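(* Let $n\ge2$ and let $f:\overline{\mathbb B}^n_0\to\mathbb R^n$ be a locally quasiconformal embedding with $$I_Q(f):=\int_{\mathbb S^{n-1}}\left(\int_0^1Q_f(tu)\frac{dt}{t}\right)^{1-n}d\sigma(u)>0.$$ Then $f$ admits cavitation at the origin.
   Context: Notation: $\mathbb B^n_0=\{x\in\mathbb R^n:0<|x|<1\}$; $\overline{\mathbb B}^n_0=\{0<|x|\le1\}$; $S_r=\{|x|=r\}$; $\mathbb S^{n-1}$ is the unit sphere with $(n-1)$-dimensional area element $d\sigma$. Convention: $(+\infty)^{1-n}=0$. Quasiconformality: a homeomorphism $f:G\to G'$ between domains of $\mathbb R^n$ is $K$-quasiconformal if $f$ is absolutely continuous on lines (ACL) in $G$ and $K_f(x)=\|f'(x)\|^n/J_f(x)\le K$ for a.e. $x\in G$, where $J_f$ is the Jacobian determinant and $\|f'(x)\|=\max_{|h|=1}|f'(x)h|$; it is quasiconformal if this holds for some $K<\infty$. A locally quasiconformal embedding $f$ of $\overline{\mathbb B}^n_0$ into $\mathbb R^n$ is an embedding that extends to a domain $G\not\ni0$ containing $\overline{\mathbb B}^n_0$ in such a way that $f$ is quasiconformal on $\{x\in G:|x|>\varepsilon\}$ for each $\varepsilon\in(0,1)$. Standing assumptions: $f$ is orientation-preserving (so $J_f>0$ a.e.), and for $0<r_1<r_2<1$ the surface $f(S_{r_1})$ lies inside $f(S_{r_2})$, i.e. in the bounded component of $\mathbb R^n\setminus f(S_{r_2})$. Cavitation: $f$ admits cavitation at the origin if the bounded connected component of $\mathbb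 R^n\setminus f(\mathbb B^n_0)$ is a non-degenerate continuum (a compact connected set with more than one point). Normal dilatation: at a regular point $x\ne0$ of $f$ (differentiable with $J_f(x)>0$; a.e. point is regular), with $u=x/|x|$ and $\partial_uf(x)=f'(x)u$, $Q_f(x)=\left(|\partial_uf(x)|^n/J_f(x)\right)^{1/(n-1)}$. *)

theory Defs
  imports "HOL-Analysis.Analysis"
begin

section \<open>Quasiconformal maps\<close>

definition jacobian :: "(real^'n \<Rightarrow> real^'n) \<Rightarrow> real^'n \<Rightarrow> real" where
  "jacobian f x = det (matrix (frechet_derivative f (at x)))"

definition is_domain :: "'a::topological_space set \<Rightarrow> bool" where
  "is_domain G \<longleftrightarrow> open G \<and> connected G \<and> G \<noteq> {}"

text \<open>Absolute continuity of a function on the compact interval \<open>{\<alpha>..\<beta>}\<close>; the library only has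
  absolute continuity of measures.\<close>

definition abs_cont_on_interval :: "real \<Rightarrow> real \<Rightarrow> (real \<Rightarrow> 'a::metric_space) \<Rightarrow> bool" where
  "abs_cont_on_interval \<alpha> \<beta> h \<longleftrightarrow>
     (\<forall>e>0. \<exists>d>0. \<forall>(N::nat) l u.
        (\<forall>k<N. \<alpha> \<le> l k \<and> l k \<le> u k \<and> u k \<le> \<beta>) \<and>
        disjoint_family_on (\<lambda>k. {l k<..<u k}) {..<N} \<and>
        (\<Sum>k<N. u k - l k) < d
        \<longrightarrow> (\<Sum>k<N. dist (h (u k)) (h (l k))) < e)"

text \<open>ACL: for every closed box \<open>cbox a b \<subseteq> G\<close> and every coordinate direction \<open>i\<close>, the map is
  absolutely continuous on almost every segment of the box parallel to the \<open>i\<close>-th axis. The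
  segments are parametrised by their projection \<open>z\<close> to the coordinate hyperplane, a point of
  \<open>\<real>\<^bsup>n-1\<^esup>\<close> whose coordinates are indexed by \<open>UNIV - {i}\<close>; ``almost every'' refers to
  \<open>(n-1)\<close>-dimensional Lebesgue measure.\<close>

definition ACL_on :: "(real^'n \<Rightarrow> real^'n) \<Rightarrow> (real^'n) set \<Rightarrow> bool" where
  "ACL_on f G \<longleftrightarrow> continuous_on G f \<and>
     (\<forall>a b i. cbox a b \<subseteq> G \<longrightarrow>
        (AE z in Pi\<^sub>M (UNIV - {i}) (\<lambda>_. lborel).
           (\<forall>j\<in>UNIV - {i}. a $ j \<le> z j \<and> z j \<le> b $ j) \<longrightarrow>
           abs_cont_on_interval (a $ i) (b $ i) (\<lambda>t. f (\<chi> j. if j = i then t else z j))))"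

text \<open>The dilatation is taken with \<open>\<bar>J\<^sub>f\<bar>\<close>, so that the notion of quasiconformality does not
  presuppose an orientation; for orientation-preserving maps (see below) this is \<open>J\<^sub>f\<close>.\<close>

definition dilatation :: "(real^'n \<Rightarrow> real^'n) \<Rightarrow> real^'n \<Rightarrow> real" where
  "dilatation f x = onorm (frechet_derivative f (at x)) ^ CARD('n) / \<bar>jacobian f x\<bar>"

text \<open>The conjuncts \<open>f differentiable at x\<close> and \<open>jacobian f x \<noteq> 0\<close> say that the dilatation is
  defined; without the latter, \<open>x / 0 = 0\<close> would let degenerate maps pass.\<close>

definition quasiconformal_with ::
  "real \<Rightarrow> (real^'n \<Rightarrow> real^'n) \<Rightarrow> (real^'n) set \<Rightarrow> (real^'n) set \<Rightarrow> bool" where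
  "quasiconformal_with K f G G' \<longleftrightarrow>
     is_domain G \<and> is_domain G' \<and> (\<exists>g. homeomorphism G G' f g) \<and> ACL_on f G \<and>
     (AE x in lebesgue. x \<in> G \<longrightarrow>
        f differentiable (at x) \<and> jacobian f x \<noteq> 0 \<and> dilatation f x \<le> K)"

definition quasiconformal :: "(real^'n \<Rightarrow> real^'n) \<Rightarrow> (real^'n) set \<Rightarrow> (real^'n) set \<Rightarrow> bool" where
  "quasiconformal f G G' \<longleftrightarrow> (\<exists>K. quasiconformal_with K f G G')"

definition regular_point :: "(real^'n \<Rightarrow> real^'n) \<Rightarrow> real^'n \<Rightarrow> bool" where
  "regular_point f x \<longleftrightarrow> f differentiable (at x) \<and> jacobian f x > 0"

text \<open>The analytic form of the notion, as usual for quasiconformal maps (to which it is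
  applied).\<close>

definition orientation_preserving_on :: "(real^'n \<Rightarrow> real^'n) \<Rightarrow> (real^'n) set \<Rightarrow> bool" where
  "orientation_preserving_on f U \<longleftrightarrow> (AE x in lebesgue. x \<in> U \<longrightarrow> regular_point f x)"

section \<open>Locally quasiconformal embeddings of the punctured ball\<close>

definition punctured_ball :: "(real^'n) set" where
  "punctured_ball = {x. 0 < norm x \<and> norm x < 1}"

definition punctured_cball :: "(real^'n) set" where
  "punctured_cball = {x. 0 < norm x \<and> norm x \<le> 1}"

text \<open>A map on the punctured closed ball is represented by a total function, whose values off that
  set are irrelevant; its extension to \<open>G\<close> is therefore a separate function \<open>F\<close>.\<close>

definition locally_qc_embedding :: "(real^'n \<Rightarrow> real^'n) \<Rightarrow> bool" where
  "locally_qc_embedding f \<longleftrightarrow>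
     (\<exists>g. homeomorphism punctured_cball (f ` punctured_cball) f g) \<and>
     (\<exists>G F. is_domain G \<and> 0 \<notin> G \<and> punctured_cball \<subseteq> G \<and>
        (\<forall>x\<in>punctured_cball. F x = f x) \<and>
        (\<forall>\<epsilon>. 0 < \<epsilon> \<and> \<epsilon> < 1 \<longrightarrow>
           quasiconformal F {x \<in> G. norm x > \<epsilon>} (F ` {x \<in> G. norm x > \<epsilon>})))"

definition nested_spheres :: "(real^'n \<Rightarrow> real^'n) \<Rightarrow> bool" where
  "nested_spheres f \<longleftrightarrow>
     (\<forall>r\<^sub>1 r\<^sub>2. 0 < r\<^sub>1 \<and> r\<^sub>1 < r\<^sub>2 \<and> r\<^sub>2 < 1 \<longrightarrow>
        f ` sphere 0 r\<^sub>1 \<subseteq> inside (f ` sphere 0 r\<^sub>2))"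

definition nondegenerate_continuum :: "'a::topological_space set \<Rightarrow> bool" where
  "nondegenerate_continuum C \<longleftrightarrow> compact C \<and> connected C \<and> (\<exists>x\<in>C. \<exists>y\<in>C. x \<noteq> y)"

definition admits_cavitation :: "(real^'n \<Rightarrow> real^'n) \<Rightarrow> bool" where
  "admits_cavitation f \<longleftrightarrow>
     (\<exists>C. {D \<in> components (- (f ` punctured_ball)). bounded D} = {C} \<and> nondegenerate_continuum C)"

section \<open>The normal dilatation and its integral\<close>

text \<open>The value \<open>0\<close> at the irregular points is immaterial: they form a null set.\<close>

definition normal_dilatation :: "(real^'n \<Rightarrow> real^'n) \<Rightarrow> real^'n \<Rightarrow> real" where
  "normal_dilatation f x =
     (if regular_point f x
      then (norm (frechet_derivative f (at x) (x /\<^sub>R norm x)) ^ CARD('n) / jacobian f x)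
             powr (1 / (real CARD('n) - 1))
      else 0)"

text \<open>The surface measure of the unit sphere, as the measure \<open>\<sigma>\<close> of polar coordinates: for a Borel
  set \<open>A\<close> of the sphere, \<open>\<sigma> A = n * vol {t *\<^sub>R u | 0 < t < 1, u \<in> A}\<close>.\<close>

definition sphere_measure :: "(real^'n) measure" where
  "sphere_measure =
     scale_measure (of_nat CARD('n))
       (distr (restrict_space lborel punctured_ball) (restrict_space borel (sphere 0 1))
          (\<lambda>x. x /\<^sub>R norm x))"

text \<open>With values in \<open>ennreal\<close>, the inner integral may be infinite, and \<open>inverse \<infinity> = 0\<close> is the
  convention \<open>(+\<infinity>)\<^bsup>1-n\<^esup> = 0\<close>.\<close>

definition I_Q :: "(real^'n \<Rightarrow> real^'n) \<Rightarrow> ennreal" where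
  "I_Q f =
     (\<integral>\<^sup>+ u. inverse (\<integral>\<^sup>+ t\<in>{0<..<1}. ennreal (normal_dilatation f (t *\<^sub>R u) / t) \<partial>lborel)
               ^ (CARD('n) - 1) \<partial>sphere_measure)"

end

theory Submission
  imports Defs
begin

text \<open>The bounded complementary component is the intersection of the fillings of the surfaces
  \<open>f(S\<^sub>r)\<close>. If it were a single point \<open>p\<close>, then \<open>f(x) \<rightarrow> p\<close> as \<open>x \<rightarrow> 0\<close>. Compose \<open>f\<close> with the
  gauge \<open>\<phi>(y) = ln (1 + ln (M / |y - p|))\<close>, which tends to infinity at \<open>p\<close> although
  \<open>\<rho> = |\<nabla>\<phi>|\<close> has a finite integral \<open>\<integral> \<rho>\<^sup>n\<close> because \<open>n \<ge> 2\<close>. By the definition of the normal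
  dilatation, the quantity \<open>P = \<rho>(f) |\<partial>\<^sub>u f|\<close> at \<open>x = t u\<close> satisfies
  \<open>P\<^sup>n = (\<rho>(f)\<^sup>n J t\<^sup>n\<^sup>-\<^sup>1) (Q / t)\<^sup>n\<^sup>-\<^sup>1\<close>, so that \<open>P \<le> \<rho>(f)\<^sup>n J t\<^sup>n\<^sup>-\<^sup>1 + Q / t\<close>.
  In polar coordinates and by the change of variables \<open>y = f(x)\<close>, the first summand has a finite
  integral along almost every ray, whereas the integral of \<open>P\<close> bounds the increments of
  \<open>\<phi> \<circ> f\<close>, which are unbounded. Hence \<open>\<integral> Q dt / t = \<infinity>\<close> on almost every ray and \<open>I\<^sub>Q(f) = 0\<close>.

  That the derivative of \<open>\<phi> \<circ> f\<close> integrates to its increments along almost every ray, and not only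
  along lines parallel to the axes, is shown by averaging over small cubes: the averages are
  continuously differentiable with the averaged partial derivatives as partials, and these converge
  in the mean, hence along almost every ray.\<close>

section \<open>The complement of the image of the punctured ball\<close>

text \<open>The second logarithm in the gauge is forced: for \<open>ln (M / |y - p|)\<close> the
  integral of the \<open>n\<close>-th power of the gradient diverges logarithmically at
  \<open>p\<close>, every annulus between radii \<open>M exp (- k - 1)\<close> and
  \<open>M exp (- k)\<close> contributing the same amount; the extra logarithm divides the
  \<open>k\<close>-th contribution by about \<open>(k + 1)^n\<close>. The bounds \<open>K\<close> of
  the dilatation hold only away from the origin and may blow up there. They serve only to make the
  derivative of the composed gauge integrable on compact shells and never enter the final estimate.
  There the factor \<open>t^(n-1)\<close> is the density of polar coordinates, so that the first
  summand is controlled up to the origin by the finite integral of the weight over the image. The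
  change of variables is applied on the set of regular points, and as an inequality, valid for every
  injective map differentiable on the set. Nesting concerns radii below 1, whereas the bounded
  component is enclosed by the surface of radius 1; extending \<open>f\<close> across the unit
  sphere makes the image open around that surface.\<close>

lemma connected_punctured_shell:
  assumes "DIM('a::euclidean_space) \<ge> 2"
  shows "connected {x::'a. r < norm x \<and> norm x < s}"
  using connected_annulus(1)[OF assms, of r 0 s] by simp

text \<open>No Jordan--Brouwer separation theorem is needed: the image of \<open>F\<close> is open, so an open set whose
  frontier is nonempty and lies on image spheres meets that image.\<close>

lemma punctured_ball_image_complement:
  fixes F :: "'a::euclidean_space \<Rightarrow> 'a"
  assumes dim: "DIM('a) \<ge> 2" and R: "R > 1"
    and cont: "continuous_on {x. 0 < norm x \<and> norm x < R} F"
    and inj: "inj_on F {x. 0 < norm x \<and> norm x < R}"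
    and nest: "\<And>r s. 0 < r \<Longrightarrow> r < s \<Longrightarrow> s < 1 \<Longrightarrow> F ` sphere 0 r \<subseteq> inside (F ` sphere 0 s)"
  obtains C where "{D \<in> components (- (F ` {x. 0 < norm x \<and> norm x < 1})). bounded D} = {C}"
    and "compact C" and "connected C" and "C \<noteq> {}"
    and "bounded (F ` {x. 0 < norm x \<and> norm x < 1})"
    and "\<And>y. C = {y} \<Longrightarrow> (F \<longlongrightarrow> y) (at 0)"
proof -

  \<comment> \<open>Surfaces \<open>K r\<close>, their fillings \<open>B r\<close>, and the two
    sides of a surface\<close>
  define U where "U = {x::'a. 0 < norm x \<and> norm x < R}"
  define K where "K r = F ` sphere 0 r" for r
  define B where "B r = K r \<union> inside (K r)" for r
  have openU: "open U"
    unfolding U_def by (intro open_Collect_conj open_Collect_less continuous_intros)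
  have open_image: "open (F ` V)" if "open V" "V \<subseteq> U" for V
    using that cont inj unfolding U_def
    by (intro invariance_of_domain) (auto intro: continuous_on_subset inj_on_subset)
  have openFU: "open (F ` U)" by (rule open_image[OF openU order_refl])
  have sphere_U: "sphere 0 r \<subseteq> U" if "0 < r" "r < R" for r
    using that by (auto simp: U_def)
  have contU: "continuous_on V F" if "V \<subseteq> U" for V
    using cont that unfolding U_def by (rule continuous_on_subset)
  have compact_K: "compact (K r)" if "0 < r" "r < R" for r
    unfolding K_def using sphere_U[OF that] by (intro compact_continuous_image contU) auto
  have connected_K: "connected (K r)" if "0 < r" "r < R" for r
    unfolding K_def using sphere_U[OF that]
    by (intro connected_continuous_image contU connected_sphere dim) auto
  have in_out: False if "p \<in> inside (K r)" "p \<in> outside (K r)" for p r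
    using that inside_Int_outside[of "K r"] by blast
  have in_K: False if "p \<in> inside (K r)" "p \<in> K r" for p r
    using that inside_no_overlap[of "K r"] by blast
  have out_K: False if "p \<in> outside (K r)" "p \<in> K r" for p r
    using that outside_no_overlap[of "K r"] by blast
  have K_ne: "K r \<noteq> {}" if "0 < r" for r
    unfolding K_def using that by simp
  have off_K: "F x \<notin> K r" if "x \<in> U" "0 < r" "r < R" "norm x \<noteq> r" for x r
  proof
    assume "F x \<in> K r"
    then obtain z where z: "z \<in> sphere 0 r" "F x = F z" unfolding K_def by blast
    then have "x = z"
      using inj_onD[OF inj, of x z] that sphere_U[OF that(2,3)] unfolding U_def by blast
    then show False using z that by simp
  qed
  \<comment> \<open>One point of the shell \<open>r < norm x < R\<close> with image in
    \<open>outside (K r)\<close> is enough, because the shell is connected and its image avoids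
    \<open>K r\<close>. Such a point exists since the frontier of \<open>outside (K r)\<close> lies
    on \<open>K r\<close>, hence in the open image of \<open>U\<close>, while points of norm at most
    \<open>r\<close> are sent to \<open>K r\<close> or to its inside.\<close>
  have outer: "F x \<in> outside (K r)"
    if r: "0 < r" "r < R" and inn: "\<And>x. x \<noteq> 0 \<Longrightarrow> norm x < r \<Longrightarrow> F x \<in> inside (K r)"
      and x: "r < norm x" "norm x < R" for r x
  proof -
    have cK: "closed (K r)" using compact_K[OF r] compact_imp_closed by blast
    have "outside (K r) \<noteq> {}"
      using unbounded_outside[of "K r"] compact_K[OF r] compact_imp_bounded by fastforce
    moreover have "outside (K r) \<noteq> UNIV" using K_ne[OF r(1)] out_K[of _ r] by blast
    ultimately have "\<not> closed (outside (K r))"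
      using clopen[of "outside (K r)"] open_outside[OF cK] by auto
    then obtain q where q: "q \<in> closure (outside (K r))" "q \<notin> outside (K r)"
      using closure_subset_eq by blast
    then have "q \<in> K r" using closure_outside_subset[OF cK] by auto
    then have "q \<in> F ` U" using sphere_U[OF r] by (auto simp: K_def)
    then have "outside (K r) \<inter> F ` U \<noteq> {}"
      using q(1) openFU open_Int_closure_eq_empty[of "F ` U" "outside (K r)"] by blast
    then obtain z where z: "z \<in> U" "F z \<in> outside (K r)" by blast
    have "norm z > r"
    proof (rule ccontr)
      assume "\<not> norm z > r"
      then consider "norm z = r" | "norm z < r" by linarith
      then show False
      proof cases
        case 1
        then have "F z \<in> K r" by (auto simp: K_def)
        then show ?thesis using z(2) out_K by blast
      next
        case 2
        then have "F z \<in> inside (K r)" using inn z(1) by (auto simp: U_def)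
        then show ?thesis using z(2) in_out by blast
      qed
    qed
    have "connected_component (- K r) (F z) (F x)"
      unfolding connected_component_def
    proof (intro exI conjI)
      show "connected (F ` {x. r < norm x \<and> norm x < R})"
        using r by (intro connected_continuous_image contU connected_punctured_shell dim)
          (auto simp: U_def)
      show "F ` {x. r < norm x \<and> norm x < R} \<subseteq> - K r"
      proof (rule image_subsetI)
        fix x :: 'a assume "x \<in> {x. r < norm x \<and> norm x < R}"
        then have "x \<in> U" "norm x \<noteq> r" using r unfolding U_def mem_Collect_eq by linarith+
        then show "F x \<in> - K r" using off_K[of x r] r by blast
      qed
    qed (use \<open>norm z > r\<close> z x in \<open>auto simp: U_def\<close>)
    then show ?thesis using z(2) outside_same_component by blast
  qed
  have inner_lt: "F x \<in> inside (K r)" if "x \<noteq> 0" "norm x < r" "r < 1" for x r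
  proof -
    have "F x \<in> F ` sphere 0 (norm x)" by auto
    then show ?thesis using nest[of "norm x" r] that unfolding K_def by auto
  qed
  \<comment> \<open>Nesting is assumed only for radii below 1. If \<open>F x\<close> were outside
    \<open>K 1\<close>, a path in \<open>outside (K 1)\<close> would join it to a far point
    \<open>w\<close>; being compact, the path also misses \<open>K s\<close> for \<open>s\<close>
    close to 1, so that \<open>w\<close> would lie inside \<open>K s\<close>, although
    \<open>K s\<close> is contained in a ball that excludes \<open>w\<close>.\<close>
  have inner_1: "F x \<in> inside (K 1)" if x: "x \<noteq> 0" "norm x < 1" for x
  proof (rule ccontr)
    assume "F x \<notin> inside (K 1)"
    moreover have "F x \<notin> K 1" using off_K[of x 1] x R by (auto simp: U_def)
    ultimately have Fx: "F x \<in> outside (K 1)" using inside_Un_outside[of "K 1"] by blast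
    define m where "m = (1 + norm x) / 2"
    have m: "norm x < m" "m < 1" "0 < m"
      using x unfolding m_def by (auto intro: add_pos_nonneg)
    have "compact ({x::'a. m \<le> norm x \<and> norm x \<le> 1})"
    proof -
      have "{x::'a. m \<le> norm x \<and> norm x \<le> 1} = cball 0 1 - ball 0 m" by auto
      then show ?thesis by (simp add: compact_diff)
    qed
    then have "compact (F ` {x. m \<le> norm x \<and> norm x \<le> 1})"
      using m R by (intro compact_continuous_image contU) (auto simp: U_def)
    from bounded_subset_ballD[OF compact_imp_bounded[OF this], of 0]
    obtain b where b: "F ` {x. m \<le> norm x \<and> norm x \<le> 1} \<subseteq> cball 0 b"
      using ball_subset_cball by blast
    have "compact (K 1)" using compact_K[of 1] R by auto
    then have "\<not> bounded (outside (K 1))"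
      using unbounded_outside compact_imp_bounded by blast
    then obtain w where w: "w \<in> outside (K 1)" "w \<notin> cball 0 b"
      using bounded_subset[OF bounded_cball, of "outside (K 1)" 0 b] by blast
    have "path_connected (outside (K 1))"
      using \<open>compact (K 1)\<close> dim
      by (simp add: connected_outside connected_open_path_connected open_outside
          compact_imp_closed compact_imp_bounded)
    then obtain g where g: "path g" "path_image g \<subseteq> outside (K 1)" "pathstart g = F x"
      "pathfinish g = w"
      using Fx w unfolding path_connected_def by blast
    define V where "V = U \<inter> F -` (- path_image g)"
    have "open V"
      unfolding V_def
      by (intro continuous_open_preimage contU openU order_refl)
        (use g(1) closed_path_image in auto)
    moreover have "sphere 0 1 \<subseteq> V"
      using g(2) out_K[of _ 1] sphere_U[of 1] R unfolding V_def K_def by fastforce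
    ultimately obtain e where e: "e > 0" "(\<Union>z\<in>sphere 0 1. ball z e) \<subseteq> V"
      using compact_subset_open_imp_ball_epsilon_subset[of "sphere 0 1" V] by (metis compact_sphere)
    \<comment> \<open>The bound \<open>m\<close> gives \<open>norm x < s\<close> and keeps
      \<open>K s\<close> in the ball of radius \<open>b\<close>; the bound \<open>1 - e / 2\<close>
      puts every point of norm \<open>s\<close> within \<open>e\<close> of the unit sphere, hence in
      \<open>V\<close>.\<close>
    define s where "s = max m (1 - e / 2)"
    have s: "norm x < s" "s < 1" "m \<le> s" "0 < s" "1 - s < e"
      using m e by (auto simp: s_def)
    have disj: "path_image g \<inter> K s = {}"
    proof -
      have "F z \<notin> path_image g" if "norm z = s" for z
      proof -
        have "dist (z /\<^sub>R s) z = norm ((1 / s - 1) *\<^sub>R z)"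
          unfolding dist_norm by (simp add: algebra_simps divide_inverse)
        also have "\<dots> = 1 - s" using that s by (simp add: field_simps)
        finally have "z \<in> ball (z /\<^sub>R s) e" using s by simp
        moreover have "z /\<^sub>R s \<in> sphere 0 1" using that s by simp
        ultimately have "z \<in> V" using e by blast
        then show ?thesis by (simp add: V_def)
      qed
      then show ?thesis by (auto simp: K_def)
    qed
    have "connected_component (- K s) (F x) w"
      unfolding connected_component_def
    proof (intro exI conjI)
      show "connected (path_image g)" using g(1) by (rule connected_path_image)
      show "F x \<in> path_image g" "w \<in> path_image g"
        using g(3,4) pathstart_in_path_image[of g] pathfinish_in_path_image[of g] by auto
    qed (use disj in blast)
    then have "w \<in> inside (K s)"
      using inner_lt[of x s] s x inside_same_component by blast
    moreover have "w \<in> outside (K s)"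
    proof -
      have "K s \<subseteq> cball 0 b" using b s by (auto simp: K_def)
      then show ?thesis using outside_subset_convex[of "cball 0 b" "K s"] w by auto
    qed
    ultimately show False using in_out by blast
  qed
  have inner: "F x \<in> inside (K r)" if "x \<noteq> 0" "norm x < r" "r \<le> 1" for x r
    using that inner_1 inner_lt by (cases "r = 1") auto
  have outer': "F x \<in> outside (K r)" if "0 < r" "r \<le> 1" "r < norm x" "norm x < R" for x r
    using outer[of r x] inner that R by auto
  \<comment> \<open>In terms of complements, \<open>K s \<union> outside (K s)\<close> has to lie in
    \<open>outside (K r)\<close>: it is connected, misses \<open>K r\<close>, and contains
    \<open>K s\<close>, which lies there by \<open>outer'\<close>.\<close>
  have B_subset: "B r \<subseteq> inside (K s)" if rs: "0 < r" "r < s" "s \<le> 1" for r s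
  proof -
    have c: "closed (K s)" "bounded (K s)" "connected (K s)"
      using compact_K[of s] connected_K[of s] rs R compact_imp_closed compact_imp_bounded by auto
    have Kr: "K r \<subseteq> inside (K s)" using inner rs by (auto simp: K_def)
    have Ks: "K s \<subseteq> outside (K r)" using outer' rs R by (auto simp: K_def)
    have conn: "connected (K s \<union> outside (K s))" by (rule connected_with_outside) (use c in auto)
    have sub: "K s \<union> outside (K s) \<subseteq> - K r"
      using Kr Ks in_out[of _ s] in_K[of _ s] by blast
    obtain y where y: "y \<in> K s" using K_ne rs by fastforce
    have "p \<in> outside (K r)" if "p \<in> K s \<union> outside (K s)" for p
    proof -
      have "connected_component (- K r) y p"
        unfolding connected_component_def using conn sub y that by blast
      then show ?thesis using outside_same_component y Ks by blast
    qed
    then have "K s \<union> outside (K s) \<subseteq> outside (K r)" by blast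
    then show ?thesis
      unfolding B_def union_with_inside[of "K r"] inside_outside[of "K s"] by blast
  qed
  have compact_B: "compact (B r)" and connected_B: "connected (B r)" and ne_B: "B r \<noteq> {}"
    if r: "0 < r" "r \<le> 1" for r
  proof -
    have c: "compact (K r)" "connected (K r)"
      using compact_K[of r] connected_K[of r] r R by auto
    then have "closed (B r)"
      unfolding B_def union_with_inside by (intro closed_Compl open_outside compact_imp_closed)
    moreover have "bounded (B r)"
      by (simp add: B_def bounded_inside compact_imp_bounded[OF c(1)])
    ultimately show "compact (B r)" using compact_eq_bounded_closed by blast
    show "connected (B r)" unfolding B_def
      by (rule connected_with_inside) (use c compact_imp_closed in auto)
    show "B r \<noteq> {}" using K_ne r by (auto simp: B_def)
  qed
  \<comment> \<open>A counterexample \<open>p\<close> would belong to \<open>A\<close>, the part of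
    the region between \<open>K r\<close> and \<open>K 1\<close> that the closed shell misses. This
    set is open and disjoint from the open image of \<open>U\<close>; a limit point outside
    \<open>A\<close> would lie on \<open>K 1\<close>, \<open>K r\<close> or \<open>Sh\<close>, all
    contained in that image. So \<open>A\<close> is clopen, and being different from the whole space
    it is empty.\<close>
  have fill: "p \<in> inside (K r)" if p: "p \<in> inside (K 1)" "p \<notin> F ` {x. 0 < norm x \<and> norm x < 1}"
    and r: "0 < r" "r < 1" for p r
  proof (rule ccontr)
    assume np: "p \<notin> inside (K r)"
    define Sh where "Sh = F ` {x. r \<le> norm x \<and> norm x \<le> 1}"
    define A where "A = inside (K 1) \<inter> outside (K r) - Sh"
    have shell: "compact {x::'a. r \<le> norm x \<and> norm x \<le> 1}"
    proof -
      have "{x::'a. r \<le> norm x \<and> norm x \<le> 1} = cball 0 1 - ball 0 r" by auto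
      then show ?thesis by (simp add: compact_diff)
    qed
    have "compact Sh"
      unfolding Sh_def using shell r R by (intro compact_continuous_image contU) (auto simp: U_def)
    have cl: "closed (K 1)" "closed (K r)"
      using compact_K[of 1] compact_K[of r] r R compact_imp_closed by auto
    have "open A" unfolding A_def
      by (intro open_Diff open_Int open_inside open_outside cl compact_imp_closed \<open>compact Sh\<close>)
    have disj: "A \<inter> F ` U = {}"
    proof (rule ccontr)
      assume "A \<inter> F ` U \<noteq> {}"
      then obtain x where x: "x \<in> U" "F x \<in> A" by blast
      consider "norm x < r" | "r \<le> norm x" "norm x \<le> 1" | "norm x > 1" by linarith
      then show False
      proof cases
        case 1
        then have "F x \<in> inside (K r)" using inner x(1) r by (auto simp: U_def)
        then show ?thesis using x(2) in_out unfolding A_def by blast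
      next
        case 2 then show ?thesis using x(2) by (auto simp: A_def Sh_def)
      next
        case 3
        then have "F x \<in> outside (K 1)" using outer' x(1) R by (auto simp: U_def)
        then show ?thesis using x(2) in_out unfolding A_def by blast
      qed
    qed
    have "closure A \<subseteq> A"
    proof
      fix q assume q: "q \<in> closure A"
      have "closure A \<inter> F ` U = {}"
        using disj openFU open_Int_closure_eq_empty[of "F ` U" A] by blast
      then have nU: "q \<notin> F ` U" using q by auto
      have sub: "Sh \<subseteq> F ` U" "K 1 \<subseteq> F ` U" "K r \<subseteq> F ` U"
        using r R by (auto simp: Sh_def K_def U_def)
      have "q \<in> closure (inside (K 1))" "q \<in> closure (outside (K r))"
        using q closure_mono[of A "inside (K 1)"] closure_mono[of A "outside (K r)"]
        unfolding A_def by auto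
      then show "q \<in> A"
        using closure_inside_subset[OF cl(1)] closure_outside_subset[OF cl(2)] nU sub
        unfolding A_def by blast
    qed
    then have "closed A" using closure_subset_eq by blast
    then have "A = {} \<or> A = UNIV" using clopen \<open>open A\<close> by blast
    moreover have "A \<noteq> UNIV"
      using K_ne[of 1] in_K[of _ 1] unfolding A_def by fastforce
    ultimately have "A = {}" by simp
    moreover have "p \<notin> Sh"
    proof
      assume "p \<in> Sh"
      then obtain x where "p = F x" "r \<le> norm x" "norm x \<le> 1" by (auto simp: Sh_def)
      then have "norm x = 1" using p(2) r by force
      then have "p \<in> K 1" using \<open>p = F x\<close> by (auto simp: K_def)
      then show False using p(1) in_K by blast
    qed
    moreover have "p \<notin> K r" using p(2) r by (auto simp: K_def)
    then have "p \<in> outside (K r)" using np inside_Un_outside[of "K r"] by blast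
    ultimately show False using p(1) by (auto simp: A_def)
  qed

  \<comment> \<open>The components of the complement and the limit of \<open>F\<close> at the
    origin\<close>
  define \<Omega> where "\<Omega> = F ` {x. 0 < norm x \<and> norm x < 1}"
  \<comment> \<open>A countable family of radii tending to 0; the shift by 2 keeps
    \<open>s 0 = 1 / 2\<close> strictly below 1, so that already \<open>B (s 0)\<close> lies inside
    \<open>K 1\<close>.\<close>
  define s where "s n = 1 / (real n + 2)" for n
  have s: "0 < s n" "s n < 1" for n by (auto simp: s_def)
  have s_mono: "s n \<le> s m" if "m \<le> n" for m n
    using that by (auto simp: s_def frac_le)
  have s_small: "\<exists>n. s n < e" if "e > 0" for e :: real
  proof -
    obtain n where "inverse (real (Suc n)) < e" using reals_Archimedean \<open>e > 0\<close> by blast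
    moreover have "s n \<le> inverse (real (Suc n))" by (simp add: s_def divide_simps)
    ultimately show ?thesis by (intro exI[of _ n]) linarith
  qed
  have B_mono: "B (s n) \<subseteq> B (s m)" if "m \<le> n" for m n
  proof (cases "s n = s m")
    case False
    then have "s n < s m" using s_mono[OF that] by simp
    then show ?thesis using B_subset[of "s n" "s m"] s[of n] s[of m] by (auto simp: B_def)
  qed simp
  define C where "C = (\<Inter>n. B (s n))"
  define E where "E = K 1 \<union> outside (K 1)"
  have K1: "compact (K 1)" "connected (K 1)" using compact_K[of 1] connected_K[of 1] R by auto
  have "compact C" unfolding C_def using compact_B s by (intro compact_Inter) (auto simp: less_imp_le)
  have "connected C" unfolding C_def
    using compact_B connected_B s B_mono by (intro connected_nest) (auto simp: less_imp_le)
  have "C \<noteq> {}" unfolding C_def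
    using compact_B ne_B s B_mono by (intro compact_nest) (auto simp: less_imp_le)
  have "connected E" unfolding E_def using K1 by (intro connected_with_outside compact_imp_closed)
  have "closed E" unfolding E_def
    using open_inside[OF compact_imp_closed[OF K1(1)]] by (simp add: union_with_outside closed_Compl)
  have "\<not> bounded E" unfolding E_def
    using unbounded_outside compact_imp_bounded[OF K1(1)] by simp
  have "C \<inter> E = {}"
  proof -
    have "C \<subseteq> B (s 0)" by (auto simp: C_def)
    also have "\<dots> \<subseteq> inside (K 1)" using B_subset s by simp
    finally show ?thesis
      using in_out[of _ 1] in_K[of _ 1] unfolding E_def by blast
  qed
  have compl: "- \<Omega> = C \<union> E"
  proof
    show "- \<Omega> \<subseteq> C \<union> E"
      using fill s inside_Un_outside[of "K 1"] unfolding C_def E_def B_def \<Omega>_def by blast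
    have "F x \<notin> C" if x: "0 < norm x" "norm x < 1" for x
    proof -
      obtain n where "s n < norm x" using s_small x by blast
      then have "F x \<in> outside (K (s n))" using outer'[of "s n" x] s[of n] x R by auto
      then have "F x \<notin> B (s n)" by (simp add: B_def union_with_inside)
      then show ?thesis by (auto simp: C_def)
    qed
    moreover have "F x \<notin> E" if x: "0 < norm x" "norm x < 1" for x
      using inner_1[of x] x by (auto simp: E_def union_with_outside)
    ultimately show "C \<union> E \<subseteq> - \<Omega>" by (auto simp: \<Omega>_def)
  qed
  have dich: "D \<subseteq> C \<or> D \<subseteq> E" if "connected D" "D \<subseteq> C \<union> E" for D
  proof -
    have "C \<inter> D = {} \<or> E \<inter> D = {}"
      using \<open>C \<inter> E = {}\<close>
      by (intro connected_closedD that compact_imp_closed \<open>compact C\<close> \<open>closed E\<close>) auto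
    then show ?thesis using that(2) by blast
  qed
  have comp: "D = C \<or> D = E" if D: "D \<in> components (- \<Omega>)" for D
  proof -
    have "D \<noteq> {}" "connected D" "D \<subseteq> C \<union> E"
      using in_components_nonempty[OF D] in_components_connected[OF D]
        in_components_subset[OF D] compl by auto
    then consider "D \<subseteq> C" | "D \<subseteq> E" using dich by blast
    then show ?thesis
    proof cases
      case 1
      then have "C \<subseteq> D"
        using components_maximal[OF D \<open>connected C\<close>] compl \<open>D \<noteq> {}\<close> by blast
      then show ?thesis using 1 by blast
    next
      case 2
      then have "E \<subseteq> D"
        using components_maximal[OF D \<open>connected E\<close>] compl \<open>D \<noteq> {}\<close> by blast
      then show ?thesis using 2 by blast
    qed
  qed
  have "C \<in> components (- \<Omega>)"
  proof -
    obtain c where c: "c \<in> C" using \<open>C \<noteq> {}\<close> by blast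
    then obtain D where D: "D \<in> components (- \<Omega>)" "c \<in> D"
      using Union_components[of "- \<Omega>"] compl by blast
    then have "D = C" using comp[OF D(1)] c \<open>C \<inter> E = {}\<close> by blast
    then show ?thesis using D by simp
  qed
  then have "{D \<in> components (- \<Omega>). bounded D} = {C}"
    using comp \<open>\<not> bounded E\<close> compact_imp_bounded[OF \<open>compact C\<close>] by auto
  moreover have "(F \<longlongrightarrow> y) (at 0)" if y: "C = {y}" for y
  proof (rule tendstoI)
    fix e :: real assume "e > 0"
    \<comment> \<open>The compact sets \<open>B (s n) - ball y e\<close> decrease and have empty
      intersection when \<open>C = {y}\<close>, so one of them is empty; the filling
      \<open>B (s n)\<close> contains every \<open>F x\<close> with
      \<open>0 < norm x < s n\<close>.\<close>
    have "\<exists>n. B (s n) \<subseteq> ball y e"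
    proof (rule ccontr)
      assume "\<nexists>n. B (s n) \<subseteq> ball y e"
      then have "(\<Inter>n. B (s n) - ball y e) \<noteq> {}"
      proof (intro compact_nest)
        show "compact (B (s n) - ball y e)" for n
          using compact_B s by (intro compact_diff) (auto simp: less_imp_le)
        show "B (s n) - ball y e \<subseteq> B (s m) - ball y e" if "m \<le> n" for m n
          using B_mono[OF that] by blast
      qed (use \<open>\<nexists>n. B (s n) \<subseteq> ball y e\<close> in blast)
      then obtain p where "\<And>n. p \<in> B (s n) - ball y e" by blast
      then have "p \<in> C" "p \<notin> ball y e" by (auto simp: C_def)
      then show False using y \<open>e > 0\<close> by auto
    qed
    then obtain n where n: "B (s n) \<subseteq> ball y e" by blast
    have "dist (F x) y < e" if "x \<noteq> 0" "dist x 0 < s n" for x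
    proof -
      have "F x \<in> B (s n)" using inner[of x "s n"] that s[of n] by (auto simp: B_def)
      then show ?thesis using n by (auto simp: dist_commute)
    qed
    then show "\<forall>\<^sub>F x in at 0. dist (F x) y < e"
      unfolding eventually_at using s[of n] by blast
  qed
  moreover have "bounded \<Omega>"
  proof (rule bounded_subset)
    show "bounded (inside (K 1))" using K1(1) by (intro bounded_inside compact_imp_bounded)
    show "\<Omega> \<subseteq> inside (K 1)" using inner_1 by (auto simp: \<Omega>_def)
  qed
  ultimately show thesis
    using that[of C] \<open>compact C\<close> \<open>connected C\<close> \<open>C \<noteq> {}\<close> unfolding \<Omega>_def by blast
qed

section \<open>Polar coordinates\<close>

lemma nn_integral_lborel_scaleR:
  fixes f :: "'a::euclidean_space \<Rightarrow> ennreal"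
  assumes [measurable]: "f \<in> borel_measurable borel" and "c > 0"
  shows "(\<integral>\<^sup>+ x. f x \<partial>lborel) = (\<integral>\<^sup>+ x. ennreal (c ^ DIM('a)) * f (c *\<^sub>R x) \<partial>lborel)"
  using assms(2)
  by (subst lborel_affine[of c 0]) (simp_all add: nn_integral_density nn_integral_distr)

text \<open>An antiderivative is \<open>- 1 / s ^ n\<close>. The value cancels the factor
  \<open>norm y ^ n\<close> that remains when the auxiliary scale \<open>s\<close> is integrated out
  in the polar formula.\<close>

lemma nn_integral_inverse_power_tail:
  fixes r :: real
  assumes "r > 0" "n > 0"
  shows "(\<integral>\<^sup>+ s. ennreal (if r < s then real n / s ^ Suc n else 0) \<partial>lborel) = ennreal (1 / r ^ n)"
proof -
  have "(\<integral>\<^sup>+ s. ennreal (if r < s then real n / s ^ Suc n else 0) \<partial>lborel) =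
      (\<integral>\<^sup>+ s. ennreal (real n / s ^ Suc n) * indicator {r..} s \<partial>lborel)"
    using AE_lborel_singleton[of r]
    by (intro nn_integral_cong_AE) (auto simp: indicator_def elim!: eventually_mono)
  also have "\<dots> = ennreal (0 - (- (1 / r ^ n)))"
  proof (rule nn_integral_FTC_atLeast)
    fix s assume "r \<le> s"
    then have "s > 0" using assms by simp
    have "((\<lambda>s. - inverse (s ^ n)) has_real_derivative - (- (inverse (s ^ n) * (real n * s ^ (n - Suc 0)) * inverse (s ^ n)))) (at s)"
      using \<open>s > 0\<close> by (intro derivative_eq_intros refl) auto
    also have "- (- (inverse (s ^ n) * (real n * s ^ (n - Suc 0)) * inverse (s ^ n))) = real n / s ^ Suc n"
    proof -
      have "s ^ n = s * s ^ (n - Suc 0)" using \<open>n > 0\<close> by (metis Suc_pred' One_nat_def power_Suc)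
      then show ?thesis using \<open>s > 0\<close> by (simp add: field_simps)
    qed
    finally show "((\<lambda>s. - (1 / s ^ n)) has_real_derivative real n / s ^ Suc n) (at s)"
      by (simp add: inverse_eq_divide)
    show "0 \<le> real n / s ^ Suc n" using \<open>s > 0\<close> by simp
  next
    have "((\<lambda>s::real. inverse (s ^ n)) \<longlongrightarrow> 0) at_top"
      using assms(2) by (intro tendsto_inverse_0_at_top filterlim_pow_at_top filterlim_ident) auto
    then show "((\<lambda>s::real. - (1 / s ^ n)) \<longlongrightarrow> 0) at_top"
      by (auto simp: inverse_eq_divide dest: tendsto_minus)
  qed (use assms in \<open>auto intro!: borel_measurable_divide\<close>)
  finally show ?thesis by simp
qed

lemma ennreal_of_nat_mult:
  "0 \<le> a \<Longrightarrow> 0 \<le> b \<Longrightarrow> of_nat n * (ennreal a * ennreal b) = ennreal (real n * (a * b))"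
  by (simp add: ennreal_mult ennreal_of_nat_eq_real_of_nat)

lemma sets_sphere_measure: "sets sphere_measure = sets (restrict_space borel (sphere 0 1))"
  by (simp add: sphere_measure_def)

lemma space_sphere_measure: "space sphere_measure = sphere 0 1"
  by (simp add: sphere_measure_def space_scale_measure space_restrict_space)

abbreviation radial_weight :: "nat \<Rightarrow> real \<Rightarrow> ennreal" where
  "radial_weight n t \<equiv> ennreal (if 0 < t \<and> t < 1 then t ^ (n - 1) else 0)"

text \<open>Radial projection in the definition of \<open>\<sigma>\<close>, two changes of scale and Tonelli's theorem replace
  the usual generator argument.\<close>

lemma polar_nn_integral:
  fixes h :: "real^'n \<Rightarrow> ennreal"
  assumes [measurable]: "h \<in> borel_measurable borel"
  shows "(\<integral>\<^sup>+ u. (\<integral>\<^sup>+ t. h (t *\<^sub>R u) * radial_weight CARD('n) t \<partial>lborel)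
            \<partial>sphere_measure) = (\<integral>\<^sup>+ x. h x * indicator punctured_ball x \<partial>lborel)"
proof -
  let ?n = "CARD('n)"
  define k where "k u t = h (t *\<^sub>R u) * radial_weight ?n t"
    for u :: "real^'n" and t :: real
  have n: "?n > 0" by simp
  have [measurable]: "(\<lambda>(u, t). k u t) \<in> borel_measurable (borel \<Otimes>\<^sub>M borel)"
    unfolding k_def by measurable
  have [measurable]: "punctured_ball \<in> sets (borel :: (real^'n) measure)"
    unfolding punctured_ball_def by measurable
  have proj: "(\<lambda>x. x /\<^sub>R norm x) \<in> restrict_space lborel (punctured_ball :: (real^'n) set)
      \<rightarrow>\<^sub>M restrict_space borel (sphere 0 1)"
    by (rule measurable_restrict_space3) (auto simp: punctured_ball_def)
  have [measurable]: "(\<lambda>u. \<integral>\<^sup>+ t. k u t \<partial>lborel) \<in> borel_measurable (borel :: (real^'n) measure)"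
    by measurable
  \<comment> \<open>The weight left by the substitution \<open>t = s * norm x\<close>: the factor
    \<open>n\<close> of \<open>sphere_measure\<close>, the factor \<open>norm x\<close> from the
    differential, and \<open>(s * norm x) ^ (n - 1)\<close> from the radial weight.\<close>
  define w where "w x s = (if 0 < norm x \<and> norm x < 1 \<and> 0 < s \<and> s * norm x < 1
      then real ?n * norm x ^ ?n * s ^ (?n - 1) else 0)" for x :: "real^'n" and s :: real
  have [measurable]: "(\<lambda>(x, s). w x s) \<in> borel_measurable (borel \<Otimes>\<^sub>M borel)"
    unfolding w_def by measurable
  have G: "(\<lambda>u. \<integral>\<^sup>+ t. k u t \<partial>lborel) \<in> borel_measurable (restrict_space borel (sphere (0::real^'n) 1))"
    by (rule measurable_restrict_space1) measurable
  have "(\<integral>\<^sup>+ u. (\<integral>\<^sup>+ t. k u t \<partial>lborel) \<partial>sphere_measure) =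
      of_nat ?n * (\<integral>\<^sup>+ u. (\<integral>\<^sup>+ t. k u t \<partial>lborel)
        \<partial>distr (restrict_space lborel punctured_ball) (restrict_space borel (sphere 0 1)) (\<lambda>x. x /\<^sub>R norm x))"
    unfolding sphere_measure_def using G by (intro nn_integral_scale_measure) simp
  also have "\<dots> = of_nat ?n * (\<integral>\<^sup>+ x. (\<integral>\<^sup>+ t. k (x /\<^sub>R norm x) t \<partial>lborel) \<partial>restrict_space lborel punctured_ball)"
    using G by (subst nn_integral_distr[OF proj]) simp_all
  also have "\<dots> = of_nat ?n * (\<integral>\<^sup>+ x. (\<integral>\<^sup>+ t. k (x /\<^sub>R norm x) t \<partial>lborel) * indicator punctured_ball x \<partial>lborel)"
    by (subst nn_integral_restrict_space) auto
  also have "\<dots> = (\<integral>\<^sup>+ x. of_nat ?n * ((\<integral>\<^sup>+ t. k (x /\<^sub>R norm x) t \<partial>lborel) * indicator punctured_ball x) \<partial>lborel)"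
    by (subst nn_integral_cmult) auto
  also have "\<dots> = (\<integral>\<^sup>+ x. (\<integral>\<^sup>+ s. h (s *\<^sub>R x) * ennreal (w x s) \<partial>lborel) \<partial>lborel)"
  proof (rule nn_integral_cong)
    fix x :: "real^'n"
    show "of_nat ?n * ((\<integral>\<^sup>+ t. k (x /\<^sub>R norm x) t \<partial>lborel) * indicator punctured_ball x) =
        (\<integral>\<^sup>+ s. h (s *\<^sub>R x) * ennreal (w x s) \<partial>lborel)"
    proof (cases "x \<in> punctured_ball")
      case True
      then have x: "0 < norm x" "norm x < 1" by (auto simp: punctured_ball_def)
      have "(\<integral>\<^sup>+ t. k (x /\<^sub>R norm x) t \<partial>lborel) =
          ennreal \<bar>norm x\<bar> * (\<integral>\<^sup>+ s. k (x /\<^sub>R norm x) (0 + norm x * s) \<partial>lborel)"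
        using x by (intro nn_integral_real_affine) auto
      also have "\<dots> = (\<integral>\<^sup>+ s. ennreal (norm x) * k (x /\<^sub>R norm x) (norm x * s) \<partial>lborel)"
        by (subst nn_integral_cmult) auto
      finally have "of_nat ?n * (\<integral>\<^sup>+ t. k (x /\<^sub>R norm x) t \<partial>lborel) =
          (\<integral>\<^sup>+ s. of_nat ?n * (ennreal (norm x) * k (x /\<^sub>R norm x) (norm x * s)) \<partial>lborel)"
        by (simp add: nn_integral_cmult)
      also have "\<dots> = (\<integral>\<^sup>+ s. h (s *\<^sub>R x) * ennreal (w x s) \<partial>lborel)"
      proof (rule nn_integral_cong)
        fix s :: real
        have pos: "0 < norm x * s \<longleftrightarrow> 0 < s" using x by (simp add: zero_less_mult_iff)
        have "norm x ^ ?n = norm x * norm x ^ (?n - 1)"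
          using n by (metis Suc_pred' One_nat_def power_Suc)
        then have "real ?n * (norm x * (if 0 < norm x * s \<and> norm x * s < 1 then (norm x * s) ^ (?n - 1) else 0))
            = w x s"
          using x unfolding w_def pos by (simp add: power_mult_distrib mult_ac)
        then have "of_nat ?n * (ennreal (norm x) *
            ennreal (if 0 < norm x * s \<and> norm x * s < 1 then (norm x * s) ^ (?n - 1) else 0)) = ennreal (w x s)"
          using x by (subst ennreal_of_nat_mult) (auto intro!: mult_nonneg_nonneg)
        moreover have "(norm x * s) *\<^sub>R (x /\<^sub>R norm x) = s *\<^sub>R x" using x by simp
        moreover have "of_nat ?n * (ennreal (norm x) * k (x /\<^sub>R norm x) (norm x * s)) =
            h ((norm x * s) *\<^sub>R (x /\<^sub>R norm x)) * (of_nat ?n * (ennreal (norm x) *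
            ennreal (if 0 < norm x * s \<and> norm x * s < 1 then (norm x * s) ^ (?n - 1) else 0)))"
          unfolding k_def by (simp only: mult_ac)
        ultimately show "of_nat ?n * (ennreal (norm x) * k (x /\<^sub>R norm x) (norm x * s)) =
            h (s *\<^sub>R x) * ennreal (w x s)"
          by (simp only:)
      qed
      finally show ?thesis using True by simp
    next
      case False
      then show ?thesis by (auto simp: w_def punctured_ball_def)
    qed
  qed
  also have "\<dots> = (\<integral>\<^sup>+ s. (\<integral>\<^sup>+ x. h (s *\<^sub>R x) * ennreal (w x s) \<partial>lborel) \<partial>lborel)"
    by (rule lborel_pair.Fubini') measurable
  \<comment> \<open>For fixed \<open>s\<close> the substitution \<open>y = s x\<close> exchanges the
    two constraints: \<open>norm x < 1\<close> becomes \<open>norm y < s\<close>, and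
    \<open>s * norm x < 1\<close> becomes \<open>norm y < 1\<close>.\<close>
  also have "\<dots> = (\<integral>\<^sup>+ s. (\<integral>\<^sup>+ y. h y * indicator punctured_ball y * ennreal (norm y ^ ?n) *
      ennreal (if norm y < s then real ?n / s ^ Suc ?n else 0) \<partial>lborel) \<partial>lborel)"
  proof (rule nn_integral_cong)
    fix s :: real
    show "(\<integral>\<^sup>+ x. h (s *\<^sub>R x) * ennreal (w x s) \<partial>lborel) =
      (\<integral>\<^sup>+ y. h y * indicator punctured_ball y * ennreal (norm y ^ ?n) *
      ennreal (if norm y < s then real ?n / s ^ Suc ?n else 0) \<partial>lborel)"
    proof (cases "s > 0")
      case True
      have "(\<integral>\<^sup>+ x. h (s *\<^sub>R x) * ennreal (w x s) \<partial>lborel) =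
          (\<integral>\<^sup>+ y. ennreal ((1 / s) ^ ?n) * (h (s *\<^sub>R (1 / s) *\<^sub>R y) * ennreal (w ((1 / s) *\<^sub>R y) s)) \<partial>lborel)"
        using True by (subst nn_integral_lborel_scaleR[of _ "1 / s"]) auto
      also have "\<dots> = (\<integral>\<^sup>+ y. h y * indicator punctured_ball y * ennreal (norm y ^ ?n) *
        ennreal (if norm y < s then real ?n / s ^ Suc ?n else 0) \<partial>lborel)"
      proof (rule nn_integral_cong)
        fix y :: "real^'n"
        have sn: "s ^ ?n = s * s ^ (?n - 1)" using n by (metis Suc_pred' One_nat_def power_Suc)
        have eq: "(1 / s) ^ ?n * w ((1 / s) *\<^sub>R y) s = indicator punctured_ball y * norm y ^ ?n *
            (if norm y < s then real ?n / s ^ Suc ?n else 0)"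
          using True sn
          by (auto simp: w_def punctured_ball_def indicator_def power_divide field_simps)
        have eq': "ennreal ((1 / s) ^ ?n) * ennreal (w ((1 / s) *\<^sub>R y) s) =
            indicator punctured_ball y * ennreal (norm y ^ ?n) *
            ennreal (if norm y < s then real ?n / s ^ Suc ?n else 0)"
        proof -
          have "indicator punctured_ball y * ennreal (norm y ^ ?n) *
            ennreal (if norm y < s then real ?n / s ^ Suc ?n else 0) = ennreal (indicator punctured_ball y
              * norm y ^ ?n * (if norm y < s then real ?n / s ^ Suc ?n else 0))"
            using True by (subst ennreal_mult, simp, simp)+ (simp add: ennreal_indicator)
          moreover have "ennreal ((1 / s) ^ ?n) * ennreal (w ((1 / s) *\<^sub>R y) s) =
              ennreal ((1 / s) ^ ?n * w ((1 / s) *\<^sub>R y) s)"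
            using True by (intro ennreal_mult[symmetric]) (auto simp: w_def)
          ultimately show ?thesis using eq by simp
        qed
        show "ennreal ((1 / s) ^ ?n) * (h (s *\<^sub>R (1 / s) *\<^sub>R y) * ennreal (w ((1 / s) *\<^sub>R y) s)) =
            h y * indicator punctured_ball y * ennreal (norm y ^ ?n) *
            ennreal (if norm y < s then real ?n / s ^ Suc ?n else 0)"
        proof -
          have "ennreal ((1 / s) ^ ?n) * (h (s *\<^sub>R (1 / s) *\<^sub>R y) * ennreal (w ((1 / s) *\<^sub>R y) s)) =
              h y * (ennreal ((1 / s) ^ ?n) * ennreal (w ((1 / s) *\<^sub>R y) s))"
            using True by (simp add: mult.left_commute)
          then show ?thesis unfolding eq' by (simp only: mult_ac)
        qed
      qed
      finally show ?thesis .
    next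
      case False
      then have "w x s = 0" for x by (auto simp: w_def)
      moreover have "\<not> norm y < s" for y :: "real^'n" using False norm_ge_zero[of y] by linarith
      ultimately show ?thesis by simp
    qed
  qed
  also have "\<dots> = (\<integral>\<^sup>+ y. (\<integral>\<^sup>+ s. h y * indicator punctured_ball y * ennreal (norm y ^ ?n) *
      ennreal (if norm y < s then real ?n / s ^ Suc ?n else 0) \<partial>lborel) \<partial>lborel)"
    by (rule lborel_pair.Fubini'[symmetric]) measurable
  also have "\<dots> = (\<integral>\<^sup>+ x. h x * indicator punctured_ball x \<partial>lborel)"
  proof (rule nn_integral_cong)
    fix y :: "real^'n"
    have "(\<integral>\<^sup>+ s. h y * indicator punctured_ball y * ennreal (norm y ^ ?n) *
      ennreal (if norm y < s then real ?n / s ^ Suc ?n else 0) \<partial>lborel) =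
      h y * indicator punctured_ball y * ennreal (norm y ^ ?n) *
      (\<integral>\<^sup>+ s. ennreal (if norm y < s then real ?n / s ^ Suc ?n else 0) \<partial>lborel)"
      by (subst nn_integral_cmult) auto
    also have "\<dots> = h y * indicator punctured_ball y"
    proof (cases "y = 0")
      case False
      then have "(\<integral>\<^sup>+ s. ennreal (if norm y < s then real ?n / s ^ Suc ?n else 0) \<partial>lborel) =
          ennreal (1 / norm y ^ ?n)"
        by (intro nn_integral_inverse_power_tail) auto
      moreover have "ennreal (norm y ^ ?n) * ennreal (1 / norm y ^ ?n) = 1"
        using False by (simp flip: ennreal_mult')
      ultimately show ?thesis by (simp add: mult.assoc)
    qed (simp add: punctured_ball_def)
    finally show "(\<integral>\<^sup>+ s. h y * indicator punctured_ball y * ennreal (norm y ^ ?n) *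
      ennreal (if norm y < s then real ?n / s ^ Suc ?n else 0) \<partial>lborel) = h y * indicator punctured_ball y" .
  qed
  finally show ?thesis unfolding k_def .
qed

lemma AE_sphere_measure_norm: "AE u in sphere_measure. norm u = 1"
  using AE_space[of sphere_measure] by (simp add: space_sphere_measure)

lemma polar_measurable:
  fixes h :: "real^'n \<Rightarrow> ennreal"
  assumes [measurable]: "h \<in> borel_measurable borel" "c \<in> borel_measurable borel"
  shows "(\<lambda>u. \<integral>\<^sup>+ t. h (t *\<^sub>R u) * c t \<partial>lborel) \<in> borel_measurable sphere_measure"
proof -
  have "(\<lambda>u. \<integral>\<^sup>+ t. h (t *\<^sub>R u) * c t \<partial>lborel) \<in> borel_measurable borel" by measurable
  then have "(\<lambda>u. \<integral>\<^sup>+ t. h (t *\<^sub>R u) * c t \<partial>lborel) \<in> borel_measurable (restrict_space borel (sphere 0 1))"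
    by (rule measurable_restrict_space1)
  then show ?thesis by (simp add: measurable_cong_sets[OF sets_sphere_measure refl])
qed

lemma AE_polar_finite:
  fixes h :: "real^'n \<Rightarrow> ennreal"
  assumes h[measurable]: "h \<in> borel_measurable borel"
    and fin: "(\<integral>\<^sup>+ x. h x * indicator punctured_ball x \<partial>lborel) < \<infinity>"
  shows "AE u in sphere_measure.
    (\<integral>\<^sup>+ t. h (t *\<^sub>R u) * radial_weight CARD('n) t \<partial>lborel) < \<infinity>"
proof -
  have "AE u in sphere_measure. (\<integral>\<^sup>+ t. h (t *\<^sub>R u) * radial_weight CARD('n) t \<partial>lborel) \<noteq> \<infinity>"
    using fin unfolding polar_nn_integral[OF h, symmetric]
    by (intro nn_integral_PInf_AE polar_measurable) auto
  then show ?thesis by (simp add: less_top)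
qed

text \<open>The exceptional points are enclosed in a Borel null set, to whose indicator the polar
  formula applies; the weight \<open>t ^ (n - 1)\<close> is positive on the open unit interval, so a
  vanishing weighted integral means that almost no point of the ray lies in the null set.\<close>

lemma AE_polar:
  fixes P :: "real^'n \<Rightarrow> bool"
  assumes "AE x in lborel. x \<in> punctured_ball \<longrightarrow> P x"
  shows "AE u in sphere_measure. AE t in lborel. 0 < t \<and> t < 1 \<longrightarrow> P (t *\<^sub>R u)"
proof -
  obtain N where N: "N \<in> null_sets lborel" "\<And>x. x \<notin> N \<Longrightarrow> x \<in> punctured_ball \<longrightarrow> P x"
    using AE_E3[OF assms] by (metis DiffI UNIV_I space_borel space_lborel)
  then have [measurable]: "N \<in> sets borel" by (auto simp: null_sets_def)
  have "(\<integral>\<^sup>+ x. indicator N x * indicator punctured_ball x \<partial>lborel) \<le> (\<integral>\<^sup>+ x. indicator N x \<partial>lborel)"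
    by (intro nn_integral_mono) (auto simp: indicator_def)
  also have "\<dots> = 0" using N by (auto simp: null_sets_def)
  finally have "(\<integral>\<^sup>+ u. (\<integral>\<^sup>+ t. indicator N (t *\<^sub>R u) * radial_weight CARD('n) t \<partial>lborel) \<partial>sphere_measure) = 0"
    by (subst polar_nn_integral) auto
  then have "AE u in sphere_measure. (\<integral>\<^sup>+ t. indicator N (t *\<^sub>R u) * radial_weight CARD('n) t \<partial>lborel) = 0"
    by (subst (asm) nn_integral_0_iff_AE) (auto intro!: polar_measurable)
  moreover have "AE u in (sphere_measure :: (real^'n) measure). norm u = 1"
    by (rule AE_sphere_measure_norm)
  ultimately show ?thesis
  proof eventually_elim
    case (elim u)
    have "AE t in lborel. indicator N (t *\<^sub>R u) * radial_weight CARD('n) t = 0"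
      using elim(1) by (subst (asm) nn_integral_0_iff_AE) auto
    then show ?case
    proof eventually_elim
      case (elim t)
      show ?case
      proof
        assume t: "0 < t \<and> t < 1"
        then have "\<not> t ^ (CARD('n) - Suc 0) \<le> 0" by (simp add: not_le)
        then have "t *\<^sub>R u \<notin> N"
          using elim t by (auto simp: indicator_def ennreal_eq_0_iff split: if_splits)
        moreover have "t *\<^sub>R u \<in> punctured_ball"
          using t \<open>norm u = 1\<close> by (auto simp: punctured_ball_def)
        ultimately show "P (t *\<^sub>R u)" using N by blast
      qed
    qed
  qed
qed

section \<open>Continuity of translations in mean\<close>

lemma nn_integral_lborel_translate:
  fixes f :: "'a::euclidean_space \<Rightarrow> ennreal"
  assumes [measurable]: "f \<in> borel_measurable borel"
  shows "(\<integral>\<^sup>+ x. f (x + h) \<partial>lborel) = (\<integral>\<^sup>+ x. f x \<partial>lborel)"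
proof -
  have "(\<integral>\<^sup>+ x. f x \<partial>lborel) = (\<integral>\<^sup>+ x. f x \<partial>distr lborel borel ((+) h))"
    by (simp add: lborel_distr_plus)
  also have "\<dots> = (\<integral>\<^sup>+ x. f (x + h) \<partial>lborel)"
    by (subst nn_integral_distr) (auto simp: add.commute)
  finally show ?thesis by simp
qed

text \<open>The estimate for density arguments, with \<open>g\<close> an approximation of
  \<open>f\<close>; translation invariance makes the two approximation errors equal, hence the
  factor 2.\<close>

lemma translation_dist_triangle:
  fixes f g :: "'a::euclidean_space \<Rightarrow> real"
  assumes [measurable]: "f \<in> borel_measurable borel" "g \<in> borel_measurable borel"
  shows "(\<integral>\<^sup>+ x. ennreal \<bar>f (x + h) - f x\<bar> \<partial>lborel) \<le>
    2 * (\<integral>\<^sup>+ x. ennreal \<bar>f x - g x\<bar> \<partial>lborel) + (\<integral>\<^sup>+ x. ennreal \<bar>g (x + h) - g x\<bar> \<partial>lborel)"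
proof -
  have "(\<integral>\<^sup>+ x. ennreal \<bar>f (x + h) - f x\<bar> \<partial>lborel) \<le>
      (\<integral>\<^sup>+ x. ennreal \<bar>f (x + h) - g (x + h)\<bar> + (ennreal \<bar>f x - g x\<bar> + ennreal \<bar>g (x + h) - g x\<bar>) \<partial>lborel)"
    by (intro nn_integral_mono) (simp flip: ennreal_plus)
  also have "\<dots> = (\<integral>\<^sup>+ x. ennreal \<bar>f (x + h) - g (x + h)\<bar> \<partial>lborel) +
      ((\<integral>\<^sup>+ x. ennreal \<bar>f x - g x\<bar> \<partial>lborel) + (\<integral>\<^sup>+ x. ennreal \<bar>g (x + h) - g x\<bar> \<partial>lborel))"
    by (simp add: nn_integral_add)
  also have "(\<integral>\<^sup>+ x. ennreal \<bar>f (x + h) - g (x + h)\<bar> \<partial>lborel) = (\<integral>\<^sup>+ x. ennreal \<bar>f x - g x\<bar> \<partial>lborel)"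
    by (rule nn_integral_lborel_translate[of "\<lambda>x. ennreal \<bar>f x - g x\<bar>"]) measurable
  finally show ?thesis by (simp add: mult_2 add.assoc)
qed

text \<open>The set is squeezed between a compact \<open>K\<close> and an open \<open>U\<close>
  whose difference is small. A translation shorter than the distance from \<open>K\<close> to the
  complement of \<open>U\<close> changes membership in \<open>A\<close> only if one of the two
  points lies in \<open>U - K\<close>.\<close>

lemma L1_continuity_translation_indicator:
  fixes A :: "'a::euclidean_space set"
  assumes A: "A \<in> sets lborel" "emeasure lborel A < \<infinity>" and "e > 0"
  shows "\<exists>d>0. \<forall>h. norm h < d \<longrightarrow>
    (\<integral>\<^sup>+ x. ennreal \<bar>indicator A (x + h) - indicator A x\<bar> \<partial>lborel) \<le> ennreal e"
proof -
  have [measurable]: "A \<in> sets borel" using A by simp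
  \<comment> \<open>The set \<open>U - K\<close> is covered by three pieces, each of measure below
    \<open>e / 6\<close>, and is counted once at \<open>x\<close> and once at
    \<open>x + h\<close>.\<close>
  have e: "e / 6 > 0" using \<open>e > 0\<close> by simp
  obtain T where T: "closed T" "T \<subseteq> A" "A - T \<in> lmeasurable"
    "emeasure lebesgue (A - T) < ennreal (e / 6)"
    by (rule sets_lebesgue_inner_closed[OF sets_completionI_sets[OF A(1)] e])
  obtain U where U: "open U" "A \<subseteq> U" "emeasure lborel (U - A) < ennreal (e / 6)"
    using outer_regular_lborel[OF _ e, of A] by auto
  have "(\<lambda>k. emeasure lborel (A - cball 0 (real k))) \<longlonglongrightarrow> emeasure lborel (\<Inter>k. A - cball 0 (real k))"
  proof (rule Lim_emeasure_decseq)
    show "decseq (\<lambda>k. A - cball 0 (real k))" by (auto simp: decseq_def)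
    show "emeasure lborel (A - cball 0 (real k)) \<noteq> \<infinity>" for k
      using A(2) emeasure_mono[of "A - cball 0 (real k)" A lborel] by (auto simp: top_unique)
  qed auto
  moreover have "(\<Inter>k. A - cball 0 (real k)) = {}"
  proof -
    have "\<exists>k. x \<in> cball 0 (real k)" for x :: 'a
      using real_arch_simple[of "norm x"] by simp
    then show ?thesis by blast
  qed
  ultimately have "(\<lambda>k. emeasure lborel (A - cball 0 (real k))) \<longlonglongrightarrow> 0"
    by (simp only: emeasure_empty)
  then have "\<forall>\<^sub>F k in sequentially. emeasure lborel (A - cball 0 (real k)) < ennreal (e / 6)"
    using e by (intro order_tendstoD(2)) auto
  then obtain k where k: "emeasure lborel (A - cball 0 (real k)) < ennreal (e / 6)"
    by (auto simp: eventually_sequentially)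
  define K where "K = T \<inter> cball 0 (real k)"
  have K: "compact K" "K \<subseteq> A" using T by (auto simp: K_def closed_Int_compact)
  have [measurable]: "K \<in> sets borel" "U \<in> sets borel" "T \<in> sets borel"
    using K U T by (auto intro: borel_compact)
  have UK: "emeasure lborel (U - K) \<le> ennreal (e / 2)"
  proof -
    have "emeasure lborel (U - K) \<le> emeasure lborel ((U - A) \<union> ((A - T) \<union> (A - cball 0 (real k))))"
      by (rule emeasure_mono) (auto simp: K_def)
    also have "\<dots> \<le> emeasure lborel (U - A) + (emeasure lborel (A - T) + emeasure lborel (A - cball 0 (real k)))"
      by (intro order_trans[OF emeasure_subadditive] add_left_mono) auto
    also have "\<dots> \<le> ennreal (e / 6) + (ennreal (e / 6) + ennreal (e / 6))"
      using T(4) U(3) k by (intro add_mono) auto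
    also have "\<dots> = ennreal (e / 2)" using e by (simp flip: ennreal_plus)
    finally show ?thesis .
  qed
  obtain d where d: "d > 0" "\<And>x y. x \<in> K \<Longrightarrow> y \<in> - U \<Longrightarrow> d \<le> dist x y"
    using separate_compact_closed[of K "- U"] K U by blast
  have "(\<integral>\<^sup>+ x. ennreal \<bar>indicator A (x + h) - indicator A x\<bar> \<partial>lborel) \<le> ennreal e" if h: "norm h < d" for h
  proof -
    have near: "x + h \<in> U" if "x \<in> K" for x using d(2)[of x "x + h"] that h by (auto simp: dist_norm)
    have near': "x \<in> U" if "x + h \<in> K" for x using d(2)[of "x + h" x] that h by (auto simp: dist_norm)
    have "(\<integral>\<^sup>+ x. ennreal \<bar>indicator A (x + h) - indicator A x\<bar> \<partial>lborel) \<le>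
        (\<integral>\<^sup>+ x. indicator (U - K) (x + h) + indicator (U - K) x \<partial>lborel)"
      using near near' K(2) U(2) by (intro nn_integral_mono) (fastforce simp: indicator_def)
    also have "\<dots> = (\<integral>\<^sup>+ x. indicator (U - K) (x + h) \<partial>lborel) + (\<integral>\<^sup>+ x. indicator (U - K) x \<partial>lborel)"
      by (rule nn_integral_add) auto
    also have "\<dots> = emeasure lborel (U - K) + emeasure lborel (U - K)"
      by (subst nn_integral_lborel_translate[of "indicator (U - K)"]) auto
    also have "\<dots> \<le> ennreal (e / 2) + ennreal (e / 2)" by (intro add_mono UK)
    also have "\<dots> = ennreal e" using \<open>e > 0\<close> by (simp flip: ennreal_plus)
    finally show ?thesis .
  qed
  then show ?thesis using d(1) by blast
qed

text \<open>Induction over integrable functions. In the limit step the approximants are bounded by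
  twice the modulus of \<open>f\<close>, so they converge to it in mean by dominated convergence,
  and the triangle estimate gives the error \<open>2 * (e / 4) + e / 2\<close>.\<close>

lemma L1_continuity_translation:
  fixes f :: "'a::euclidean_space \<Rightarrow> real"
  assumes "integrable lborel f" and "e > 0"
  shows "\<exists>d>0. \<forall>h. norm h < d \<longrightarrow> (\<integral>\<^sup>+ x. ennreal \<bar>f (x + h) - f x\<bar> \<partial>lborel) \<le> ennreal e"
  using assms
proof (induction arbitrary: e rule: integrable_induct)
  case (base A c)
  then have [measurable]: "A \<in> sets borel" by simp
  have "e / (\<bar>c\<bar> + 1) > 0" using base by (simp add: add_nonneg_pos)
  from L1_continuity_translation_indicator[OF base(1,2) this] obtain d where d: "d > 0"
    "\<And>h. norm h < d \<Longrightarrow> (\<integral>\<^sup>+ x. ennreal \<bar>indicator A (x + h) - indicator A x\<bar> \<partial>lborel) \<le> ennreal (e / (\<bar>c\<bar> + 1))"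
    by blast
  have "(\<integral>\<^sup>+ x. ennreal \<bar>indicator A (x + h) *\<^sub>R c - indicator A x *\<^sub>R c\<bar> \<partial>lborel) \<le> ennreal e"
    if h: "norm h < d" for h
  proof -
    have "(\<integral>\<^sup>+ x. ennreal \<bar>indicator A (x + h) *\<^sub>R c - indicator A x *\<^sub>R c\<bar> \<partial>lborel) =
        (\<integral>\<^sup>+ x. ennreal \<bar>c\<bar> * ennreal \<bar>indicator A (x + h) - indicator A x\<bar> \<partial>lborel)"
      by (intro nn_integral_cong)
        (simp add: mult.commute flip: ennreal_mult left_diff_distrib right_diff_distrib abs_mult)
    also have "\<dots> = ennreal \<bar>c\<bar> * (\<integral>\<^sup>+ x. ennreal \<bar>indicator A (x + h) - indicator A x\<bar> \<partial>lborel)"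
      by (rule nn_integral_cmult) measurable
    also have "\<dots> \<le> ennreal \<bar>c\<bar> * ennreal (e / (\<bar>c\<bar> + 1))"
      by (intro mult_left_mono d h) auto
    also have "\<dots> = ennreal (\<bar>c\<bar> * (e / (\<bar>c\<bar> + 1)))"
      using base by (intro ennreal_mult[symmetric]) auto
    also have "\<dots> \<le> ennreal e"
      using base by (intro ennreal_leI) (simp add: field_simps)
    finally show ?thesis .
  qed
  then show ?case using d(1) by blast
next
  case (add f g)
  then have [measurable]: "f \<in> borel_measurable borel" "g \<in> borel_measurable borel"
    by (auto dest: borel_measurable_integrable)
  have e: "e / 2 > 0" using add by simp
  obtain d1 where d1: "d1 > 0" "\<And>h. norm h < d1 \<Longrightarrow> (\<integral>\<^sup>+ x. ennreal \<bar>f (x + h) - f x\<bar> \<partial>lborel) \<le> ennreal (e / 2)"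
    using add.IH(1)[OF e] by blast
  obtain d2 where d2: "d2 > 0" "\<And>h. norm h < d2 \<Longrightarrow> (\<integral>\<^sup>+ x. ennreal \<bar>g (x + h) - g x\<bar> \<partial>lborel) \<le> ennreal (e / 2)"
    using add.IH(2)[OF e] by blast
  have "(\<integral>\<^sup>+ x. ennreal \<bar>(f (x + h) + g (x + h)) - (f x + g x)\<bar> \<partial>lborel) \<le> ennreal e"
    if h: "norm h < min d1 d2" for h
  proof -
    have "(\<integral>\<^sup>+ x. ennreal \<bar>(f (x + h) + g (x + h)) - (f x + g x)\<bar> \<partial>lborel) \<le>
        (\<integral>\<^sup>+ x. ennreal \<bar>f (x + h) - f x\<bar> + ennreal \<bar>g (x + h) - g x\<bar> \<partial>lborel)"
      by (intro nn_integral_mono) (simp flip: ennreal_plus)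
    also have "\<dots> = (\<integral>\<^sup>+ x. ennreal \<bar>f (x + h) - f x\<bar> \<partial>lborel) + (\<integral>\<^sup>+ x. ennreal \<bar>g (x + h) - g x\<bar> \<partial>lborel)"
      by (rule nn_integral_add) auto
    also have "\<dots> \<le> ennreal (e / 2) + ennreal (e / 2)"
      using h by (intro add_mono d1 d2) auto
    also have "\<dots> = ennreal e" using e by (simp flip: ennreal_plus)
    finally show ?thesis .
  qed
  then show ?case using d1(1) d2(1) by (intro exI[of _ "min d1 d2"]) auto
next
  case (lim f s)
  have [measurable]: "f \<in> borel_measurable borel" "\<And>i. s i \<in> borel_measurable borel"
    using lim by (auto dest: borel_measurable_integrable)
  have "(\<lambda>i. \<integral>\<^sup>+ x. ennreal \<bar>f x - s i x\<bar> \<partial>lborel) \<longlonglongrightarrow> (\<integral>\<^sup>+ x. 0 \<partial>(lborel :: 'a measure))"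
  proof (rule nn_integral_dominated_convergence[where w = "\<lambda>x. ennreal (3 * \<bar>f x\<bar>)"])
    show "AE x in lborel. ennreal \<bar>f x - s j x\<bar> \<le> ennreal (3 * \<bar>f x\<bar>)" for j
    proof (rule AE_I2)
      fix x :: 'a
      have "\<bar>s j x\<bar> \<le> 2 * \<bar>f x\<bar>" using lim(3)[of x j] by simp
      then show "ennreal \<bar>f x - s j x\<bar> \<le> ennreal (3 * \<bar>f x\<bar>)" by (intro ennreal_leI) linarith
    qed
    have "integrable lborel (\<lambda>x. 3 * \<bar>f x\<bar>)" using lim by auto
    then show "(\<integral>\<^sup>+ x. ennreal (3 * \<bar>f x\<bar>) \<partial>lborel) < \<infinity>"
      by (subst nn_integral_eq_integral) auto
    show "AE x in lborel. (\<lambda>i. ennreal \<bar>f x - s i x\<bar>) \<longlonglongrightarrow> 0"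
    proof (rule AE_I2)
      fix x :: 'a
      have "(\<lambda>i. \<bar>f x - s i x\<bar>) \<longlonglongrightarrow> \<bar>f x - f x\<bar>" using lim(2)[of x] by (intro tendsto_intros) auto
      then show "(\<lambda>i. ennreal \<bar>f x - s i x\<bar>) \<longlonglongrightarrow> 0" using tendsto_ennrealI by fastforce
    qed
  qed auto
  then have "(\<lambda>i. \<integral>\<^sup>+ x. ennreal \<bar>f x - s i x\<bar> \<partial>lborel) \<longlonglongrightarrow> 0" by simp
  moreover have "(0::ennreal) < ennreal (e / 4)" using lim by simp
  ultimately have "\<forall>\<^sub>F i in sequentially. (\<integral>\<^sup>+ x. ennreal \<bar>f x - s i x\<bar> \<partial>lborel) < ennreal (e / 4)"
    by (rule order_tendstoD(2))
  then obtain i where i: "(\<integral>\<^sup>+ x. ennreal \<bar>f x - s i x\<bar> \<partial>lborel) < ennreal (e / 4)"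
    by (auto simp: eventually_sequentially)
  have e: "e / 2 > 0" using lim by simp
  obtain d where d: "d > 0" "\<And>h. norm h < d \<Longrightarrow> (\<integral>\<^sup>+ x. ennreal \<bar>s i (x + h) - s i x\<bar> \<partial>lborel) \<le> ennreal (e / 2)"
    using lim.IH[OF e] by blast
  have "(\<integral>\<^sup>+ x. ennreal \<bar>f (x + h) - f x\<bar> \<partial>lborel) \<le> ennreal e" if h: "norm h < d" for h
  proof -
    have "(\<integral>\<^sup>+ x. ennreal \<bar>f (x + h) - f x\<bar> \<partial>lborel) \<le>
      2 * (\<integral>\<^sup>+ x. ennreal \<bar>f x - s i x\<bar> \<partial>lborel) + (\<integral>\<^sup>+ x. ennreal \<bar>s i (x + h) - s i x\<bar> \<partial>lborel)"
      by (rule translation_dist_triangle) auto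
    also have "\<dots> \<le> 2 * ennreal (e / 4) + ennreal (e / 2)"
      using i d(2)[OF h] by (intro add_mono mult_left_mono) auto
    also have "\<dots> = ennreal e"
    proof -
      have "2 * ennreal (e / 4) = ennreal (e / 2)"
        using e by (simp add: mult_2 flip: ennreal_plus)
      then show ?thesis using e by (simp flip: ennreal_plus)
    qed
    finally show ?thesis .
  qed
  then show ?case using d(1) by blast
qed

section \<open>Steklov averages and increments along rays\<close>

text \<open>Here \<open>1\<close> is the all-ones vector. The cube extends from \<open>x\<close> in
  the positive directions only, so that it and its translate along an axis fit into a box with lower
  corner \<open>x\<close>.\<close>

definition steklov :: "real \<Rightarrow> (real^'n \<Rightarrow> real) \<Rightarrow> real^'n \<Rightarrow> real" where
  "steklov \<epsilon> f x = (\<integral>z. indicator (cbox 0 (\<epsilon> *\<^sub>R 1)) z * f (x + z) \<partial>lborel) / \<epsilon> ^ CARD('n)"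

lemma integrable_lborel_translate:
  fixes f :: "'a::euclidean_space \<Rightarrow> real"
  assumes "integrable lborel f"
  shows "integrable lborel (\<lambda>z. f (x + z))"
proof -
  have "integrable (distr lborel borel ((+) x)) f" using assms by (simp add: lborel_distr_plus)
  then show ?thesis
    using assms by (subst (asm) integrable_distr_eq) auto
qed

lemma integrable_steklov:
  fixes f :: "real^'n \<Rightarrow> real"
  assumes "integrable lborel f"
  shows "integrable lborel (\<lambda>z. indicator (cbox 0 (\<epsilon> *\<^sub>R 1)) z * f (x + z))"
  using integrable_mult_indicator[of "cbox 0 (\<epsilon> *\<^sub>R 1)" lborel "\<lambda>z. f (x + z)"]
    integrable_lborel_translate[OF assms] by simp

lemma norm_le_steklov_cube:
  fixes z :: "real^'n"
  assumes "z \<in> cbox 0 (\<epsilon> *\<^sub>R 1)"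
  shows "norm z \<le> real CARD('n) * \<epsilon>"
proof -
  have "norm z \<le> (\<Sum>i\<in>UNIV. \<bar>z $ i\<bar>)" by (rule norm_le_l1_cart)
  also have "\<dots> \<le> (\<Sum>i\<in>(UNIV :: 'n set). \<epsilon>)"
    using assms by (intro sum_mono) (auto simp: mem_box_cart)
  finally show ?thesis by simp
qed

lemma measure_steklov_cube:
  assumes "\<epsilon> > 0"
  shows "measure lborel (cbox (0 :: real^'n) (\<epsilon> *\<^sub>R 1)) = \<epsilon> ^ CARD('n)"
    and "emeasure lborel (cbox (0 :: real^'n) (\<epsilon> *\<^sub>R 1)) = ennreal (\<epsilon> ^ CARD('n))"
proof -
  have "cbox (0 :: real^'n) (\<epsilon> *\<^sub>R 1) \<noteq> {}"
    using assms by (auto simp: cbox_interval less_eq_vec_def)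
  then show m: "measure lborel (cbox (0 :: real^'n) (\<epsilon> *\<^sub>R 1)) = \<epsilon> ^ CARD('n)"
    by (simp add: content_cbox_cart)
  show "emeasure lborel (cbox (0 :: real^'n) (\<epsilon> *\<^sub>R 1)) = ennreal (\<epsilon> ^ CARD('n))"
    unfolding m[symmetric] using emeasure_lborel_cbox_finite
    by (intro emeasure_eq_ennreal_measure) (auto simp: less_top)
qed

lemma integrable_steklov_cube:
  "integrable lborel (\<lambda>z. indicator (cbox (0 :: real^'n) (\<epsilon> *\<^sub>R 1)) z * (c::real))"
  using emeasure_lborel_cbox_finite by (intro integrable_mult_left integrable_real_indicator) auto

lemma steklov_minus_const:
  fixes f :: "real^'n \<Rightarrow> real"
  assumes "integrable lborel f" "\<epsilon> > 0"
  shows "steklov \<epsilon> f x - c =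
    (\<integral>z. indicator (cbox 0 (\<epsilon> *\<^sub>R 1)) z * (f (x + z) - c) \<partial>lborel) / \<epsilon> ^ CARD('n)"
proof -
  have "(\<integral>z. indicator (cbox 0 (\<epsilon> *\<^sub>R 1)) z * (f (x + z) - c) \<partial>lborel) =
     (\<integral>z. indicator (cbox 0 (\<epsilon> *\<^sub>R 1)) z * f (x + z) \<partial>lborel) - \<epsilon> ^ CARD('n) * c"
    using integrable_steklov[OF assms(1), of \<epsilon> x] integrable_steklov_cube[of \<epsilon> c, where 'n='n] assms(2)
    by (simp only: right_diff_distrib Bochner_Integration.integral_diff) (simp add: measure_steklov_cube)
  then show ?thesis using assms(2) by (simp add: steklov_def diff_divide_distrib)
qed

lemma steklov_minus_const_le:
  fixes f :: "real^'n \<Rightarrow> real"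
  assumes "integrable lborel f" "\<epsilon> > 0"
  shows "ennreal \<bar>steklov \<epsilon> f x - c\<bar> \<le>
    (\<integral>\<^sup>+ z. ennreal (1 / \<epsilon> ^ CARD('n)) * (indicator (cbox 0 (\<epsilon> *\<^sub>R 1)) z * ennreal \<bar>f (x + z) - c\<bar>) \<partial>lborel)"
proof -
  have int: "integrable lborel (\<lambda>z. indicator (cbox 0 (\<epsilon> *\<^sub>R 1)) z * (f (x + z) - c))"
    unfolding right_diff_distrib using integrable_steklov[OF assms(1)] integrable_steklov_cube
    by (rule Bochner_Integration.integrable_diff)
  have [measurable]: "f \<in> borel_measurable borel" using assms(1) by auto
  have "ennreal \<bar>steklov \<epsilon> f x - c\<bar> = ennreal (1 / \<epsilon> ^ CARD('n)) *
      ennreal \<bar>\<integral>z. indicator (cbox 0 (\<epsilon> *\<^sub>R 1)) z * (f (x + z) - c) \<partial>lborel\<bar>"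
    unfolding steklov_minus_const[OF assms] using assms(2)
    by (subst ennreal_mult[symmetric]) (auto simp: abs_mult)
  also have "\<dots> \<le> ennreal (1 / \<epsilon> ^ CARD('n)) *
      (\<integral>\<^sup>+ z. ennreal (norm (indicator (cbox 0 (\<epsilon> *\<^sub>R 1)) z * (f (x + z) - c))) \<partial>lborel)"
    using integral_norm_bound_ennreal[OF int] by (intro mult_left_mono) auto
  also have "\<dots> = ennreal (1 / \<epsilon> ^ CARD('n)) *
      (\<integral>\<^sup>+ z. indicator (cbox 0 (\<epsilon> *\<^sub>R 1)) z * ennreal \<bar>f (x + z) - c\<bar> \<partial>lborel)"
    by (intro arg_cong2[where f = "(*)"] nn_integral_cong refl) (auto simp: indicator_def)
  finally show ?thesis by (subst nn_integral_cmult) auto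
qed

text \<open>The cube lies in the ball of radius \<open>CARD('n) * \<epsilon>\<close>, so only values
  of \<open>f\<close> near \<open>x\<close> enter. This yields convergence of the averages at points
  of continuity.\<close>

lemma steklov_near_const:
  fixes f :: "real^'n \<Rightarrow> real"
  assumes f: "integrable lborel f" "\<epsilon> > 0"
    and le: "\<And>z. norm z \<le> real CARD('n) * \<epsilon> \<Longrightarrow> \<bar>f (x + z) - c\<bar> \<le> e"
  shows "\<bar>steklov \<epsilon> f x - c\<bar> \<le> e"
proof -
  have "e \<ge> 0" using le[of 0] f(2) by (auto intro: order_trans[OF abs_ge_zero])
  have "ennreal \<bar>steklov \<epsilon> f x - c\<bar> \<le>
    (\<integral>\<^sup>+ z. ennreal (1 / \<epsilon> ^ CARD('n)) * (indicator (cbox 0 (\<epsilon> *\<^sub>R 1)) z * ennreal \<bar>f (x + z) - c\<bar>) \<partial>lborel)"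
    by (rule steklov_minus_const_le[OF f])
  also have "\<dots> \<le> (\<integral>\<^sup>+ z. ennreal (e / \<epsilon> ^ CARD('n)) * indicator (cbox (0 :: real^'n) (\<epsilon> *\<^sub>R 1)) z \<partial>lborel)"
  proof (rule nn_integral_mono)
    fix z :: "real^'n"
    show "ennreal (1 / \<epsilon> ^ CARD('n)) * (indicator (cbox 0 (\<epsilon> *\<^sub>R 1)) z * ennreal \<bar>f (x + z) - c\<bar>)
      \<le> ennreal (e / \<epsilon> ^ CARD('n)) * indicator (cbox 0 (\<epsilon> *\<^sub>R 1)) z"
    proof (cases "z \<in> cbox 0 (\<epsilon> *\<^sub>R 1)")
      case True
      then have "\<bar>f (x + z) - c\<bar> \<le> e" by (intro le norm_le_steklov_cube)
      then show ?thesis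
        using True f(2) by (simp add: divide_right_mono ennreal_leI flip: ennreal_mult)
    qed simp
  qed
  also have "\<dots> = ennreal (e / \<epsilon> ^ CARD('n)) * ennreal (\<epsilon> ^ CARD('n))"
    using f(2) by (subst nn_integral_cmult) (auto simp: measure_steklov_cube)
  also have "\<dots> = ennreal e"
    using \<open>e \<ge> 0\<close> f(2) by (simp flip: ennreal_mult)
  finally show ?thesis using \<open>e \<ge> 0\<close> by (simp add: ennreal_le_iff)
qed

text \<open>The difference of two averages is at most the distance in mean between \<open>f\<close>
  and a translate of it, divided by the volume of the cube; so integrability of \<open>f\<close>
  yields a continuous average.\<close>

lemma continuous_steklov:
  fixes f :: "real^'n \<Rightarrow> real"
  assumes f: "integrable lborel f" "\<epsilon> > 0"
  shows "continuous_on UNIV (steklov \<epsilon> f)"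
  unfolding continuous_on_iff
proof (intro ballI allI impI)
  fix x :: "real^'n" and e :: real assume "e > 0"
  have [measurable]: "f \<in> borel_measurable borel" using f by auto
  have e: "e / 2 * \<epsilon> ^ CARD('n) > 0" using \<open>e > 0\<close> f by simp
  obtain d where d: "d > 0" "\<And>h. norm h < d \<Longrightarrow>
      (\<integral>\<^sup>+ x. ennreal \<bar>f (x + h) - f x\<bar> \<partial>lborel) \<le> ennreal (e / 2 * \<epsilon> ^ CARD('n))"
    using L1_continuity_translation[OF f(1) e] by blast
  have "dist (steklov \<epsilon> f y) (steklov \<epsilon> f x) < e" if y: "dist y x < d" for y
  proof -
    have int: "integrable lborel (\<lambda>z. indicator (cbox 0 (\<epsilon> *\<^sub>R 1)) z * (f (y + z) - f (x + z)))"
      using integrable_steklov[OF f(1)] by (simp add: right_diff_distrib)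
    have "steklov \<epsilon> f y - steklov \<epsilon> f x =
        (\<integral>z. indicator (cbox 0 (\<epsilon> *\<^sub>R 1)) z * (f (y + z) - f (x + z)) \<partial>lborel) / \<epsilon> ^ CARD('n)"
      using integrable_steklov[OF f(1)] by (simp add: steklov_def right_diff_distrib diff_divide_distrib)
    then have eq: "\<bar>steklov \<epsilon> f y - steklov \<epsilon> f x\<bar> * \<epsilon> ^ CARD('n) =
        \<bar>\<integral>z. indicator (cbox 0 (\<epsilon> *\<^sub>R 1)) z * (f (y + z) - f (x + z)) \<partial>lborel\<bar>"
      using f(2) by simp
    have "ennreal \<bar>\<integral>z. indicator (cbox 0 (\<epsilon> *\<^sub>R 1)) z * (f (y + z) - f (x + z)) \<partial>lborel\<bar> \<le>
        (\<integral>\<^sup>+ z. ennreal (norm (indicator (cbox 0 (\<epsilon> *\<^sub>R 1)) z * (f (y + z) - f (x + z)))) \<partial>lborel)"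
      using integral_norm_bound_ennreal[OF int] by simp
    also have "\<dots> \<le> (\<integral>\<^sup>+ z. ennreal \<bar>f (z + x + (y - x)) - f (z + x)\<bar> \<partial>lborel)"
      by (intro nn_integral_mono) (auto simp: indicator_def add.commute)
    also have "\<dots> = (\<integral>\<^sup>+ z. ennreal \<bar>f (z + (y - x)) - f z\<bar> \<partial>lborel)"
      by (rule nn_integral_lborel_translate[of "\<lambda>z. ennreal \<bar>f (z + (y - x)) - f z\<bar>"]) measurable
    also have "\<dots> \<le> ennreal (e / 2 * \<epsilon> ^ CARD('n))"
      using y by (intro d) (simp add: dist_norm)
    finally have "\<bar>steklov \<epsilon> f y - steklov \<epsilon> f x\<bar> * \<epsilon> ^ CARD('n) \<le> e / 2 * \<epsilon> ^ CARD('n)"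
      unfolding eq[symmetric] using e by (subst (asm) ennreal_le_iff) auto
    then have "\<bar>steklov \<epsilon> f y - steklov \<epsilon> f x\<bar> \<le> e / 2" using f(2) by simp
    then show ?thesis using \<open>e > 0\<close> by (simp add: dist_real_def)
  qed
  then show "\<exists>d>0. \<forall>y\<in>UNIV. dist y x < d \<longrightarrow> dist (steklov \<epsilon> f y) (steklov \<epsilon> f x) < e"
    using d(1) by blast
qed

text \<open>By Tonelli's theorem the distance in mean is at most the average, over the vectors
  \<open>z\<close> of the cube, of the distances between \<open>f\<close> and its translates by
  \<open>z\<close>.\<close>

lemma steklov_L1:
  fixes f :: "real^'n \<Rightarrow> real"
  assumes f: "integrable lborel f" "\<epsilon> > 0"
    and d: "\<And>h. norm h \<le> real CARD('n) * \<epsilon> \<Longrightarrow> (\<integral>\<^sup>+ x. ennreal \<bar>f (x + h) - f x\<bar> \<partial>lborel) \<le> ennreal e"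
  shows "(\<integral>\<^sup>+ x. ennreal \<bar>steklov \<epsilon> f x - f x\<bar> \<partial>lborel) \<le> ennreal e"
proof -
  have [measurable]: "f \<in> borel_measurable borel" using f by auto
  let ?Q = "cbox (0 :: real^'n) (\<epsilon> *\<^sub>R 1)"
  have "(\<integral>\<^sup>+ x. ennreal \<bar>steklov \<epsilon> f x - f x\<bar> \<partial>lborel) \<le>
      (\<integral>\<^sup>+ x. (\<integral>\<^sup>+ z. ennreal (1 / \<epsilon> ^ CARD('n)) * (indicator ?Q z * ennreal \<bar>f (x + z) - f x\<bar>) \<partial>lborel) \<partial>lborel)"
    by (intro nn_integral_mono steklov_minus_const_le f)
  also have "\<dots> = (\<integral>\<^sup>+ z. (\<integral>\<^sup>+ x. ennreal (1 / \<epsilon> ^ CARD('n)) * (indicator ?Q z * ennreal \<bar>f (x + z) - f x\<bar>) \<partial>lborel) \<partial>lborel)"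
    by (rule lborel_pair.Fubini') measurable
  also have "\<dots> = (\<integral>\<^sup>+ z. ennreal (1 / \<epsilon> ^ CARD('n)) * (indicator ?Q z * (\<integral>\<^sup>+ x. ennreal \<bar>f (x + z) - f x\<bar> \<partial>lborel)) \<partial>lborel)"
    by (simp add: nn_integral_cmult)
  also have "\<dots> \<le> (\<integral>\<^sup>+ z. ennreal (1 / \<epsilon> ^ CARD('n)) * ennreal e * indicator ?Q z \<partial>lborel)"
  proof (rule nn_integral_mono)
    fix z :: "real^'n"
    show "ennreal (1 / \<epsilon> ^ CARD('n)) * (indicator ?Q z * (\<integral>\<^sup>+ x. ennreal \<bar>f (x + z) - f x\<bar> \<partial>lborel))
        \<le> ennreal (1 / \<epsilon> ^ CARD('n)) * ennreal e * indicator ?Q z"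
      using d[OF norm_le_steklov_cube[of z \<epsilon>]]
      by (cases "z \<in> ?Q") (auto intro!: mult_left_mono)
  qed
  also have "\<dots> = ennreal (1 / \<epsilon> ^ CARD('n)) * ennreal e * ennreal (\<epsilon> ^ CARD('n))"
    using f(2) by (subst nn_integral_cmult) (auto simp: measure_steklov_cube)
  also have "\<dots> = ennreal e * (ennreal (1 / \<epsilon> ^ CARD('n)) * ennreal (\<epsilon> ^ CARD('n)))"
    by (simp only: mult_ac)
  also have "ennreal (1 / \<epsilon> ^ CARD('n)) * ennreal (\<epsilon> ^ CARD('n)) = 1"
    using f(2) by (simp flip: ennreal_mult)
  finally show ?thesis by simp
qed

text \<open>Fubini's theorem averages the formula on lines over the cube: the increment of
  \<open>steklov \<epsilon> f\<close> is the integral of the continuous function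
  \<open>steklov \<epsilon> D\<close> along the segment. The conclusion is phrased as a deviation
  from \<open>s * d\<close> because the differentiability criterion by coordinate steps asks for
  that.\<close>

lemma steklov_increment:
  fixes f D :: "real^'n \<Rightarrow> real"
  assumes f: "integrable lborel f" and D: "integrable lborel D" and \<epsilon>: "\<epsilon> > 0" and s: "s \<ge> 0"
    and line: "AE y in lborel. y \<in> B \<longrightarrow> y + s *\<^sub>R v \<in> B \<longrightarrow>
      ((\<lambda>t. D (y + t *\<^sub>R v)) has_integral (f (y + s *\<^sub>R v) - f y)) {0..s}"
    and B: "\<And>z. z \<in> cbox 0 (\<epsilon> *\<^sub>R 1) \<Longrightarrow> x + z \<in> B \<and> x + z + s *\<^sub>R v \<in> B"
    and le: "\<And>t. 0 \<le> t \<Longrightarrow> t \<le> s \<Longrightarrow> \<bar>steklov \<epsilon> D (x + t *\<^sub>R v) - d\<bar> \<le> e"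
  shows "\<bar>steklov \<epsilon> f (x + s *\<^sub>R v) - steklov \<epsilon> f x - s * d\<bar> \<le> e * s"
proof -
  let ?Q = "cbox (0 :: real^'n) (\<epsilon> *\<^sub>R 1)" and ?n = "CARD('n)"
  have [measurable]: "f \<in> borel_measurable borel" "D \<in> borel_measurable borel" using f D by auto
  define G where "G z t = indicator ?Q z * (indicator {0..s} t * D (x + z + t *\<^sub>R v))" for z :: "real^'n" and t :: real
  have [measurable]: "(\<lambda>(z, t). G z t) \<in> borel_measurable (lborel \<Otimes>\<^sub>M lborel)"
    unfolding G_def by measurable
  \<comment> \<open>For fixed \<open>t\<close>, translation invariance bounds the integral over
    \<open>z\<close> by that of the modulus of \<open>D\<close>, and \<open>t\<close> runs through
    an interval of length \<open>s\<close>.\<close>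
  have intG: "integrable (lborel \<Otimes>\<^sub>M lborel) (\<lambda>(z, t). G z t)"
  proof (rule integrableI_bounded)
    have "(\<integral>\<^sup>+ p. ennreal (norm (case p of (z, t) \<Rightarrow> G z t)) \<partial>(lborel \<Otimes>\<^sub>M lborel)) =
        (\<integral>\<^sup>+ t. (\<integral>\<^sup>+ z. ennreal (norm (G z t)) \<partial>lborel) \<partial>lborel)"
      by (subst lborel_pair.nn_integral_snd[symmetric]) auto
    also have "\<dots> \<le> (\<integral>\<^sup>+ t. (\<integral>\<^sup>+ z. indicator {0..s} t * ennreal \<bar>D (z + (x + t *\<^sub>R v))\<bar> \<partial>lborel) \<partial>lborel)"
      by (intro nn_integral_mono) (auto simp: G_def indicator_def add_ac)
    also have "\<dots> = (\<integral>\<^sup>+ t. indicator {0..s} t * (\<integral>\<^sup>+ z. ennreal \<bar>D z\<bar> \<partial>lborel) \<partial>lborel)"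
    proof (rule nn_integral_cong)
      fix t :: real
      have "(\<integral>\<^sup>+ z. ennreal \<bar>D (z + (x + t *\<^sub>R v))\<bar> \<partial>lborel) = (\<integral>\<^sup>+ z. ennreal \<bar>D z\<bar> \<partial>lborel)"
        by (rule nn_integral_lborel_translate[of "\<lambda>z. ennreal \<bar>D z\<bar>"]) measurable
      then show "(\<integral>\<^sup>+ z. indicator {0..s} t * ennreal \<bar>D (z + (x + t *\<^sub>R v))\<bar> \<partial>lborel) =
          indicator {0..s} t * (\<integral>\<^sup>+ z. ennreal \<bar>D z\<bar> \<partial>lborel)"
        by (subst nn_integral_cmult) auto
    qed
    also have "\<dots> = ennreal s * (\<integral>\<^sup>+ z. ennreal \<bar>D z\<bar> \<partial>lborel)"
      using s by (subst nn_integral_multc) auto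
    also have "\<dots> < \<infinity>"
      using D by (auto simp: integrable_iff_bounded intro!: ennreal_mult_less_top[THEN iffD2])
    finally show "(\<integral>\<^sup>+ p. ennreal (norm (case p of (z, t) \<Rightarrow> G z t)) \<partial>(lborel \<Otimes>\<^sub>M lborel)) < \<infinity>" .
  qed measurable
  have AE1: "AE z in lborel. integrable lborel (G z)"
    using lborel_pair.AE_integrable_fst[OF intG] by simp
  have AE2: "AE z in lborel. x + z \<in> B \<longrightarrow> x + z + s *\<^sub>R v \<in> B \<longrightarrow>
      ((\<lambda>t. D (x + z + t *\<^sub>R v)) has_integral (f (x + z + s *\<^sub>R v) - f (x + z))) {0..s}"
  proof -
    have "AE y in distr lborel borel ((+) x). y \<in> B \<longrightarrow> y + s *\<^sub>R v \<in> B \<longrightarrow>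
      ((\<lambda>t. D (y + t *\<^sub>R v)) has_integral (f (y + s *\<^sub>R v) - f y)) {0..s}"
      using line by (simp only: lborel_distr_plus)
    from AE_distrD[OF _ this] show ?thesis by simp
  qed
  have "steklov \<epsilon> f (x + s *\<^sub>R v) - steklov \<epsilon> f x =
      (\<integral>z. indicator ?Q z * (f (x + z + s *\<^sub>R v) - f (x + z)) \<partial>lborel) / \<epsilon> ^ ?n"
    using integrable_steklov[OF f, of \<epsilon> x] integrable_steklov[OF f, of \<epsilon> "x + s *\<^sub>R v"]
    by (simp add: steklov_def right_diff_distrib diff_divide_distrib add_ac)
  also have "(\<integral>z. indicator ?Q z * (f (x + z + s *\<^sub>R v) - f (x + z)) \<partial>lborel) =
      (\<integral>z. (\<integral>t. G z t \<partial>lborel) \<partial>lborel)"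
  proof (rule integral_cong_AE)
    show "AE z in lborel. indicator ?Q z * (f (x + z + s *\<^sub>R v) - f (x + z)) = (\<integral>t. G z t \<partial>lborel)"
      using AE1 AE2
    proof eventually_elim
      case (elim z)
      show ?case
      proof (cases "z \<in> ?Q")
        case True
        then have h: "((\<lambda>t. D (x + z + t *\<^sub>R v)) has_integral (f (x + z + s *\<^sub>R v) - f (x + z))) {0..s}"
          using elim(2) B by blast
        have "set_integrable lborel {0..s} (\<lambda>t. D (x + z + t *\<^sub>R v))"
        proof -
          have "G z = (\<lambda>t. indicator {0..s} t *\<^sub>R D (x + z + t *\<^sub>R v))"
            using True by (simp add: G_def fun_eq_iff)
          then show ?thesis using elim(1) unfolding set_integrable_def by simp
        qed
        from set_borel_integral_eq_integral(2)[OF this] integral_unique[OF h]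
        show ?thesis using True by (simp add: G_def set_lebesgue_integral_def)
      qed (simp add: G_def)
    qed
  qed measurable
  also have "\<dots> = (\<integral>t. (\<integral>z. G z t \<partial>lborel) \<partial>lborel)"
    by (rule lborel_pair.Fubini_integral[OF intG, symmetric])
  also have "\<dots> = (\<integral>t. indicator {0..s} t *\<^sub>R (\<epsilon> ^ ?n * steklov \<epsilon> D (x + t *\<^sub>R v)) \<partial>lborel)"
  proof (rule Bochner_Integration.integral_cong[OF refl])
    fix t :: real
    have "(\<integral>z. G z t \<partial>lborel) = (\<integral>z. indicator {0..s} t * (indicator ?Q z * D (x + t *\<^sub>R v + z)) \<partial>lborel)"
      by (intro Bochner_Integration.integral_cong refl) (simp add: G_def add_ac)
    then show "(\<integral>z. G z t \<partial>lborel) = indicator {0..s} t *\<^sub>R (\<epsilon> ^ ?n * steklov \<epsilon> D (x + t *\<^sub>R v))"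
      using \<epsilon> by (simp add: steklov_def)
  qed
  also have "\<dots> = \<epsilon> ^ ?n * integral {0..s} (\<lambda>t. steklov \<epsilon> D (x + t *\<^sub>R v))"
  proof -
    have c: "continuous_on {0..s} (\<lambda>t. steklov \<epsilon> D (x + t *\<^sub>R v))"
      by (rule continuous_on_compose2[OF continuous_steklov[OF D \<epsilon>]]) (auto intro!: continuous_intros)
    have "set_integrable lborel {0..s} (\<lambda>t. steklov \<epsilon> D (x + t *\<^sub>R v))"
      unfolding set_integrable_def by (intro borel_integrable_compact compact_Icc c)
    from set_borel_integral_eq_integral(2)[OF this]
    show ?thesis by (simp add: set_lebesgue_integral_def mult.left_commute)
  qed
  finally have "steklov \<epsilon> f (x + s *\<^sub>R v) - steklov \<epsilon> f x = integral {0..s} (\<lambda>t. steklov \<epsilon> D (x + t *\<^sub>R v))"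
    using \<epsilon> by simp
  moreover have c: "continuous_on {0..s} (\<lambda>t. steklov \<epsilon> D (x + t *\<^sub>R v))"
    by (rule continuous_on_compose2[OF continuous_steklov[OF D \<epsilon>]]) (auto intro!: continuous_intros)
  then have "integral {0..s} (\<lambda>t. steklov \<epsilon> D (x + t *\<^sub>R v) - d) =
      integral {0..s} (\<lambda>t. steklov \<epsilon> D (x + t *\<^sub>R v)) - s * d"
    using s by (subst integral_diff) (auto intro!: integrable_continuous_real)
  moreover have "norm (integral {0..s} (\<lambda>t. steklov \<epsilon> D (x + t *\<^sub>R v) - d)) \<le> e * (s - 0)"
    by (rule integral_bound) (use s c le in \<open>auto intro!: continuous_intros\<close>)
  ultimately show ?thesis by simp
qed

text \<open>The path from \<open>x\<close> to \<open>y\<close> changes one coordinate at a time. Its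
  vertices stay in the ball of radius \<open>r\<close>, since each displacement has the coordinates
  of \<open>y - x\<close> or zeros, and each of the \<open>n\<close> steps costs at most
  \<open>e / n\<close> times the length of \<open>y - x\<close>.\<close>

lemma has_derivative_coordinate_steps:
  fixes G :: "real^'n \<Rightarrow> real"
  assumes step: "\<And>e. e > 0 \<Longrightarrow> \<exists>r>0. \<forall>i y s. norm (y - x) < r \<longrightarrow> norm (y + s *\<^sub>R axis i 1 - x) < r \<longrightarrow>
      \<bar>G (y + s *\<^sub>R axis i 1) - G y - s * d i\<bar> \<le> e * \<bar>s\<bar>"
  shows "(G has_derivative (\<lambda>h. \<Sum>i\<in>UNIV. h $ i * d i)) (at x)"
  unfolding has_derivative_at_alt
proof (intro conjI allI impI)
  show "bounded_linear (\<lambda>h. \<Sum>i\<in>UNIV. h $ i * d i)"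
    by (intro bounded_linear_sum bounded_linear_mult_const bounded_linear_vec_nth)
  fix e :: real assume "e > 0"
  then have "e / CARD('n) > 0" by simp
  from step[OF this] obtain r where r: "r > 0" "\<And>i y s. norm (y - x) < r \<Longrightarrow> norm (y + s *\<^sub>R axis i 1 - x) < r \<Longrightarrow>
      \<bar>G (y + s *\<^sub>R axis i 1) - G y - s * d i\<bar> \<le> e / CARD('n) * \<bar>s\<bar>" by blast
  have "norm (G y - G x - (\<Sum>i\<in>UNIV. (y - x) $ i * d i)) \<le> e * norm (y - x)" if y: "norm (y - x) < r" for y
  proof -
    define h where "h = y - x"
    define p where "p I = (\<Sum>i\<in>I. h $ i *\<^sub>R axis i (1::real))" for I :: "'n set"
    have p_nth: "p I $ j = (if j \<in> I then h $ j else 0)" for I j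
      by (simp add: p_def axis_def if_distrib cong: if_cong)
    have p_norm: "norm (p I) < r" for I
    proof -
      have "norm (p I) \<le> norm h"
        by (rule norm_le_componentwise_cart) (simp add: p_nth)
      then show ?thesis using y by (simp add: h_def)
    qed
    have "\<bar>G (x + p I) - G x - (\<Sum>i\<in>I. h $ i * d i)\<bar> \<le> (\<Sum>i\<in>I. e / CARD('n) * \<bar>h $ i\<bar>)" if "finite I" for I
      using that
    proof (induction I rule: finite_induct)
      case empty
      then show ?case by (simp add: p_def)
    next
      case (insert j I)
      have pj: "p (insert j I) = p I + h $ j *\<^sub>R axis j 1" using insert by (simp add: p_def add.commute)
      have "norm (x + p I + h $ j *\<^sub>R axis j 1 - x) < r"
        using p_norm[of "insert j I"] by (simp add: pj algebra_simps)
      moreover have "norm (x + p I - x) < r" using p_norm[of I] by simp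
      ultimately have "\<bar>G (x + p I + h $ j *\<^sub>R axis j 1) - G (x + p I) - h $ j * d j\<bar> \<le> e / CARD('n) * \<bar>h $ j\<bar>"
        by (intro r(2))
      then show ?case using insert by (simp add: pj add.assoc)
    qed
    from this[of UNIV] have "\<bar>G (x + p UNIV) - G x - (\<Sum>i\<in>UNIV. h $ i * d i)\<bar> \<le> (\<Sum>i\<in>(UNIV :: 'n set). e / CARD('n) * \<bar>h $ i\<bar>)"
      by simp
    also have "\<dots> \<le> (\<Sum>i\<in>(UNIV :: 'n set). e / CARD('n) * norm h)"
      using \<open>e > 0\<close> by (intro sum_mono mult_left_mono component_le_norm_cart) auto
    also have "\<dots> = e * norm h" by simp
    finally have "\<bar>G (x + p UNIV) - G x - (\<Sum>i\<in>UNIV. h $ i * d i)\<bar> \<le> e * norm h" .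
    moreover have "x + p UNIV = y" by (simp add: vec_eq_iff p_nth h_def)
    ultimately show ?thesis by (simp add: h_def)
  qed
  then show "\<exists>d'>0. \<forall>y. norm (y - x) < d' \<longrightarrow>
      norm (G y - G x - (\<Sum>i\<in>UNIV. (y - x) $ i * d i)) \<le> e * norm (y - x)"
    using r(1) by blast
qed

lemma integral_le_nn_integral_continuous:
  fixes k :: "real \<Rightarrow> real"
  assumes "continuous_on {a..b} k"
  shows "ennreal \<bar>integral {a..b} k\<bar> \<le> (\<integral>\<^sup>+ t. ennreal \<bar>k t\<bar> * indicator {a..b} t \<partial>lborel)"
proof -
  have si: "set_integrable lborel {a..b} k"
    unfolding set_integrable_def by (intro borel_integrable_compact compact_Icc assms)
  have "ennreal \<bar>integral {a..b} k\<bar> = ennreal (norm (\<integral>t. indicator {a..b} t *\<^sub>R k t \<partial>lborel))"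
    using set_borel_integral_eq_integral(2)[OF si] by (simp add: set_lebesgue_integral_def)
  also have "\<dots> \<le> (\<integral>\<^sup>+ t. ennreal (norm (indicator {a..b} t *\<^sub>R k t)) \<partial>lborel)"
    using si unfolding set_integrable_def by (rule integral_norm_bound_ennreal)
  also have "\<dots> = (\<integral>\<^sup>+ t. ennreal \<bar>k t\<bar> * indicator {a..b} t \<partial>lborel)"
    by (intro nn_integral_cong) (auto simp: indicator_def)
  finally show ?thesis .
qed

lemma suminf_ennreal_tendsto_0:
  fixes f :: "nat \<Rightarrow> ennreal"
  assumes "(\<Sum>k. f k) < \<infinity>"
  shows "f \<longlonglongrightarrow> 0"
proof -
  have fin: "f k < \<infinity>" for k
    using assms ennreal_suminf_lessD[of f "\<infinity>" k] by simp
  define g where "g k = enn2real (f k)" for k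
  have fg: "f k = ennreal (g k)" for k using fin[of k] by (simp add: g_def less_top)
  have "summable g"
    using assms unfolding fg by (intro summable_suminf_not_top) (auto simp: g_def)
  then have "g \<longlonglongrightarrow> 0" by (rule summable_LIMSEQ_zero)
  then have "(\<lambda>k. ennreal (g k)) \<longlonglongrightarrow> ennreal 0" by (rule tendsto_ennrealI)
  then show ?thesis by (simp add: fg[abs_def])
qed

text \<open>The averages have the continuous partial derivatives
  \<open>steklov \<epsilon> (D i)\<close>, so they are differentiable and the ordinary fundamental
  theorem of calculus applies in the direction \<open>u\<close>, although the hypothesis concerns
  the coordinate directions only.\<close>

lemma steklov_ray_increment:
  fixes f :: "real^'n \<Rightarrow> real" and D :: "'n \<Rightarrow> real^'n \<Rightarrow> real"
  assumes f: "integrable lborel f" and D: "\<And>i. integrable lborel (D i)"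
    and \<eta>: "\<eta> > 0" and \<epsilon>: "\<epsilon> > 0" "real CARD('n) * \<epsilon> < \<eta> / 4"
    and line: "\<And>i l u. cbox l u \<subseteq> {x. a - \<eta> \<le> norm x \<and> norm x \<le> b + \<eta>} \<Longrightarrow>
      AE x in lborel. \<forall>s\<ge>0. x \<in> cbox l u \<longrightarrow> x + s *\<^sub>R axis i 1 \<in> cbox l u \<longrightarrow>
        ((\<lambda>t. D i (x + t *\<^sub>R axis i 1)) has_integral (f (x + s *\<^sub>R axis i 1) - f x)) {0..s}"
    and ab: "0 < a" "a \<le> b" and u: "norm u = 1"
  shows "ennreal \<bar>steklov \<epsilon> f (b *\<^sub>R u) - steklov \<epsilon> f (a *\<^sub>R u)\<bar> \<le>
    (\<integral>\<^sup>+ t. ennreal \<bar>\<Sum>i\<in>UNIV. u $ i * steklov \<epsilon> (D i) (t *\<^sub>R u)\<bar> * indicator {a..b} t \<partial>lborel)"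
proof -
  let ?S = "steklov \<epsilon>"
  have cont: "continuous_on UNIV (?S (D i))" for i by (rule continuous_steklov[OF D \<epsilon>(1)])
  have der: "(?S f has_derivative (\<lambda>h. \<Sum>i\<in>UNIV. h $ i * ?S (D i) x)) (at x)"
    if x: "a \<le> norm x" "norm x \<le> b" for x
  proof (rule has_derivative_coordinate_steps)
    fix e :: real assume "e > 0"
    have "\<forall>i. \<exists>r>0. \<forall>y. dist y x < r \<longrightarrow> dist (?S (D i) y) (?S (D i) x) < e"
      using cont \<open>e > 0\<close> unfolding continuous_on_iff by blast
    then obtain r where r: "\<And>i. r i > 0" "\<And>i y. dist y x < r i \<Longrightarrow> dist (?S (D i) y) (?S (D i) x) < e"
      by metis
    \<comment> \<open>The choice \<open>R \<le> \<eta> / 8\<close> gives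
      \<open>s < 2 * R \<le> \<eta> / 4\<close>; with the size
      \<open>CARD('n) * \<epsilon> < \<eta> / 4\<close> of the cube, every point of the box below is
      within \<open>5 * \<eta> / 8\<close> of \<open>x\<close>.\<close>
    define R where "R = min (\<eta> / 8) (Min (range r))"
    have "Min (range r) > 0" using r(1) by (subst Min_gr_iff) auto
    then have R: "R > 0" "R \<le> \<eta> / 8" "\<And>i. R \<le> r i"
      using \<eta> by (auto simp: R_def min.coboundedI2)
    have main: "\<bar>?S f (y + s *\<^sub>R axis i 1) - ?S f y - s * ?S (D i) x\<bar> \<le> e * s"
      if s: "s \<ge> 0" and y: "norm (y - x) < R" "norm (y + s *\<^sub>R axis i 1 - x) < R" for i y s
    proof -
      have "s = norm ((y + s *\<^sub>R axis i 1 - x) - (y - x))" using s by (simp add: norm_axis_1)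
      also have "\<dots> \<le> norm (y + s *\<^sub>R axis i 1 - x) + norm (y - x)" by (rule norm_triangle_ineq4)
      finally have s2: "s < 2 * R" using y by linarith
      define l where "l = y"
      \<comment> \<open>The box from \<open>l\<close> to \<open>w\<close> contains the averaging
        cube at \<open>y\<close> and its translate by \<open>s\<close> along the axis.\<close>
      define w where "w = y + \<epsilon> *\<^sub>R 1 + s *\<^sub>R axis i 1"
      have box: "cbox l w \<subseteq> {x. a - \<eta> \<le> norm x \<and> norm x \<le> b + \<eta>}"
      proof
        fix p assume p: "p \<in> cbox l w"
        have "norm (p - y) \<le> (\<Sum>j\<in>UNIV. \<bar>(p - y) $ j\<bar>)" by (rule norm_le_l1_cart)
        also have "\<dots> \<le> (\<Sum>j\<in>(UNIV :: 'n set). \<epsilon> + (if j = i then s else 0))"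
        proof (rule sum_mono)
          fix j show "\<bar>(p - y) $ j\<bar> \<le> \<epsilon> + (if j = i then s else 0)"
            using p[unfolded mem_box_cart, THEN spec[of _ j]] by (auto simp: l_def w_def axis_def)
        qed
        also have "\<dots> = real CARD('n) * \<epsilon> + s" by (simp add: sum.distrib)
        finally have "norm (p - y) < \<eta> / 4 + 2 * R" using \<epsilon>(2) s2 by linarith
        moreover have "norm (p - x) \<le> norm (p - y) + norm (y - x)"
          using norm_triangle_ineq[of "p - y" "y - x"] by simp
        ultimately have "norm (p - x) < \<eta>" using y(1) R(2) \<eta> by linarith
        then show "p \<in> {x. a - \<eta> \<le> norm x \<and> norm x \<le> b + \<eta>}"
          using x norm_triangle_ineq2[of p x] norm_triangle_ineq3[of p x] by auto
      qed
      show ?thesis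
      proof (rule steklov_increment[OF f D \<epsilon>(1) s])
        show "AE z in lborel. z \<in> cbox l w \<longrightarrow> z + s *\<^sub>R axis i 1 \<in> cbox l w \<longrightarrow>
          ((\<lambda>t. D i (z + t *\<^sub>R axis i 1)) has_integral (f (z + s *\<^sub>R axis i 1) - f z)) {0..s}"
          using line[OF box, of i] by eventually_elim (use s in blast)
        show "y + z \<in> cbox l w \<and> y + z + s *\<^sub>R axis i 1 \<in> cbox l w" if "z \<in> cbox 0 (\<epsilon> *\<^sub>R 1)" for z
        proof -
          have z: "0 \<le> z $ j" "z $ j \<le> \<epsilon>" "z $ j \<le> \<epsilon> + s" for j
            using that[unfolded mem_box_cart, THEN spec[of _ j]] s by auto
          show ?thesis using z s by (auto simp: mem_box_cart l_def w_def axis_def)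
        qed
        fix t assume t: "0 \<le> t" "t \<le> s"
        have "norm (y + t *\<^sub>R axis i 1 - x) < R"
        proof (cases "s = 0")
          case False
          have "y + t *\<^sub>R axis i 1 - x = (1 - t / s) *\<^sub>R (y - x) + (t / s) *\<^sub>R (y + s *\<^sub>R axis i 1 - x)"
            using False by (simp add: algebra_simps)
          moreover have "(1 - t / s) *\<^sub>R (y - x) + (t / s) *\<^sub>R (y + s *\<^sub>R axis i 1 - x) \<in> ball 0 R"
            using y t s False by (intro convexD[OF convex_ball]) auto
          ultimately show ?thesis by simp
        qed (use t y in simp)
        then have "dist (y + t *\<^sub>R axis i 1) x < r i" using R(3)[of i] by (simp add: dist_norm)
        from r(2)[OF this] show "\<bar>?S (D i) (y + t *\<^sub>R axis i 1) - ?S (D i) x\<bar> \<le> e"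
          by (simp add: dist_real_def)
      qed
    qed
    \<comment> \<open>For negative \<open>s\<close> the two endpoints exchange their roles.\<close>
    have "\<bar>?S f (y + s *\<^sub>R axis i 1) - ?S f y - s * ?S (D i) x\<bar> \<le> e * \<bar>s\<bar>"
      if y: "norm (y - x) < R" "norm (y + s *\<^sub>R axis i 1 - x) < R" for i y s
    proof (cases "s \<ge> 0")
      case True
      then show ?thesis using main y by simp
    next
      case False
      then show ?thesis using main[of "- s" "y + s *\<^sub>R axis i 1" i] y by (simp add: algebra_simps)
    qed
    then show "\<exists>r>0. \<forall>i y s. norm (y - x) < r \<longrightarrow> norm (y + s *\<^sub>R axis i 1 - x) < r \<longrightarrow>
      \<bar>?S f (y + s *\<^sub>R axis i 1) - ?S f y - s * ?S (D i) x\<bar> \<le> e * \<bar>s\<bar>"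
      using R(1) by blast
  qed
  define k where "k t = (\<Sum>i\<in>UNIV. u $ i * ?S (D i) (t *\<^sub>R u))" for t
  have ck: "continuous_on {a..b} k"
    unfolding k_def by (intro continuous_intros continuous_on_compose2[OF cont]) auto
  have "(k has_integral (?S f (b *\<^sub>R u) - ?S f (a *\<^sub>R u))) {a..b}"
  proof (rule fundamental_theorem_of_calculus[OF ab(2)])
    fix t assume t: "t \<in> {a..b}"
    have "((\<lambda>t. ?S f (t *\<^sub>R u)) has_derivative (\<lambda>h. \<Sum>i\<in>UNIV. (h *\<^sub>R u) $ i * ?S (D i) (t *\<^sub>R u))) (at t within {a..b})"
      by (rule has_derivative_compose[OF _ der]) (use t u ab in \<open>auto intro!: derivative_eq_intros\<close>)
    then show "((\<lambda>t. ?S f (t *\<^sub>R u)) has_vector_derivative k t) (at t within {a..b})"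
      by (simp add: has_vector_derivative_def k_def sum_distrib_left mult.assoc)
  qed
  then have "?S f (b *\<^sub>R u) - ?S f (a *\<^sub>R u) = integral {a..b} k" by (simp add: integral_unique)
  then show ?thesis
    using integral_le_nn_integral_continuous[OF ck] by (simp add: k_def)
qed

text \<open>The bound holds for the averages on every ray. Their values converge by continuity of
  \<open>g\<close>, and the errors of their partial derivatives are summable in mean, which by polar
  coordinates makes them tend to 0 in mean on almost every ray.\<close>

lemma AE_ray_increment_le:
  fixes g :: "real^'n \<Rightarrow> real" and D :: "'n \<Rightarrow> real^'n \<Rightarrow> real"
  assumes ab: "0 < a" "a \<le> b" "b < 1"
    and cont: "continuous_on punctured_ball g"
    and D: "\<And>\<alpha> \<beta> i. 0 < \<alpha> \<Longrightarrow> \<beta> < 1 \<Longrightarrow>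
      integrable lborel (\<lambda>x. indicator {x. \<alpha> \<le> norm x \<and> norm x \<le> \<beta>} x * D i x)"
    and line: "\<And>i l u. cbox l u \<subseteq> punctured_ball \<Longrightarrow>
      AE x in lborel. \<forall>s\<ge>0. x \<in> cbox l u \<longrightarrow> x + s *\<^sub>R axis i 1 \<in> cbox l u \<longrightarrow>
        ((\<lambda>t. D i (x + t *\<^sub>R axis i 1)) has_integral (g (x + s *\<^sub>R axis i 1) - g x)) {0..s}"
  shows "AE u in sphere_measure. ennreal \<bar>g (b *\<^sub>R u) - g (a *\<^sub>R u)\<bar> \<le>
    (\<integral>\<^sup>+ t. ennreal \<bar>\<Sum>i\<in>UNIV. u $ i * D i (t *\<^sub>R u)\<bar> * indicator {a..b} t \<partial>lborel)"
proof -
  let ?n = "CARD('n)"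
  \<comment> \<open>Half the distance of the radii \<open>a\<close> and \<open>b\<close> from 0 and
    1: the enlarged shell still lies in the punctured ball.\<close>
  define \<eta> where "\<eta> = min (a / 2) ((1 - b) / 2)"
  have \<eta>: "\<eta> > 0" "0 < a - \<eta>" "b + \<eta> < 1" using ab by (auto simp: \<eta>_def min_def field_simps)
  define Sh where "Sh = {x::real^'n. a - \<eta> \<le> norm x \<and> norm x \<le> b + \<eta>}"
  have "Sh = cball 0 (b + \<eta>) - ball 0 (a - \<eta>)" by (auto simp: Sh_def)
  then have "compact Sh" by (simp add: compact_diff)
  have Sh_sub: "Sh \<subseteq> punctured_ball"
  proof
    fix x assume "x \<in> Sh"
    then have "0 < norm x" "norm x < 1" using \<eta> unfolding Sh_def by auto
    then show "x \<in> punctured_ball" by (simp add: punctured_ball_def)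
  qed
  \<comment> \<open>The averages are defined for functions integrable on the whole space, hence the
    cut-off to the shell; line segments inside the shell are unaffected by it.\<close>
  define f where "f x = indicator Sh x * g x" for x
  define d where "d i x = indicator Sh x * D i x" for i x
  have f: "integrable lborel f"
    using borel_integrable_compact[OF \<open>compact Sh\<close> continuous_on_subset[OF cont Sh_sub]]
    by (simp add: f_def[abs_def])
  have d: "integrable lborel (d i)" for i
    unfolding d_def Sh_def using \<eta> by (intro D) auto
  have [measurable]: "d i \<in> borel_measurable borel" for i using d[of i] by auto
  have line': "AE x in lborel. \<forall>s\<ge>0. x \<in> cbox l w \<longrightarrow> x + s *\<^sub>R axis i 1 \<in> cbox l w \<longrightarrow>
      ((\<lambda>t. d i (x + t *\<^sub>R axis i 1)) has_integral (f (x + s *\<^sub>R axis i 1) - f x)) {0..s}"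
    if box: "cbox l w \<subseteq> Sh" for i l w
  proof -
    have "cbox l w \<subseteq> punctured_ball" using box Sh_sub by blast
    from line[OF this, of i] show ?thesis
    proof eventually_elim
      case (elim x)
      show ?case
      proof (intro allI impI)
        fix s :: real assume s: "0 \<le> s" and x: "x \<in> cbox l w" "x + s *\<^sub>R axis i 1 \<in> cbox l w"
        have seg: "x + t *\<^sub>R axis i 1 \<in> Sh" if "t \<in> {0..s}" for t
        proof -
          have "x + t *\<^sub>R axis i 1 \<in> cbox l w"
            unfolding mem_box_cart
          proof
            fix j
            show "l $ j \<le> (x + t *\<^sub>R axis i 1) $ j \<and> (x + t *\<^sub>R axis i 1) $ j \<le> w $ j"
              using that x[unfolded mem_box_cart, THEN spec[of _ j]] by (auto simp: axis_def)
          qed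
          then show ?thesis using box by blast
        qed
        have "((\<lambda>t. D i (x + t *\<^sub>R axis i 1)) has_integral (g (x + s *\<^sub>R axis i 1) - g x)) {0..s}"
          using elim s x by blast
        then have "((\<lambda>t. d i (x + t *\<^sub>R axis i 1)) has_integral (g (x + s *\<^sub>R axis i 1) - g x)) {0..s}"
          by (rule has_integral_eq[rotated]) (simp add: d_def seg)
        moreover have "f x = g x" "f (x + s *\<^sub>R axis i 1) = g (x + s *\<^sub>R axis i 1)"
          using x box by (auto simp: f_def indicator_def)
        ultimately show "((\<lambda>t. d i (x + t *\<^sub>R axis i 1)) has_integral (f (x + s *\<^sub>R axis i 1) - f x)) {0..s}"
          by simp
      qed
    qed
  qed
  \<comment> \<open>The scale keeps the cubes inside the enlarged shell, tends to 0 with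
    \<open>k\<close>, and makes the errors in mean at most \<open>(1 / 2) ^ k\<close>, whose sum is
    finite.\<close>
  have "\<exists>\<epsilon>. 0 < \<epsilon> \<and> real ?n * \<epsilon> < \<eta> / 4 \<and> real ?n * \<epsilon> \<le> (1 / 2) ^ k \<and>
      (\<forall>i. (\<integral>\<^sup>+ x. ennreal \<bar>steklov \<epsilon> (d i) x - d i x\<bar> \<partial>lborel) \<le> ennreal ((1 / 2) ^ k))" for k :: nat
  proof -
    have "\<forall>i. \<exists>r>0. \<forall>h. norm h < r \<longrightarrow> (\<integral>\<^sup>+ x. ennreal \<bar>d i (x + h) - d i x\<bar> \<partial>lborel) \<le> ennreal ((1 / 2) ^ k)"
      using L1_continuity_translation[OF d] by simp
    then obtain r where r: "\<And>i. r i > 0" "\<And>i h. norm h < r i \<Longrightarrow>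
        (\<integral>\<^sup>+ x. ennreal \<bar>d i (x + h) - d i x\<bar> \<partial>lborel) \<le> ennreal ((1 / 2) ^ k)" by metis
    define m where "m = min (Min (range r)) (min (\<eta> / 4) ((1 / 2) ^ k))"
    have "Min (range r) > 0" using r(1) by (subst Min_gr_iff) auto
    then have m: "m > 0" "m \<le> \<eta> / 4" "m \<le> (1 / 2) ^ k" using \<eta> by (auto simp: m_def)
    have mr: "m \<le> r i" for i by (auto simp: m_def min.coboundedI1)
    define \<epsilon> where "\<epsilon> = m / (2 * real ?n)"
    have \<epsilon>: "\<epsilon> > 0" "real ?n * \<epsilon> = m / 2" using m by (auto simp: \<epsilon>_def)
    have "(\<integral>\<^sup>+ x. ennreal \<bar>steklov \<epsilon> (d i) x - d i x\<bar> \<partial>lborel) \<le> ennreal ((1 / 2) ^ k)" for i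
    proof (rule steklov_L1[OF d \<epsilon>(1)])
      fix h :: "real^'n" assume "norm h \<le> real ?n * \<epsilon>"
      then have "norm h < r i" using \<epsilon>(2) m(1) mr[of i] by linarith
      then show "(\<integral>\<^sup>+ x. ennreal \<bar>d i (x + h) - d i x\<bar> \<partial>lborel) \<le> ennreal ((1 / 2) ^ k)" by (rule r(2))
    qed
    then show ?thesis using \<epsilon> m by (intro exI[of _ \<epsilon>]) auto
  qed
  then have "\<exists>\<epsilon>. \<forall>k. 0 < \<epsilon> k \<and> real ?n * \<epsilon> k < \<eta> / 4 \<and> real ?n * \<epsilon> k \<le> (1 / 2) ^ k \<and>
      (\<forall>i. (\<integral>\<^sup>+ x. ennreal \<bar>steklov (\<epsilon> k) (d i) x - d i x\<bar> \<partial>lborel) \<le> ennreal ((1 / 2) ^ k))"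
    by (intro choice allI)
  then obtain \<epsilon> where \<epsilon>: "\<And>k. 0 < \<epsilon> k" "\<And>k. real ?n * \<epsilon> k < \<eta> / 4" "\<And>k. real ?n * \<epsilon> k \<le> (1 / 2) ^ k"
    "\<And>k i. (\<integral>\<^sup>+ x. ennreal \<bar>steklov (\<epsilon> k) (d i) x - d i x\<bar> \<partial>lborel) \<le> ennreal ((1 / 2) ^ k)"
    by blast
  \<comment> \<open>Integrability of the sum of \<open>E k\<close> over all \<open>k\<close> treats
    the whole sequence at once: on almost every ray the series of integrals converges, so its terms
    tend to 0.\<close>
  define E where "E k x = (\<Sum>i\<in>UNIV. ennreal \<bar>steklov (\<epsilon> k) (d i) x - d i x\<bar>)" for k x
  have [measurable]: "steklov (\<epsilon> k) (d i) \<in> borel_measurable borel" for k i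
    by (intro borel_measurable_continuous_onI continuous_steklov d \<epsilon>)
  have [measurable]: "E k \<in> borel_measurable borel" for k unfolding E_def by measurable
  have "(\<integral>\<^sup>+ x. (\<Sum>k. E k x) * indicator punctured_ball x \<partial>lborel) \<le> (\<integral>\<^sup>+ x. (\<Sum>k. E k x) \<partial>lborel)"
    by (intro nn_integral_mono) (auto simp: indicator_def)
  also have "\<dots> = (\<Sum>k. (\<integral>\<^sup>+ x. E k x \<partial>lborel))"
    by (rule nn_integral_suminf) measurable
  also have "\<dots> \<le> (\<Sum>k. ennreal (real ?n * (1 / 2) ^ k))"
  proof (intro suminf_le)
    fix k
    have "(\<integral>\<^sup>+ x. E k x \<partial>lborel) = (\<Sum>i\<in>UNIV. \<integral>\<^sup>+ x. ennreal \<bar>steklov (\<epsilon> k) (d i) x - d i x\<bar> \<partial>lborel)"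
      unfolding E_def by (rule nn_integral_sum) measurable
    also have "\<dots> \<le> (\<Sum>i\<in>(UNIV :: 'n set). ennreal ((1 / 2) ^ k))"
      by (intro sum_mono \<epsilon>)
    also have "\<dots> = ennreal (\<Sum>i\<in>(UNIV :: 'n set). (1 / 2) ^ k)" by (rule sum_ennreal) simp
    finally show "(\<integral>\<^sup>+ x. E k x \<partial>lborel) \<le> ennreal (real ?n * (1 / 2) ^ k)" by simp
  qed auto
  also have "\<dots> = ennreal (\<Sum>k. real ?n * (1 / 2) ^ k)"
    by (intro suminf_ennreal2 summable_mult summable_geometric) auto
  also have "\<dots> < \<infinity>" by simp
  finally have "AE u in sphere_measure. (\<integral>\<^sup>+ t. (\<Sum>k. E k (t *\<^sub>R u)) * radial_weight ?n t \<partial>lborel) < \<infinity>"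
    by (intro AE_polar_finite) measurable
  moreover have "AE u in (sphere_measure :: (real^'n) measure). norm u = 1"
    by (rule AE_sphere_measure_norm)
  ultimately show ?thesis
  proof eventually_elim
    case (elim u)
    define I where "I = (\<integral>\<^sup>+ t. ennreal \<bar>\<Sum>i\<in>UNIV. u $ i * D i (t *\<^sub>R u)\<bar> * indicator {a..b} t \<partial>lborel)"
    define e where "e k = (\<integral>\<^sup>+ t. E k (t *\<^sub>R u) * indicator {a..b} t \<partial>lborel)" for k
    have ray: "t *\<^sub>R u \<in> Sh" if "t \<in> {a..b}" for t
      using that ab \<eta> elim(2) by (auto simp: Sh_def)
    have "(\<lambda>k. \<integral>\<^sup>+ t. E k (t *\<^sub>R u) * radial_weight ?n t \<partial>lborel) \<longlonglongrightarrow> 0"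
    proof (rule suminf_ennreal_tendsto_0)
      have "(\<Sum>k. \<integral>\<^sup>+ t. E k (t *\<^sub>R u) * radial_weight ?n t \<partial>lborel) =
          (\<integral>\<^sup>+ t. (\<Sum>k. E k (t *\<^sub>R u) * radial_weight ?n t) \<partial>lborel)"
        by (rule nn_integral_suminf[symmetric]) measurable
      then show "(\<Sum>k. \<integral>\<^sup>+ t. E k (t *\<^sub>R u) * radial_weight ?n t \<partial>lborel) < \<infinity>"
        using elim(1) by simp
    qed
    then have "(\<lambda>k. ennreal (1 / a ^ (?n - 1)) * (\<integral>\<^sup>+ t. E k (t *\<^sub>R u) * radial_weight ?n t \<partial>lborel)) \<longlonglongrightarrow> ennreal (1 / a ^ (?n - 1)) * 0"
      by (intro ennreal_tendsto_cmult) auto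
    \<comment> \<open>On \<open>{a..b}\<close> the radial weight is at least
      \<open>a ^ (n - 1)\<close>, so it can be divided out.\<close>
    moreover have "e k \<le> ennreal (1 / a ^ (?n - 1)) * (\<integral>\<^sup>+ t. E k (t *\<^sub>R u) * radial_weight ?n t \<partial>lborel)" for k
    proof -
      have "e k \<le> (\<integral>\<^sup>+ t. ennreal (1 / a ^ (?n - 1)) * (E k (t *\<^sub>R u) * radial_weight ?n t) \<partial>lborel)"
        unfolding e_def
      proof (rule nn_integral_mono)
        fix t :: real
        show "E k (t *\<^sub>R u) * indicator {a..b} t \<le> ennreal (1 / a ^ (?n - 1)) * (E k (t *\<^sub>R u) * radial_weight ?n t)"
        proof (cases "t \<in> {a..b}")
          case True
          then have t: "0 < t" "t < 1" "a \<le> t" using ab by auto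
          have "a ^ (?n - 1) \<le> t ^ (?n - 1)" using t ab by (intro power_mono) auto
          then have "1 \<le> 1 / a ^ (?n - 1) * t ^ (?n - 1)" using ab by simp
          then have "1 \<le> ennreal (1 / a ^ (?n - 1)) * ennreal (t ^ (?n - 1))"
            using ab t by (simp flip: ennreal_mult ennreal_1)
          then have "E k (t *\<^sub>R u) * 1 \<le> E k (t *\<^sub>R u) * (ennreal (1 / a ^ (?n - 1)) * ennreal (t ^ (?n - 1)))"
            by (rule mult_left_mono) simp
          then show ?thesis using True t by (simp add: mult_ac)
        qed simp
      qed
      also have "\<dots> = ennreal (1 / a ^ (?n - 1)) * (\<integral>\<^sup>+ t. E k (t *\<^sub>R u) * radial_weight ?n t \<partial>lborel)"
        by (rule nn_integral_cmult) measurable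
      finally show ?thesis .
    qed
    ultimately have e0: "e \<longlonglongrightarrow> 0"
      by (intro tendsto_sandwich[of "\<lambda>_. 0" e sequentially]) (auto intro: always_eventually)
    have bound: "ennreal \<bar>steklov (\<epsilon> k) f (b *\<^sub>R u) - steklov (\<epsilon> k) f (a *\<^sub>R u)\<bar> \<le> I + e k" for k
    proof -
      have "ennreal \<bar>steklov (\<epsilon> k) f (b *\<^sub>R u) - steklov (\<epsilon> k) f (a *\<^sub>R u)\<bar> \<le>
        (\<integral>\<^sup>+ t. ennreal \<bar>\<Sum>i\<in>UNIV. u $ i * steklov (\<epsilon> k) (d i) (t *\<^sub>R u)\<bar> * indicator {a..b} t \<partial>lborel)"
        by (rule steklov_ray_increment[OF f d \<eta>(1) \<epsilon>(1,2) line' ab(1,2) elim(2)]) (simp_all add: Sh_def)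
      also have "\<dots> \<le> (\<integral>\<^sup>+ t. ennreal \<bar>\<Sum>i\<in>UNIV. u $ i * d i (t *\<^sub>R u)\<bar> * indicator {a..b} t +
          E k (t *\<^sub>R u) * indicator {a..b} t \<partial>lborel)"
      proof (rule nn_integral_mono)
        fix t :: real
        have "\<bar>\<Sum>i\<in>UNIV. u $ i * steklov (\<epsilon> k) (d i) (t *\<^sub>R u)\<bar> \<le>
            \<bar>\<Sum>i\<in>UNIV. u $ i * d i (t *\<^sub>R u)\<bar> +
            \<bar>\<Sum>i\<in>UNIV. u $ i * (steklov (\<epsilon> k) (d i) (t *\<^sub>R u) - d i (t *\<^sub>R u))\<bar>"
          by (simp add: right_diff_distrib sum_subtractf)
        also have "\<bar>\<Sum>i\<in>UNIV. u $ i * (steklov (\<epsilon> k) (d i) (t *\<^sub>R u) - d i (t *\<^sub>R u))\<bar> \<le>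
            (\<Sum>i\<in>UNIV. \<bar>steklov (\<epsilon> k) (d i) (t *\<^sub>R u) - d i (t *\<^sub>R u)\<bar>)"
        proof (intro order_trans[OF sum_abs] sum_mono)
          fix i
          have "\<bar>u $ i\<bar> \<le> 1" using component_le_norm_cart[of u i] elim(2) by simp
          then show "\<bar>u $ i * (steklov (\<epsilon> k) (d i) (t *\<^sub>R u) - d i (t *\<^sub>R u))\<bar> \<le>
              \<bar>steklov (\<epsilon> k) (d i) (t *\<^sub>R u) - d i (t *\<^sub>R u)\<bar>"
            by (simp add: abs_mult mult_left_le_one_le)
        qed
        finally have "ennreal \<bar>\<Sum>i\<in>UNIV. u $ i * steklov (\<epsilon> k) (d i) (t *\<^sub>R u)\<bar> \<le>
            ennreal (\<bar>\<Sum>i\<in>UNIV. u $ i * d i (t *\<^sub>R u)\<bar> +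
            (\<Sum>i\<in>UNIV. \<bar>steklov (\<epsilon> k) (d i) (t *\<^sub>R u) - d i (t *\<^sub>R u)\<bar>))"
          by (intro ennreal_leI) simp
        also have "\<dots> = ennreal \<bar>\<Sum>i\<in>UNIV. u $ i * d i (t *\<^sub>R u)\<bar> + E k (t *\<^sub>R u)"
          by (subst ennreal_plus) (auto simp: E_def sum_ennreal sum_nonneg)
        finally show "ennreal \<bar>\<Sum>i\<in>UNIV. u $ i * steklov (\<epsilon> k) (d i) (t *\<^sub>R u)\<bar> * indicator {a..b} t \<le>
          ennreal \<bar>\<Sum>i\<in>UNIV. u $ i * d i (t *\<^sub>R u)\<bar> * indicator {a..b} t + E k (t *\<^sub>R u) * indicator {a..b} t"
          by (simp add: indicator_def)
      qed
      also have "\<dots> = (\<integral>\<^sup>+ t. ennreal \<bar>\<Sum>i\<in>UNIV. u $ i * d i (t *\<^sub>R u)\<bar> * indicator {a..b} t \<partial>lborel) + e k"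
        unfolding e_def by (rule nn_integral_add) measurable
      also have "(\<integral>\<^sup>+ t. ennreal \<bar>\<Sum>i\<in>UNIV. u $ i * d i (t *\<^sub>R u)\<bar> * indicator {a..b} t \<partial>lborel) = I"
        unfolding I_def
      proof (rule nn_integral_cong)
        fix t
        show "ennreal \<bar>\<Sum>i\<in>UNIV. u $ i * d i (t *\<^sub>R u)\<bar> * indicator {a..b} t =
            ennreal \<bar>\<Sum>i\<in>UNIV. u $ i * D i (t *\<^sub>R u)\<bar> * indicator {a..b} t"
          using ray[of t] by (cases "t \<in> {a..b}") (auto simp: d_def)
      qed
      finally show ?thesis .
    qed
    \<comment> \<open>Near the ray the cut-off function coincides with \<open>g\<close>, because the
      cube at \<open>c *\<^sub>R u\<close> stays inside the enlarged shell.\<close>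
    have lim: "(\<lambda>k. steklov (\<epsilon> k) f (c *\<^sub>R u)) \<longlonglongrightarrow> g (c *\<^sub>R u)" if c: "c \<in> {a..b}" for c
    proof (rule LIMSEQ_I)
      fix r :: real assume "r > 0"
      have cb: "c *\<^sub>R u \<in> punctured_ball" using ray[OF c] Sh_sub by blast
      obtain \<delta> where \<delta>: "\<delta> > 0" "\<And>y. y \<in> punctured_ball \<Longrightarrow> dist y (c *\<^sub>R u) < \<delta> \<Longrightarrow> dist (g y) (g (c *\<^sub>R u)) < r / 2"
        using cont cb \<open>r > 0\<close> unfolding continuous_on_iff by (metis half_gt_zero)
      obtain K where K: "(1 / 2 :: real) ^ K < \<delta>" using real_arch_pow_inv[of \<delta> "1 / 2"] \<delta>(1) by auto
      have "norm (steklov (\<epsilon> k) f (c *\<^sub>R u) - g (c *\<^sub>R u)) < r" if k: "k \<ge> K" for k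
      proof -
        have "\<bar>steklov (\<epsilon> k) f (c *\<^sub>R u) - g (c *\<^sub>R u)\<bar> \<le> r / 2"
        proof (rule steklov_near_const[OF f \<epsilon>(1)])
          fix z :: "real^'n" assume z: "norm z \<le> real ?n * \<epsilon> k"
          have "(1 / 2 :: real) ^ k \<le> (1 / 2) ^ K" using k by (intro power_decreasing) auto
          then have "norm z < \<delta>" using z \<epsilon>(3)[of k] K by linarith
          have nc: "norm (c *\<^sub>R u) = c" using c ab elim(2) by simp
          have "norm z < \<eta> / 4" using z \<epsilon>(2)[of k] by linarith
          then have "c *\<^sub>R u + z \<in> Sh"
            using norm_triangle_ineq[of "c *\<^sub>R u" z] norm_diff_ineq[of "c *\<^sub>R u" z] nc c \<eta>(1)
            by (auto simp: Sh_def)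
          then show "\<bar>f (c *\<^sub>R u + z) - g (c *\<^sub>R u)\<bar> \<le> r / 2"
            using \<delta>(2)[of "c *\<^sub>R u + z"] Sh_sub \<open>norm z < \<delta>\<close>
            by (auto simp: f_def dist_norm less_imp_le)
        qed
        then show ?thesis using \<open>r > 0\<close> by simp
      qed
      then show "\<exists>K. \<forall>k\<ge>K. norm (steklov (\<epsilon> k) f (c *\<^sub>R u) - g (c *\<^sub>R u)) < r" by blast
    qed
    have "(\<lambda>k. \<bar>steklov (\<epsilon> k) f (b *\<^sub>R u) - steklov (\<epsilon> k) f (a *\<^sub>R u)\<bar>) \<longlonglongrightarrow> \<bar>g (b *\<^sub>R u) - g (a *\<^sub>R u)\<bar>"
      using ab by (intro tendsto_intros lim) auto
    then have "(\<lambda>k. ennreal \<bar>steklov (\<epsilon> k) f (b *\<^sub>R u) - steklov (\<epsilon> k) f (a *\<^sub>R u)\<bar>) \<longlonglongrightarrow> ennreal \<bar>g (b *\<^sub>R u) - g (a *\<^sub>R u)\<bar>"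
      by (rule tendsto_ennrealI)
    moreover have "(\<lambda>k. I + e k) \<longlonglongrightarrow> I + 0" by (intro tendsto_add tendsto_const e0)
    ultimately have "ennreal \<bar>g (b *\<^sub>R u) - g (a *\<^sub>R u)\<bar> \<le> I + 0"
      by (rule LIMSEQ_le) (use bound in auto)
    then show ?case by (simp add: I_def)
  qed
qed

section \<open>Absolute continuity on lines\<close>

lemma abs_cont_on_interval_subset:
  assumes "abs_cont_on_interval \<alpha> \<beta> h" "\<alpha> \<le> \<alpha>'" "\<beta>' \<le> \<beta>"
  shows "abs_cont_on_interval \<alpha>' \<beta>' h"
  unfolding abs_cont_on_interval_def
proof (intro allI impI)
  fix e :: real assume "e > 0"
  then obtain d where "d > 0" and d: "\<And>(N::nat) l u.
      (\<forall>k<N. \<alpha> \<le> l k \<and> l k \<le> u k \<and> u k \<le> \<beta>) \<and>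
      disjoint_family_on (\<lambda>k. {l k<..<u k}) {..<N} \<and> (\<Sum>k<N. u k - l k) < d
      \<Longrightarrow> (\<Sum>k<N. dist (h (u k)) (h (l k))) < e"
    using assms(1) unfolding abs_cont_on_interval_def by meson
  show "\<exists>d>0. \<forall>(N::nat) l u.
      (\<forall>k<N. \<alpha>' \<le> l k \<and> l k \<le> u k \<and> u k \<le> \<beta>') \<and>
      disjoint_family_on (\<lambda>k. {l k<..<u k}) {..<N} \<and> (\<Sum>k<N. u k - l k) < d
      \<longrightarrow> (\<Sum>k<N. dist (h (u k)) (h (l k))) < e"
  proof (intro exI[of _ d] conjI allI impI \<open>d > 0\<close>)
    fix N :: nat and l u
    assume A: "(\<forall>k<N. \<alpha>' \<le> l k \<and> l k \<le> u k \<and> u k \<le> \<beta>') \<and>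
      disjoint_family_on (\<lambda>k. {l k<..<u k}) {..<N} \<and> (\<Sum>k<N. u k - l k) < d"
    then have "\<forall>k<N. \<alpha> \<le> l k \<and> l k \<le> u k \<and> u k \<le> \<beta>"
      using assms(2,3) by (meson order_trans)
    then show "(\<Sum>k<N. dist (h (u k)) (h (l k))) < e" using A d by blast
  qed
qed

lemma abs_cont_on_interval_compose_Lipschitz:
  assumes "abs_cont_on_interval \<alpha> \<beta> h"
    and lip: "L-lipschitz_on (h ` {\<alpha>..\<beta>}) \<phi>"
  shows "abs_cont_on_interval \<alpha> \<beta> (\<lambda>t. \<phi> (h t))"
  unfolding abs_cont_on_interval_def
proof (intro allI impI)
  fix e :: real assume "e > 0"
  have "L \<ge> 0" using lip by (rule lipschitz_on_nonneg)
  then have "e / (L + 1) > 0" using \<open>e > 0\<close> by simp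
  then obtain d where "d > 0" and d: "\<And>(N::nat) l u.
      (\<forall>k<N. \<alpha> \<le> l k \<and> l k \<le> u k \<and> u k \<le> \<beta>) \<and>
      disjoint_family_on (\<lambda>k. {l k<..<u k}) {..<N} \<and> (\<Sum>k<N. u k - l k) < d
      \<Longrightarrow> (\<Sum>k<N. dist (h (u k)) (h (l k))) < e / (L + 1)"
    using assms(1) unfolding abs_cont_on_interval_def by meson
  show "\<exists>d>0. \<forall>(N::nat) l u.
      (\<forall>k<N. \<alpha> \<le> l k \<and> l k \<le> u k \<and> u k \<le> \<beta>) \<and>
      disjoint_family_on (\<lambda>k. {l k<..<u k}) {..<N} \<and> (\<Sum>k<N. u k - l k) < d
      \<longrightarrow> (\<Sum>k<N. dist (\<phi> (h (u k))) (\<phi> (h (l k)))) < e"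
  proof (intro exI[of _ d] conjI allI impI \<open>d > 0\<close>)
    fix N :: nat and l u
    assume A: "(\<forall>k<N. \<alpha> \<le> l k \<and> l k \<le> u k \<and> u k \<le> \<beta>) \<and>
      disjoint_family_on (\<lambda>k. {l k<..<u k}) {..<N} \<and> (\<Sum>k<N. u k - l k) < d"
    have "dist (\<phi> (h (u k))) (\<phi> (h (l k))) \<le> L * dist (h (u k)) (h (l k))" if "k < N" for k
    proof (rule lipschitz_onD[OF lip])
      have "l k \<in> {\<alpha>..\<beta>}" "u k \<in> {\<alpha>..\<beta>}" using A that by force+
      then show "h (l k) \<in> h ` {\<alpha>..\<beta>}" "h (u k) \<in> h ` {\<alpha>..\<beta>}" by auto
    qed
    then have "(\<Sum>k<N. dist (\<phi> (h (u k))) (\<phi> (h (l k)))) \<le> (\<Sum>k<N. L * dist (h (u k)) (h (l k)))"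
      by (intro sum_mono) auto
    also have "\<dots> \<le> (L + 1) * (\<Sum>k<N. dist (h (u k)) (h (l k)))"
      using \<open>L \<ge> 0\<close> by (simp add: sum_distrib_left[symmetric] mult_right_mono sum_nonneg)
    also have "\<dots> < (L + 1) * (e / (L + 1))"
      using d[OF A] \<open>L \<ge> 0\<close> by (intro mult_strict_left_mono) auto
    also have "\<dots> = e" using \<open>L \<ge> 0\<close> by simp
    finally show "(\<Sum>k<N. dist (\<phi> (h (u k))) (\<phi> (h (l k)))) < e" .
  qed
qed

text \<open>Reindexing makes the definition, stated for intervals numbered by naturals, applicable
  to the elements of a tagged division.\<close>

lemma abs_cont_on_interval_sum:
  assumes ac: "abs_cont_on_interval \<alpha> \<beta> h" and "e > 0"
  obtains d where "d > 0" and "\<And>(p :: 'b set) l u. finite p \<Longrightarrow>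
      (\<And>k. k \<in> p \<Longrightarrow> \<alpha> \<le> l k \<and> l k \<le> u k \<and> u k \<le> \<beta>) \<Longrightarrow>
      disjoint_family_on (\<lambda>k. {l k<..<u k}) p \<Longrightarrow> (\<Sum>k\<in>p. u k - l k) < d \<Longrightarrow>
      (\<Sum>k\<in>p. dist (h (u k)) (h (l k))) < e"
proof -
  obtain d where "d > 0" and d: "\<And>(N::nat) l u.
      (\<forall>k<N. \<alpha> \<le> l k \<and> l k \<le> u k \<and> u k \<le> \<beta>) \<and>
      disjoint_family_on (\<lambda>k. {l k<..<u k}) {..<N} \<and> (\<Sum>k<N. u k - l k) < d
      \<Longrightarrow> (\<Sum>k<N. dist (h (u k)) (h (l k))) < e"
    using ac \<open>e > 0\<close> unfolding abs_cont_on_interval_def by meson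
  have "(\<Sum>k\<in>p. dist (h (u k)) (h (l k))) < e"
    if p: "finite p" "\<And>k. k \<in> p \<Longrightarrow> \<alpha> \<le> l k \<and> l k \<le> u k \<and> u k \<le> \<beta>"
      "disjoint_family_on (\<lambda>k. {l k<..<u k}) p" "(\<Sum>k\<in>p. u k - l k) < d" for p :: "'b set" and l u
  proof -
    obtain f where f: "bij_betw f {..<card p} p"
      using ex_bij_betw_nat_finite[OF p(1)] by (auto simp: atLeast0LessThan)
    have fp: "f k \<in> p" if "k < card p" for k using f that by (auto simp: bij_betw_def)
    have sum: "(\<Sum>k<card p. g (f k)) = (\<Sum>k\<in>p. g k)" for g :: "'b \<Rightarrow> real"
      by (rule sum.reindex_bij_betw[OF f])
    have "disjoint_family_on (\<lambda>k. {l (f k)<..<u (f k)}) {..<card p}"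
      unfolding disjoint_family_on_def
    proof (intro ballI impI)
      fix j k assume "j \<in> {..<card p}" "k \<in> {..<card p}" "j \<noteq> k"
      then have "f j \<noteq> f k" "f j \<in> p" "f k \<in> p"
        using f by (auto simp: bij_betw_def inj_on_def)
      then show "{l (f j)<..<u (f j)} \<inter> {l (f k)<..<u (f k)} = {}"
        using p(3) unfolding disjoint_family_on_def by blast
    qed
    then show ?thesis
      using d[of "card p" "\<lambda>k. l (f k)" "\<lambda>k. u (f k)"] p fp sum[of "\<lambda>k. u k - l k"]
        sum[of "\<lambda>k. dist (h (u k)) (h (l k))"] by auto
  qed
  then show thesis using that[OF \<open>d > 0\<close>] by blast
qed

text \<open>Intervals of a tagged division with tags in the exceptional null set have small total length,
  and absolute continuity controls the increments of the function over them.\<close>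

theorem abs_cont_fundamental_theorem_of_calculus:
  fixes h :: "real \<Rightarrow> real"
  assumes "\<alpha> \<le> \<beta>" and ac: "abs_cont_on_interval \<alpha> \<beta> h" and N: "negligible N"
    and der: "\<And>t. t \<in> {\<alpha>..\<beta>} - N \<Longrightarrow> (h has_real_derivative h' t) (at t within {\<alpha>..\<beta>})"
  shows "(h' has_integral (h \<beta> - h \<alpha>)) {\<alpha>..\<beta>}"
proof -
  \<comment> \<open>With the value 0 on \<open>N\<close>, an interval tagged in \<open>N\<close>
    contributes nothing to the Riemann sum, and only the increment of \<open>h\<close> over it has
    to be estimated.\<close>
  define g where "g t = (if t \<in> N then 0 else h' t)" for t
  have "(g has_integral (h \<beta> - h \<alpha>)) {\<alpha>..\<beta>}"
    unfolding has_integral_real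
  proof (intro allI impI)
    fix e :: real assume "e > 0"
    then have "e / 3 > 0" by simp
    from abs_cont_on_interval_sum[OF ac this] obtain \<delta> where "\<delta> > 0"
      and \<delta>: "\<And>(p :: (real \<times> real set) set) l u. finite p \<Longrightarrow>
      (\<And>k. k \<in> p \<Longrightarrow> \<alpha> \<le> l k \<and> l k \<le> u k \<and> u k \<le> \<beta>) \<Longrightarrow>
      disjoint_family_on (\<lambda>k. {l k<..<u k}) p \<Longrightarrow> (\<Sum>k\<in>p. u k - l k) < \<delta> \<Longrightarrow>
      (\<Sum>k\<in>p. dist (h (u k)) (h (l k))) < e / 3" by blast
    have "N \<in> sets lebesgue" using N negligible_imp_sets by blast
    then obtain V where V: "open V" "N \<subseteq> V" "V - N \<in> lmeasurable" "emeasure lebesgue (V - N) < ennreal \<delta>"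
      using sets_lebesgue_outer_open \<open>\<delta> > 0\<close> by blast
    have NM: "N \<in> null_sets lebesgue" using N negligible_iff_null_sets by blast
    have Veq: "V = (V - N) \<union> N" using V(2) by blast
    have Vm: "V \<in> lmeasurable"
      using V(3) NM Veq fmeasurable.Un[of "V - N" lebesgue N] negligible_imp_measurable[OF N] by simp
    have "emeasure lebesgue V = emeasure lebesgue (V - N)"
      using emeasure_Un_null_set[of "V - N" lebesgue N] NM V(3) Veq by auto
    then have "ennreal (measure lebesgue V) < ennreal \<delta>"
      using V(4) Vm by (simp add: emeasure_eq_measure2)
    then have Vlt: "measure lebesgue V < \<delta>" by (simp add: ennreal_less_iff)
    \<comment> \<open>The summand 1 in the denominator keeps it positive when
      \<open>\<alpha> = \<beta>\<close>.\<close>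
    define \<epsilon> where "\<epsilon> = e / (3 * (\<beta> - \<alpha> + 1))"
    have "\<epsilon> > 0" using \<open>e > 0\<close> \<open>\<alpha> \<le> \<beta>\<close> by (simp add: \<epsilon>_def)
    \<comment> \<open>The gauge: at tags in \<open>N\<close> it forces the interval into the small
      open set \<open>V\<close>, at the other tags it makes \<open>h\<close> nearly linear with
      slope \<open>h' x\<close>.\<close>
    have "\<exists>d>0. (x \<in> N \<longrightarrow> ball x d \<subseteq> V) \<and> (x \<in> {\<alpha>..\<beta>} - N \<longrightarrow>
        (\<forall>y\<in>{\<alpha>..\<beta>}. \<bar>y - x\<bar> < d \<longrightarrow> \<bar>h y - h x - (y - x) * h' x\<bar> \<le> \<epsilon> * \<bar>y - x\<bar>))" for x
    proof (cases "x \<in> N")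
      case True
      then obtain d where "d > 0" "ball x d \<subseteq> V" using V(1,2) open_contains_ball by blast
      then show ?thesis using True by blast
    next
      case False
      show ?thesis
      proof (cases "x \<in> {\<alpha>..\<beta>}")
        case True
        then have "(h has_derivative (\<lambda>y. y * h' x)) (at x within {\<alpha>..\<beta>})"
          using der[of x] False by (simp add: has_field_derivative_def mult_commute_abs)
        then show ?thesis
          using False \<open>\<epsilon> > 0\<close> unfolding has_derivative_within_alt by auto
      next
        case False
        then show ?thesis using \<open>x \<notin> N\<close> by (intro exI[of _ 1]) auto
      qed
    qed
    then obtain d where d: "\<And>x. d x > 0" "\<And>x. x \<in> N \<Longrightarrow> ball x (d x) \<subseteq> V"
      "\<And>x y. x \<in> {\<alpha>..\<beta>} - N \<Longrightarrow> y \<in> {\<alpha>..\<beta>} \<Longrightarrow> \<bar>y - x\<bar> < d x \<Longrightarrow>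
        \<bar>h y - h x - (y - x) * h' x\<bar> \<le> \<epsilon> * \<bar>y - x\<bar>"
      by metis
    show "\<exists>\<gamma>. gauge \<gamma> \<and> (\<forall>p. p tagged_division_of {\<alpha>..\<beta>} \<and> \<gamma> fine p \<longrightarrow>
        norm ((\<Sum>(x, k)\<in>p. measure lborel k *\<^sub>R g x) - (h \<beta> - h \<alpha>)) < e)"
    proof (intro exI[of _ "\<lambda>x. ball x (d x)"] conjI allI impI)
      show "gauge (\<lambda>x. ball x (d x))" using d(1) gauge_ball_dependent by blast
    next
      fix p assume "p tagged_division_of {\<alpha>..\<beta>} \<and> (\<lambda>x. ball x (d x)) fine p"
      then have p: "p tagged_division_of {\<alpha>..\<beta>}" and fine: "(\<lambda>x. ball x (d x)) fine p" by auto
      have "finite p" using p by auto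
      have el: "x \<in> {\<alpha>..\<beta>} \<and> \<alpha> \<le> Inf k \<and> Inf k \<le> x \<and> x \<le> Sup k \<and> Sup k \<le> \<beta> \<and> k = {Inf k..Sup k} \<and>
          measure lborel k = Sup k - Inf k \<and> k \<subseteq> ball x (d x)"
        if xk: "(x, k) \<in> p" for x k
      proof -
        obtain u v where k: "k = cbox u v" using tagged_division_ofD(4)[OF p xk] by blast
        have "x \<in> k" "k \<subseteq> {\<alpha>..\<beta>}" using tagged_division_ofD(2,3)[OF p xk] by auto
        moreover have "k \<subseteq> ball x (d x)" using fineD[OF fine xk] .
        moreover have "u \<le> v" using k \<open>x \<in> k\<close> by auto
        ultimately show ?thesis using k by auto
      qed
      define I where "I = (\<lambda>(x::real, k). h (Sup k) - h (Inf k))"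
      define pN where "pN = {z \<in> p. fst z \<in> N}"
      have pN: "finite pN" "pN \<subseteq> p" using \<open>finite p\<close> by (auto simp: pN_def)
      have bad: "(\<Sum>z\<in>pN. dist (h (Sup (snd z))) (h (Inf (snd z)))) < e / 3"
      proof (rule \<delta>[OF pN(1)])
        show "\<alpha> \<le> Inf (snd z) \<and> Inf (snd z) \<le> Sup (snd z) \<and> Sup (snd z) \<le> \<beta>" if "z \<in> pN" for z
          using el[of "fst z" "snd z"] that pN(2) by fastforce
        have int: "interior (snd z) = {Inf (snd z)<..<Sup (snd z)}" if "z \<in> p" for z
          using el[of "fst z" "snd z"] that by (metis interior_atLeastAtMost_real prod.collapse)
        show disj: "disjoint_family_on (\<lambda>z. {Inf (snd z)<..<Sup (snd z)}) pN"
          unfolding disjoint_family_on_def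
        proof (intro ballI impI)
          fix w z assume wz: "w \<in> pN" "z \<in> pN" "w \<noteq> z"
          then have "interior (snd w) \<inter> interior (snd z) = {}"
            using tagged_division_ofD(5)[OF p, of "fst w" "snd w" "fst z" "snd z"] pN(2)
            by (auto simp: prod_eq_iff)
          moreover have "w \<in> p" "z \<in> p" using wz pN(2) by auto
          ultimately show "{Inf (snd w)<..<Sup (snd w)} \<inter> {Inf (snd z)<..<Sup (snd z)} = {}"
            by (metis int)
        qed
        have sub: "{Inf (snd z)<..<Sup (snd z)} \<subseteq> V" if "z \<in> pN" for z
        proof -
          have "fst z \<in> N" "(fst z, snd z) \<in> p" using that by (auto simp: pN_def)
          then have "snd z \<subseteq> V" using el d(2) by blast
          then show ?thesis using int[of z] that pN(2) interior_subset by blast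
        qed
        have "(\<Sum>z\<in>pN. Sup (snd z) - Inf (snd z)) = (\<Sum>z\<in>pN. measure lebesgue {Inf (snd z)<..<Sup (snd z)})"
        proof (rule sum.cong[OF refl])
          fix z assume "z \<in> pN"
          then have "Inf (snd z) \<le> Sup (snd z)" using el[of "fst z" "snd z"] pN(2) by fastforce
          then show "Sup (snd z) - Inf (snd z) = measure lebesgue {Inf (snd z)<..<Sup (snd z)}" by simp
        qed
        also have "\<dots> = measure lebesgue (\<Union>z\<in>pN. {Inf (snd z)<..<Sup (snd z)})"
        proof (rule measure_finite_Union[symmetric, OF pN(1) _ disj])
          show "emeasure lebesgue {Inf (snd z)<..<Sup (snd z)} \<noteq> \<infinity>" for z :: "real \<times> real set"
            by (cases "Inf (snd z) \<le> Sup (snd z)") auto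
        qed auto
        also have "\<dots> \<le> measure lebesgue V"
          using sub Vm pN(1) by (intro measure_mono_fmeasurable) auto
        finally show "(\<Sum>z\<in>pN. Sup (snd z) - Inf (snd z)) < \<delta>" using Vlt by simp
      qed
      \<comment> \<open>Straddle estimate: the tag lies between the endpoints, so the errors of the
        two linear approximations add up to \<open>\<epsilon>\<close> times the length of the
        interval.\<close>
      have good: "\<bar>measure lborel k * g x - I (x, k)\<bar> \<le> \<epsilon> * (Sup k - Inf k)"
        if xk: "(x, k) \<in> p - pN" for x k
      proof -
        have *: "(x, k) \<in> p" "x \<notin> N" using xk by (auto simp: pN_def)
        note E = el[OF *(1)]
        have E': "Inf k \<le> x" "x \<le> Sup k" "measure lborel k = Sup k - Inf k"
            "x \<in> {\<alpha>..\<beta>}" "Inf k \<in> {\<alpha>..\<beta>}" "Sup k \<in> {\<alpha>..\<beta>}"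
          using E unfolding atLeastAtMost_iff by linarith+
        have "Inf k \<in> k" "Sup k \<in> k" using E by (metis atLeastAtMost_iff order_refl order_trans)+
        then have "Inf k \<in> ball x (d x)" "Sup k \<in> ball x (d x)" using E by blast+
        then have "\<bar>Inf k - x\<bar> < d x" "\<bar>Sup k - x\<bar> < d x"
          by (auto simp: dist_real_def abs_minus_commute)
        then have "\<bar>h (Inf k) - h x - (Inf k - x) * h' x\<bar> \<le> \<epsilon> * \<bar>Inf k - x\<bar>"
          "\<bar>h (Sup k) - h x - (Sup k - x) * h' x\<bar> \<le> \<epsilon> * \<bar>Sup k - x\<bar>"
          using d(3)[of x "Inf k"] d(3)[of x "Sup k"] E' *(2) by auto
        moreover have "\<epsilon> * \<bar>Inf k - x\<bar> + \<epsilon> * \<bar>Sup k - x\<bar> = \<epsilon> * (Sup k - Inf k)"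
          using E'(1,2) by (simp add: algebra_simps)
        moreover have "measure lborel k * g x - I (x, k) =
            (h (Inf k) - h x - (Inf k - x) * h' x) - (h (Sup k) - h x - (Sup k - x) * h' x)"
          using *(2) unfolding I_def g_def case_prod_conv E'(3) by (simp add: algebra_simps)
        ultimately show ?thesis by linarith
      qed
      have tel: "(\<Sum>z\<in>p. I z) = h \<beta> - h \<alpha>"
        unfolding I_def by (rule additive_tagged_division_1[OF \<open>\<alpha> \<le> \<beta>\<close> p])
      have len: "(\<Sum>(x, k)\<in>p. Sup k - Inf k) = \<beta> - \<alpha>"
        using additive_tagged_division_1[OF \<open>\<alpha> \<le> \<beta>\<close> p, of "\<lambda>x. x"] .
      have "(\<Sum>(x, k)\<in>p. measure lborel k *\<^sub>R g x) - (h \<beta> - h \<alpha>) =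
          (\<Sum>z\<in>p. (case z of (x, k) \<Rightarrow> measure lborel k * g x) - I z)"
        unfolding tel[symmetric] by (simp add: sum_subtractf)
      also have "\<dots> = (\<Sum>z\<in>p - pN. (case z of (x, k) \<Rightarrow> measure lborel k * g x) - I z) +
          (\<Sum>z\<in>pN. (case z of (x, k) \<Rightarrow> measure lborel k * g x) - I z)"
        by (rule sum.subset_diff[OF pN(2) \<open>finite p\<close>])
      finally have split: "(\<Sum>(x, k)\<in>p. measure lborel k *\<^sub>R g x) - (h \<beta> - h \<alpha>) = \<dots>" .
      have "\<bar>\<Sum>z\<in>p - pN. (case z of (x, k) \<Rightarrow> measure lborel k * g x) - I z\<bar> \<le>
          (\<Sum>z\<in>p - pN. \<epsilon> * (case z of (x, k) \<Rightarrow> Sup k - Inf k))"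
        using good by (intro order_trans[OF sum_abs] sum_mono) auto
      also have "\<dots> \<le> (\<Sum>z\<in>p. \<epsilon> * (case z of (x, k) \<Rightarrow> Sup k - Inf k))"
      proof (intro sum_mono2 \<open>finite p\<close>)
        fix z assume "z \<in> p - (p - pN)"
        then have "Inf (snd z) \<le> Sup (snd z)" using el[of "fst z" "snd z"] by fastforce
        then show "0 \<le> \<epsilon> * (case z of (x, k) \<Rightarrow> Sup k - Inf k)"
          using \<open>\<epsilon> > 0\<close> by (simp add: case_prod_beta)
      qed auto
      also have "\<dots> = \<epsilon> * (\<beta> - \<alpha>)" by (simp add: len flip: sum_distrib_left)
      also have "\<dots> \<le> e / 3"
        using \<open>e > 0\<close> \<open>\<alpha> \<le> \<beta>\<close> by (simp add: \<epsilon>_def field_simps)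
      finally have 1: "\<bar>\<Sum>z\<in>p - pN. (case z of (x, k) \<Rightarrow> measure lborel k * g x) - I z\<bar> \<le> e / 3" .
      have "\<bar>\<Sum>z\<in>pN. (case z of (x, k) \<Rightarrow> measure lborel k * g x) - I z\<bar> \<le>
          (\<Sum>z\<in>pN. dist (h (Sup (snd z))) (h (Inf (snd z))))"
        by (intro order_trans[OF sum_abs] sum_mono) (auto simp: pN_def g_def I_def dist_real_def)
      then have 2: "\<bar>\<Sum>z\<in>pN. (case z of (x, k) \<Rightarrow> measure lborel k * g x) - I z\<bar> < e / 3" using bad by simp
      show "norm ((\<Sum>(x, k)\<in>p. measure lborel k *\<^sub>R g x) - (h \<beta> - h \<alpha>)) < e"
        unfolding split using 1 2 \<open>e > 0\<close> by (simp only: real_norm_def)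
    qed
  qed
  moreover have "h' x = g x" if "x \<in> {\<alpha>..\<beta>} - N" for x
    using that by (simp add: g_def)
  ultimately show ?thesis
    using has_integral_spike[OF N, of "{\<alpha>..\<beta>}" h' g] by blast
qed

lemma borel_measurable_vec_lambda:
  fixes f :: "'n::finite \<Rightarrow> 'a \<Rightarrow> real"
  assumes "\<And>i. f i \<in> borel_measurable M"
  shows "(\<lambda>x. \<chi> i. f i x) \<in> borel_measurable M"
  by (subst borel_measurable_euclidean_space) (use assms in \<open>auto simp: Basis_vec_def inner_axis\<close>)

text \<open>Agreement on boxes determines the measure. This connects \<open>real^'n\<close> with the
  product measures in the definition of \<open>ACL_on\<close>.\<close>

lemma lborel_vec:
  "distr (Pi\<^sub>M UNIV (\<lambda>_. lborel)) borel vec_lambda = (lborel :: (real^'n) measure)"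
proof (rule lborel_eqI[symmetric])
  interpret product_sigma_finite "\<lambda>_::'n. lborel :: real measure" ..
  have [measurable]: "vec_lambda \<in> Pi\<^sub>M UNIV (\<lambda>_::'n. lborel) \<rightarrow>\<^sub>M (borel :: (real^'n) measure)"
    by (rule borel_measurable_vec_lambda[where f = "\<lambda>i x. x i", simplified]) simp
  fix l u :: "real^'n" assume le: "\<And>b. b \<in> Basis \<Longrightarrow> l \<bullet> b \<le> u \<bullet> b"
  have le': "l $ i \<le> u $ i" for i using le[of "axis i 1"] by (simp add: inner_axis axis_in_Basis_iff)
  have pre: "vec_lambda -` box l u \<inter> space (Pi\<^sub>M UNIV (\<lambda>_::'n. lborel :: real measure)) =
      (\<Pi>\<^sub>E i\<in>UNIV. {l $ i<..<u $ i})"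
    by (auto simp: space_PiM mem_box_cart PiE_iff)
  have "emeasure (distr (Pi\<^sub>M UNIV (\<lambda>_. lborel)) borel vec_lambda) (box l u) =
      (\<Prod>i\<in>UNIV. ennreal (u $ i - l $ i))"
    using le' by (simp add: emeasure_distr pre emeasure_PiM)
  also have "\<dots> = (\<Prod>b\<in>Basis. ennreal ((u - l) \<bullet> b))"
  proof -
    have B: "(Basis :: (real^'n) set) = (\<lambda>i. axis i 1) ` UNIV" by (auto simp: Basis_vec_def)
    have "inj (\<lambda>i::'n. axis i (1::real))" by (auto simp: inj_def axis_eq_axis)
    then show ?thesis unfolding B by (subst prod.reindex) (auto simp: inner_axis)
  qed
  also have "\<dots> = ennreal (\<Prod>b\<in>Basis. (u - l) \<bullet> b)"
    using le by (intro prod_ennreal) (simp add: inner_diff_left)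
  finally show "emeasure (distr (Pi\<^sub>M UNIV (\<lambda>_. lborel)) borel vec_lambda) (box l u) = (\<Prod>b\<in>Basis. (u - l) \<bullet> b)"
    by simp
qed simp

lemma nn_integral_slice:
  fixes h :: "real^'n \<Rightarrow> ennreal"
  assumes [measurable]: "h \<in> borel_measurable borel"
  shows "(\<integral>\<^sup>+ x. h x \<partial>lborel) =
    (\<integral>\<^sup>+ z. (\<integral>\<^sup>+ t. h (\<chi> j. if j = i then t else z j) \<partial>lborel) \<partial>Pi\<^sub>M (UNIV - {i}) (\<lambda>_. lborel))"
proof -
  interpret product_sigma_finite "\<lambda>_::'n. lborel :: real measure" ..
  have [measurable]: "vec_lambda \<in> Pi\<^sub>M UNIV (\<lambda>_::'n. lborel) \<rightarrow>\<^sub>M (borel :: (real^'n) measure)"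
    by (rule borel_measurable_vec_lambda[where f = "\<lambda>i x. x i", simplified]) simp
  have ins: "insert i (UNIV - {i}) = (UNIV :: 'n set)" by auto
  have "(\<integral>\<^sup>+ x. h x \<partial>lborel) = (\<integral>\<^sup>+ x. h (vec_lambda x) \<partial>Pi\<^sub>M (insert i (UNIV - {i})) (\<lambda>_. lborel))"
    unfolding lborel_vec[symmetric] ins by (subst nn_integral_distr) auto
  also have "\<dots> = (\<integral>\<^sup>+ z. (\<integral>\<^sup>+ t. h (vec_lambda (z(i := t))) \<partial>lborel) \<partial>Pi\<^sub>M (UNIV - {i}) (\<lambda>_. lborel))"
    by (rule product_nn_integral_insert) (auto simp: ins)
  finally show ?thesis by (simp add: fun_upd_def)
qed

lemma AE_slice:
  fixes P :: "real^'n \<Rightarrow> bool"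
  assumes "AE x in lborel. P x"
  shows "AE z in Pi\<^sub>M (UNIV - {i}) (\<lambda>_. lborel). AE t in lborel. P (\<chi> j. if j = i then t else z j)"
proof -
  interpret product_sigma_finite "\<lambda>_::'n. lborel :: real measure" ..
  obtain N where N: "N \<in> null_sets lborel" "\<And>x. x \<notin> N \<Longrightarrow> P x"
    using AE_E3[OF assms] by (metis DiffI UNIV_I space_borel space_lborel)
  then have [measurable]: "N \<in> sets borel" by (auto simp: null_sets_def)
  have [measurable]: "(\<lambda>(z, t). \<chi> j. if j = i then t else z j) \<in>
      Pi\<^sub>M (UNIV - {i}) (\<lambda>_. lborel) \<Otimes>\<^sub>M lborel \<rightarrow>\<^sub>M (borel :: (real^'n) measure)"
    unfolding case_prod_beta
  proof (intro borel_measurable_vec_lambda)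
    fix j
    show "(\<lambda>x. if j = i then snd x else fst x j) \<in>
        borel_measurable (Pi\<^sub>M (UNIV - {i}) (\<lambda>_. lborel) \<Otimes>\<^sub>M lborel)"
      by (cases "j = i") (auto intro!: measurable_compose[OF measurable_fst measurable_component_singleton])
  qed
  have "(\<integral>\<^sup>+ z. (\<integral>\<^sup>+ t. indicator N (\<chi> j. if j = i then t else z j) \<partial>lborel) \<partial>Pi\<^sub>M (UNIV - {i}) (\<lambda>_. lborel)) = 0"
    using N(1) by (subst nn_integral_slice[symmetric]) (auto simp: null_sets_def)
  then have "AE z in Pi\<^sub>M (UNIV - {i}) (\<lambda>_. lborel).
      (\<integral>\<^sup>+ t. indicator N (\<chi> j. if j = i then t else z j) \<partial>lborel) = 0"
    by (subst (asm) nn_integral_0_iff_AE) auto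
  moreover have "AE z in Pi\<^sub>M (UNIV - {i}) (\<lambda>_::'n. lborel :: real measure).
      z \<in> space (Pi\<^sub>M (UNIV - {i}) (\<lambda>_. lborel))" by (rule AE_space)
  ultimately show ?thesis
  proof eventually_elim
    case (elim z)
    have "AE t in lborel. indicator N (\<chi> j. if j = i then t else z j) = (0::ennreal)"
      using elim by (subst (asm) nn_integral_0_iff_AE) auto
    then show ?case
      by eventually_elim (use N(2) in \<open>auto simp: indicator_def split: if_splits\<close>)
  qed
qed

text \<open>The cylinder over a null set of the hyperplane is null, its indicator being constant in
  direction \<open>i\<close>. The restriction is there because elements of the product space are
  undefined at the removed index.\<close>

lemma AE_unslice:
  fixes P :: "('n::finite \<Rightarrow> real) \<Rightarrow> bool"
  assumes "AE z in Pi\<^sub>M (UNIV - {i}) (\<lambda>_. lborel). P z"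
  shows "AE x in (lborel :: (real^'n) measure). P (restrict (\<lambda>j. x $ j) (UNIV - {i}))"
proof -
  let ?M = "Pi\<^sub>M (UNIV - {i}) (\<lambda>_::'n. lborel :: real measure)"
  obtain N where N: "N \<in> null_sets ?M" "\<And>z. z \<in> space ?M \<Longrightarrow> z \<notin> N \<Longrightarrow> P z"
    using AE_E3[OF assms] by (metis DiffI)
  then have [measurable]: "N \<in> sets ?M" by (auto simp: null_sets_def)
  have [measurable]: "(\<lambda>x::real^'n. restrict (\<lambda>j. x $ j) (UNIV - {i})) \<in> borel \<rightarrow>\<^sub>M ?M"
    by (intro measurable_restrict) auto
  have "(\<integral>\<^sup>+ x. indicator N (restrict (\<lambda>j. x $ j) (UNIV - {i})) \<partial>(lborel :: (real^'n) measure)) =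
      (\<integral>\<^sup>+ z. (\<integral>\<^sup>+ t. indicator N z \<partial>(lborel :: real measure)) \<partial>?M)"
  proof (subst nn_integral_slice[of _ i], measurable, rule nn_integral_cong, rule nn_integral_cong)
    fix z t assume "z \<in> space ?M"
    then have "restrict (\<lambda>j. (\<chi> j. if j = i then t else z j) $ j) (UNIV - {i}) = z"
      by (auto simp: space_PiM PiE_def extensional_def fun_eq_iff)
    then show "indicator N (restrict (\<lambda>j. (\<chi> j. if j = i then t else z j) $ j) (UNIV - {i})) = indicator N z"
      by simp
  qed
  also have "\<dots> = 0"
    using N(1) by (subst nn_integral_0_iff_AE) (auto intro!: AE_I'[OF N(1)] simp: indicator_def)
  finally have "AE x in (lborel :: (real^'n) measure). indicator N (restrict (\<lambda>j. x $ j) (UNIV - {i})) = (0::ennreal)"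
    by (subst (asm) nn_integral_0_iff_AE) auto
  then show ?thesis
  proof eventually_elim
    case (elim x)
    have "restrict (\<lambda>j. x $ j) (UNIV - {i}) \<in> space ?M" by (auto simp: space_PiM)
    then show ?case using N(2) elim by (auto simp: indicator_def split: if_splits)
  qed
qed

text \<open>The Lipschitz map \<open>\<phi>\<close> preserves absolute continuity, so the
  fundamental theorem holds on almost every line. Whether a starting point is exceptional depends
  only on its line, which is why one null set serves all \<open>s\<close>.\<close>

lemma ACL_line_fundamental_theorem:
  fixes F :: "real^'n \<Rightarrow> real^'n" and \<phi> :: "real^'n \<Rightarrow> real"
  assumes acl: "ACL_on F G" and G: "cbox l u \<subseteq> G"
    and lip: "L-lipschitz_on (F ` cbox l u) \<phi>"
    and der: "AE x in lborel. x \<in> cbox l u \<longrightarrow>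
      ((\<lambda>s. \<phi> (F (x + s *\<^sub>R axis i 1))) has_real_derivative D x) (at 0)"
  shows "AE x in lborel. \<forall>s\<ge>0. x \<in> cbox l u \<longrightarrow> x + s *\<^sub>R axis i 1 \<in> cbox l u \<longrightarrow>
    ((\<lambda>t. D (x + t *\<^sub>R axis i 1)) has_integral (\<phi> (F (x + s *\<^sub>R axis i 1)) - \<phi> (F x))) {0..s}"
proof -
  let ?M = "Pi\<^sub>M (UNIV - {i}) (\<lambda>_::'n. lborel :: real measure)"
  define ln where "ln z t = (\<chi> j. if j = i then t else z j)" for z :: "'n \<Rightarrow> real" and t
  have "AE z in ?M. (\<forall>j\<in>UNIV - {i}. l $ j \<le> z j \<and> z j \<le> u $ j) \<longrightarrow>
           abs_cont_on_interval (l $ i) (u $ i) (\<lambda>t. F (ln z t))"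
    using acl G unfolding ACL_on_def ln_def by blast
  moreover have "AE z in ?M. AE t in lborel. ln z t \<in> cbox l u \<longrightarrow>
      ((\<lambda>s. \<phi> (F (ln z t + s *\<^sub>R axis i 1))) has_real_derivative D (ln z t)) (at 0)"
    using AE_slice[OF der] unfolding ln_def .
  ultimately have "AE z in ?M. ((\<forall>j\<in>UNIV - {i}. l $ j \<le> z j \<and> z j \<le> u $ j) \<longrightarrow>
           abs_cont_on_interval (l $ i) (u $ i) (\<lambda>t. F (ln z t))) \<and>
      (AE t in lborel. ln z t \<in> cbox l u \<longrightarrow>
      ((\<lambda>s. \<phi> (F (ln z t + s *\<^sub>R axis i 1))) has_real_derivative D (ln z t)) (at 0))"
    by eventually_elim blast
  from AE_unslice[OF this] show ?thesis
  proof eventually_elim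
    case (elim x)
    define z where "z = restrict (\<lambda>j. x $ j) (UNIV - {i})"
    note elim' = elim[folded z_def]
    \<comment> \<open>The line through \<open>x\<close> is parametrised by its \<open>i\<close>-th
      coordinate and passes through \<open>x\<close> at \<open>t = x $ i\<close>.\<close>
    have ln_z: "ln z t = x + (t - x $ i) *\<^sub>R axis i 1" for t
      by (auto simp: vec_eq_iff ln_def z_def axis_def)
    show ?case
    proof (intro allI impI)
      fix s :: real assume s: "0 \<le> s" and x: "x \<in> cbox l u" "x + s *\<^sub>R axis i 1 \<in> cbox l u"
      have bd: "l $ j \<le> x $ j" "x $ j \<le> u $ j" for j using x(1) by (auto simp: mem_box_cart)
      have bs: "x $ i + s \<le> u $ i" using x(2) by (auto simp: mem_box_cart dest!: spec[of _ i])
      have in_box: "ln z t \<in> cbox l u" if "l $ i \<le> t" "t \<le> u $ i" for t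
        using that bd by (auto simp: mem_box_cart ln_def z_def)
      have "abs_cont_on_interval (l $ i) (u $ i) (\<lambda>t. F (ln z t))"
        using elim'[THEN conjunct1] bd by (auto simp: z_def)
      moreover have "L-lipschitz_on ((\<lambda>t. F (ln z t)) ` {l $ i..u $ i}) \<phi>"
        using in_box by (intro lipschitz_on_subset[OF lip]) auto
      ultimately have "abs_cont_on_interval (l $ i) (u $ i) (\<lambda>t. \<phi> (F (ln z t)))"
        by (rule abs_cont_on_interval_compose_Lipschitz)
      then have ac: "abs_cont_on_interval (x $ i) (x $ i + s) (\<lambda>t. \<phi> (F (ln z t)))"
        using bd[of i] bs abs_cont_on_interval_subset by blast
      have "\<exists>N. N \<in> null_sets lborel \<and> (\<forall>t. t \<notin> N \<longrightarrow> ln z t \<in> cbox l u \<longrightarrow>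
          ((\<lambda>s. \<phi> (F (ln z t + s *\<^sub>R axis i 1))) has_real_derivative D (ln z t)) (at 0))"
        using AE_E3[OF elim'[THEN conjunct2]] by (metis DiffI UNIV_I space_borel space_lborel)
      then obtain N where N: "N \<in> null_sets lborel" and dN: "\<And>t. t \<notin> N \<Longrightarrow> ln z t \<in> cbox l u \<Longrightarrow>
          ((\<lambda>s. \<phi> (F (ln z t + s *\<^sub>R axis i 1))) has_real_derivative D (ln z t)) (at 0)"
        by blast
      have neg: "negligible N"
        using N null_sets_completionI negligible_iff_null_sets by blast
      have "((\<lambda>t. D (ln z t)) has_integral (\<phi> (F (ln z (x $ i + s))) - \<phi> (F (ln z (x $ i))))) {x $ i..x $ i + s}"
      proof (rule abs_cont_fundamental_theorem_of_calculus[OF _ ac neg])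
        fix t assume t: "t \<in> {x $ i..x $ i + s} - N"
        then have "ln z t \<in> cbox l u"
          using bd[of i] bs by (intro in_box) auto
        then have "((\<lambda>s. \<phi> (F (ln z t + s *\<^sub>R axis i 1))) has_real_derivative D (ln z t)) (at 0)"
          using dN t by blast
        then have "((\<lambda>r. \<phi> (F (ln z t + (r - t) *\<^sub>R axis i 1))) has_real_derivative D (ln z t)) (at t)"
          using DERIV_shift[of "\<lambda>r. \<phi> (F (ln z t + (r - t) *\<^sub>R axis i 1))" "D (ln z t)" 0 t]
          by simp
        moreover have "ln z t + (r - t) *\<^sub>R axis i 1 = ln z r" for r
          by (simp add: ln_z algebra_simps)
        ultimately show "((\<lambda>t. \<phi> (F (ln z t))) has_real_derivative D (ln z t)) (at t within {x $ i..x $ i + s})"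
          by (simp add: has_field_derivative_at_within)
      qed (use s in auto)
      \<comment> \<open>The parameter is shifted by \<open>x $ i\<close>, so that the interval
        starts at 0.\<close>
      from has_integral_affinity'[OF this[folded cbox_interval], of 1 "x $ i"]
      show "((\<lambda>t. D (x + t *\<^sub>R axis i 1)) has_integral
          (\<phi> (F (x + s *\<^sub>R axis i 1)) - \<phi> (F x))) {0..s}"
        by (simp add: ln_z cbox_interval)
    qed
  qed
qed

section \<open>Change of variables over arbitrary finite index types\<close>

text \<open>The library states the change of variables formula for well-ordered index types only; it is
  transported to \<open>'n\<close> through this well-ordered copy.\<close>

typedef ('n::finite) index = "{k::nat. k < CARD('n)}"
  by (rule exI[of _ 0]) simp

instance index :: (finite) finite
proof
  have "(UNIV :: 'a index set) = Abs_index ` {k. k < CARD('a)}"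
    by (rule type_definition.Abs_image[OF type_definition_index, symmetric])
  then show "finite (UNIV :: 'a index set)"
    by (metis finite_Collect_less_nat finite_imageI)
qed

instantiation index :: (finite) wellorder
begin

definition "less_eq_index (a :: 'a index) (b :: 'a index) \<longleftrightarrow> Rep_index a \<le> Rep_index b"
definition "less_index (a :: 'a index) (b :: 'a index) \<longleftrightarrow> Rep_index a < Rep_index b"

instance
proof
  fix P :: "'a index \<Rightarrow> bool" and a :: "'a index"
  assume step: "\<And>x. (\<And>y. y < x \<Longrightarrow> P y) \<Longrightarrow> P x"
  show "P a"
    by (rule measure_induct_rule[where f = Rep_index]) (rule step, simp add: less_index_def)
qed (auto simp: less_eq_index_def less_index_def Rep_index_inject)

end

lemma card_index: "CARD('n::finite index) = CARD('n)"
  by (simp add: type_definition.card[OF type_definition_index])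

lemma permutes_UNIV_iff_bij: "p permutes UNIV \<longleftrightarrow> bij p"
  by (metis UNIV_I bij_imp_permutes permutes_bij)

text \<open>Induction over products of transpositions: conjugation by \<open>\<pi>\<close> turns the
  transposition of \<open>a\<close> and \<open>b\<close> into that of \<open>\<pi> a\<close> and
  \<open>\<pi> b\<close>.\<close>

lemma sign_conjugate:
  fixes \<pi> :: "'a::finite \<Rightarrow> 'b::finite"
  assumes "bij \<pi>" "p permutes UNIV"
  shows "sign (\<pi> \<circ> p \<circ> inv \<pi>) = sign p"
  using assms(2) finite[of "UNIV :: 'a set"]
proof (induction p rule: permutes_induct)
  case id
  have "\<pi> \<circ> id \<circ> inv \<pi> = id"
    using assms(1) by (simp add: fun_eq_iff bij_is_surj surj_f_inv_f)
  then show ?case by (simp only: sign_id)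
next
  case (swap a b p)
  have inj: "inj \<pi>" and surj: "surj \<pi>" using assms(1) by (auto simp: bij_def)
  have conj: "\<pi> \<circ> (Transposition.transpose a b \<circ> p) \<circ> inv \<pi> = Transposition.transpose (\<pi> a) (\<pi> b) \<circ> (\<pi> \<circ> p \<circ> inv \<pi>)"
    using inj by (auto simp: fun_eq_iff Transposition.transpose_def inj_eq)
  have perm: "permutation p" "permutation (\<pi> \<circ> p \<circ> inv \<pi>)"
    using swap.hyps(4) assms(1)
    by (auto intro!: permutation_permutes[THEN iffD2] exI[of _ UNIV] simp: permutes_UNIV_iff_bij bij_comp bij_imp_bij_inv)
  have "sign (\<pi> \<circ> (Transposition.transpose a b \<circ> p) \<circ> inv \<pi>) = sign (Transposition.transpose (\<pi> a) (\<pi> b)) * sign (\<pi> \<circ> p \<circ> inv \<pi>)"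
    unfolding conj using perm by (intro sign_compose permutation_swap_id)
  also have "\<dots> = sign (Transposition.transpose a b) * sign p"
    unfolding swap.IH using swap.hyps(3) inj by (simp add: sign_swap_id inj_eq)
  also have "\<dots> = sign (Transposition.transpose a b \<circ> p)"
    using perm by (intro sign_compose[symmetric] permutation_swap_id)
  finally show ?case .
qed

text \<open>Conjugation by \<open>\<pi>\<close> is a sign-preserving bijection between the two sets
  of permutations, and it matches the terms of the Leibniz formulas.\<close>

lemma det_reindex:
  fixes A :: "real^'n^'n" and \<pi> :: "'n \<Rightarrow> 'm::finite"
  assumes \<pi>: "bij \<pi>"
  shows "det (\<chi> k l. A $ inv \<pi> k $ inv \<pi> l) = det A"
proof -
  have inv: "inv \<pi> (\<pi> x) = x" "\<pi> (inv \<pi> y) = y" for x y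
    using \<pi> by (auto simp: bij_is_inj bij_is_surj surj_f_inv_f)
  have bb: "bij_betw (\<lambda>p. \<pi> \<circ> p \<circ> inv \<pi>) {p. p permutes UNIV} {q. q permutes UNIV}"
    by (rule bij_betw_byWitness[where f' = "\<lambda>q. inv \<pi> \<circ> q \<circ> \<pi>"])
      (use \<pi> in \<open>auto simp: fun_eq_iff inv permutes_UNIV_iff_bij bij_comp bij_imp_bij_inv\<close>)
  have "det (\<chi> k l. A $ inv \<pi> k $ inv \<pi> l) =
      (\<Sum>p\<in>{p. p permutes UNIV}. of_int (sign (\<pi> \<circ> p \<circ> inv \<pi>)) *
        (\<Prod>k\<in>UNIV. A $ inv \<pi> k $ inv \<pi> ((\<pi> \<circ> p \<circ> inv \<pi>) k)))"
    unfolding det_def by (subst sum.reindex_bij_betw[OF bb, symmetric]) simp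
  also have "\<dots> = det A"
    unfolding det_def
  proof (rule sum.cong[OF refl])
    fix p :: "'n \<Rightarrow> 'n" assume p: "p \<in> {p. p permutes UNIV}"
    have "(\<Prod>k\<in>UNIV. A $ inv \<pi> k $ inv \<pi> ((\<pi> \<circ> p \<circ> inv \<pi>) k)) = (\<Prod>i\<in>UNIV. A $ i $ p i)"
      using prod.reindex_bij_betw[of "inv \<pi>" UNIV UNIV "\<lambda>i. A $ i $ p i"] bij_imp_bij_inv[OF \<pi>]
      by (simp add: inv)
    then show "of_int (sign (\<pi> \<circ> p \<circ> inv \<pi>)) *
        (\<Prod>k\<in>UNIV. A $ inv \<pi> k $ inv \<pi> ((\<pi> \<circ> p \<circ> inv \<pi>) k)) = of_int (sign p) * (\<Prod>i\<in>UNIV. A $ i $ p i)"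
      using sign_conjugate[OF \<pi>] p by simp
  qed
  finally show ?thesis .
qed

text \<open>The exact formula over the image of \<open>S\<close>, followed by enlarging the image to
  the whole space. The function \<open>k\<close> is a representative of the transformed integrand,
  which as written is in general only Lebesgue measurable.\<close>

lemma change_of_variables_le_wellorder:
  fixes g :: "real^'m::{finite,wellorder} \<Rightarrow> real^'m::_" and h :: "real^'m::_ \<Rightarrow> real"
  assumes S: "S \<in> sets lebesgue"
    and der: "\<And>x. x \<in> S \<Longrightarrow> (g has_derivative g' x) (at x within S)"
    and inj: "inj_on g S" and h: "integrable lborel h" "\<And>y. h y \<ge> 0"
    and k: "AE x in lborel. k x = ennreal (indicator S x * (\<bar>det (matrix (g' x))\<bar> * h (g x)))"
  shows "(\<integral>\<^sup>+ x. k x \<partial>lborel) \<le> (\<integral>\<^sup>+ y. ennreal (h y) \<partial>lborel)"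
proof -
  define F where "F = (\<lambda>x. \<bar>det (matrix (g' x))\<bar> * h (g x))"
  have gS: "g ` S \<in> sets lebesgue"
    using der by (intro differentiable_image_in_sets_lebesgue[OF S]) (auto simp: differentiable_on_def differentiable_def)
  have hU: "h absolutely_integrable_on UNIV"
    using h(1) by (simp add: set_integrable_def integrable_completion)
  then have hS: "h absolutely_integrable_on (g ` S)"
    by (rule set_integrable_subset) (use gS in auto)
  \<comment> \<open>The formula is for vector-valued integrands, so the scalar \<open>h\<close> is
    passed as a map into \<open>real^1\<close>.\<close>
  then have "(\<lambda>y. vec (h y) :: real^1) absolutely_integrable_on (g ` S)"
    by (simp add: absolutely_integrable_on_1_iff)
  then have "(\<lambda>x. \<bar>det (matrix (g' x))\<bar> *\<^sub>R (vec (h (g x)) :: real^1)) absolutely_integrable_on S \<and>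
      integral S (\<lambda>x. \<bar>det (matrix (g' x))\<bar> *\<^sub>R (vec (h (g x)) :: real^1)) = integral (g ` S) (\<lambda>y. vec (h y))"
    using has_absolute_integral_change_of_variables[OF S der inj,
        of "\<lambda>y. vec (h y) :: real^1" "integral (g ` S) (\<lambda>y. vec (h y))"] by blast
  then have F: "F absolutely_integrable_on S" and eq: "integral S F = integral (g ` S) h"
    unfolding F_def by (auto simp: absolutely_integrable_on_1_iff integral_on_1_eq vec_eq_iff)
  have "(\<integral>\<^sup>+ x. k x \<partial>lborel) = (\<integral>\<^sup>+ x. ennreal (indicator S x * F x) \<partial>lborel)"
    using k by (intro nn_integral_cong_AE) (simp add: F_def)
  also have "\<dots> = (\<integral>\<^sup>+ x. ennreal (indicator S x * F x) \<partial>lebesgue)"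
    by (simp add: nn_integral_completion)
  also have "\<dots> = ennreal (\<integral>x. indicator S x * F x \<partial>lebesgue)"
    using F h(2) by (intro nn_integral_eq_integral) (auto simp: set_integrable_def F_def)
  also have "(\<integral>x. indicator S x * F x \<partial>lebesgue) = integral S F"
    using set_lebesgue_integral_eq_integral(2)[OF F] by (simp add: set_lebesgue_integral_def)
  also have "integral S F = integral (g ` S) h" by (rule eq)
  also have "ennreal (integral (g ` S) h) \<le> ennreal (integral UNIV h)"
    using hS hU h(2) by (intro ennreal_leI integral_subset_le) (auto dest: set_lebesgue_integral_eq_integral(1))
  also have "integral UNIV h = (\<integral>y. h y \<partial>lborel)"
    using h(1) by (simp add: integral_lborel)
  also have "ennreal (\<integral>y. h y \<partial>lborel) = (\<integral>\<^sup>+ y. ennreal (h y) \<partial>lborel)"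
    using h by (subst nn_integral_eq_integral) auto
  finally show ?thesis .
qed

lemma lborel_distr_reindex:
  fixes \<pi> :: "'n::finite \<Rightarrow> 'm::finite"
  assumes \<pi>: "bij \<pi>"
  shows "distr lborel borel (\<lambda>y::real^'m. \<chi> i. y $ \<pi> i) = (lborel :: (real^'n) measure)"
proof (rule lborel_eqI[symmetric])
  fix l u :: "real^'n" assume le: "\<And>b. b \<in> Basis \<Longrightarrow> l \<bullet> b \<le> u \<bullet> b"
  have inv: "inv \<pi> (\<pi> x) = x" "\<pi> (inv \<pi> y) = y" for x y
    using \<pi> by (auto simp: bij_is_inj bij_is_surj surj_f_inv_f)
  have le': "l $ i \<le> u $ i" for i using le[of "axis i 1"] by (simp add: inner_axis)
  have meas: "(\<lambda>y::real^'m. \<chi> i. y $ \<pi> i) \<in> borel_measurable borel"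
    by (intro borel_measurable_continuous_onI continuous_intros)
  have pre: "(\<lambda>y::real^'m. \<chi> i. y $ \<pi> i) -` box l u = box (\<chi> k. l $ inv \<pi> k) (\<chi> k. u $ inv \<pi> k)"
  proof -
    have "(\<forall>i. l $ i < y $ \<pi> i \<and> y $ \<pi> i < u $ i) \<longleftrightarrow>
        (\<forall>k. l $ inv \<pi> k < y $ k \<and> y $ k < u $ inv \<pi> k)" for y :: "real^'m"
      by (metis inv)
    then show ?thesis by (auto simp: mem_box_cart)
  qed
  have B: "(Basis :: (real^'a::finite) set) = (\<lambda>i. axis i 1) ` UNIV" by (auto simp: Basis_vec_def)
  have injax: "inj (\<lambda>i::'a::finite. axis i (1::real))" by (auto simp: inj_def axis_eq_axis)
  have "emeasure (distr lborel borel (\<lambda>y::real^'m. \<chi> i. y $ \<pi> i)) (box l u) =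
      ennreal (\<Prod>b\<in>Basis. ((\<chi> k. u $ inv \<pi> k) - (\<chi> k. l $ inv \<pi> k) :: real^'m) \<bullet> b)"
    using le' meas by (subst emeasure_distr)
      (auto simp: pre emeasure_lborel_box_eq inner_diff_left Basis_vec_def inner_axis)
  also have "(\<Prod>b\<in>Basis. ((\<chi> k. u $ inv \<pi> k) - (\<chi> k. l $ inv \<pi> k) :: real^'m) \<bullet> b) =
      (\<Prod>k\<in>UNIV. u $ inv \<pi> k - l $ inv \<pi> k)"
    unfolding B by (subst prod.reindex[OF injax]) (simp add: inner_axis)
  also have "\<dots> = (\<Prod>i\<in>UNIV. u $ i - l $ i)"
    using prod.reindex_bij_betw[of "inv \<pi>" UNIV UNIV "\<lambda>i. u $ i - l $ i"] bij_imp_bij_inv[OF \<pi>] by simp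
  also have "\<dots> = (\<Prod>b\<in>Basis. (u - l) \<bullet> b)"
    unfolding B by (subst prod.reindex[OF injax]) (simp add: inner_axis)
  finally show "emeasure (distr lborel borel (\<lambda>y::real^'m. \<chi> i. y $ \<pi> i)) (box l u) = (\<Prod>b\<in>Basis. (u - l) \<bullet> b)" .
qed simp

text \<open>Conjugation of \<open>g\<close> with the relabelling \<open>T\<close> of coordinates
  reduces this to the well-ordered case: \<open>T\<close> preserves Lebesgue measure, and by
  \<open>det_reindex\<close> the Jacobian determinant.\<close>

theorem change_of_variables_le:
  fixes g :: "real^'n \<Rightarrow> real^'n" and h :: "real^'n \<Rightarrow> real"
  assumes S: "S \<in> sets lebesgue"
    and der: "\<And>x. x \<in> S \<Longrightarrow> (g has_derivative g' x) (at x within S)"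
    and inj: "inj_on g S" and h: "integrable lborel h" "\<And>y. h y \<ge> 0"
    and k: "k \<in> borel_measurable borel"
      "AE x in lborel. k x = ennreal (indicator S x * (\<bar>det (matrix (g' x))\<bar> * h (g x)))"
  shows "(\<integral>\<^sup>+ x. k x \<partial>lborel) \<le> (\<integral>\<^sup>+ y. ennreal (h y) \<partial>lborel)"
proof -
  obtain \<pi> :: "'n \<Rightarrow> 'n index" where \<pi>: "bij \<pi>"
    using finite_same_card_bij[of "UNIV :: 'n set" "UNIV :: 'n index set"] by (auto simp: card_index)
  have inv[simp]: "inv \<pi> (\<pi> x) = x" "\<pi> (inv \<pi> y) = y" for x y
    using \<pi> by (auto simp: bij_is_inj bij_is_surj surj_f_inv_f)
  define T :: "real^'n \<Rightarrow> real^'n index" where "T x = (\<chi> k. x $ inv \<pi> k)" for x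
  define T' :: "real^'n index \<Rightarrow> real^'n" where "T' y = (\<chi> i. y $ \<pi> i)" for y
  have TT'[simp]: "T (T' y) = y" "T' (T x) = x" for x y by (auto simp: T_def T'_def vec_eq_iff)
  have lin: "bounded_linear T" "bounded_linear T'"
    unfolding T_def T'_def
    by (auto intro!: linear_conv_bounded_linear[THEN iffD1] linearI simp: vec_eq_iff)
  have bT: "bij T" by (rule bij_betw_byWitness[where f' = T']) auto
  have dT': "distr lborel borel T' = (lborel :: (real^'n) measure)"
    unfolding T'_def[abs_def] by (rule lborel_distr_reindex[OF \<pi>])
  have [measurable]: "T' \<in> borel_measurable borel" "k \<in> borel_measurable borel" "h \<in> borel_measurable borel"
    using borel_measurable_continuous_onI linear_continuous_on[OF lin(2)] k(1) h(1) by auto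
  have matT: "matrix (T \<circ> L \<circ> T') = (\<chi> k l. matrix L $ inv \<pi> k $ inv \<pi> l)" for L
  proof -
    have eq: "T' (axis l 1) = axis (inv \<pi> l) 1" for l
      unfolding T'_def axis_def vec_eq_iff by (auto simp: inv)
    show ?thesis unfolding matrix_def comp_def eq by (simp add: vec_eq_iff T_def)
  qed
  have "(\<integral>\<^sup>+ x. k x \<partial>lborel) = (\<integral>\<^sup>+ y. k (T' y) \<partial>lborel)"
    unfolding dT'[symmetric] by (subst nn_integral_distr) auto
  also have "\<dots> \<le> (\<integral>\<^sup>+ y. ennreal (h (T' y)) \<partial>lborel)"
  proof (rule change_of_variables_le_wellorder[where S = "T ` S" and g = "T \<circ> g \<circ> T'" and
        g' = "\<lambda>y. T \<circ> g' (T' y) \<circ> T'"])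
    show "T ` S \<in> sets lebesgue"
      using lin(1) by (intro differentiable_image_in_sets_lebesgue[OF S])
        (auto simp: card_index bounded_linear_imp_differentiable_on)
    show "((T \<circ> g \<circ> T') has_derivative (T \<circ> g' (T' y) \<circ> T')) (at y within T ` S)" if y: "y \<in> T ` S" for y
    proof -
      have im: "T' ` (T ` S) = S" by (auto simp: image_image)
      have "T' y \<in> S" using y by auto
      then have "(g has_derivative g' (T' y)) (at (T' y) within T' ` (T ` S))"
        using der im by simp
      then have "((g \<circ> T') has_derivative (g' (T' y) \<circ> T')) (at y within T ` S)"
        by (rule diff_chain_within[OF bounded_linear_imp_has_derivative[OF lin(2)]])
      then have "((T \<circ> (g \<circ> T')) has_derivative (T \<circ> (g' (T' y) \<circ> T'))) (at y within T ` S)"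
        by (rule diff_chain_within) (rule bounded_linear_imp_has_derivative[OF lin(1)])
      then show ?thesis by (simp add: o_assoc)
    qed
    show "inj_on (T \<circ> g \<circ> T') (T ` S)"
      using inj bij_is_inj[OF bT] by (auto simp: inj_on_def)
    show "integrable lborel (\<lambda>y. h (T' y))"
      using h(1) unfolding dT'[symmetric] by (subst (asm) integrable_distr_eq) auto
    have "AE x in distr lborel borel T'. k x = ennreal (indicator S x * (\<bar>det (matrix (g' x))\<bar> * h (g x)))"
      unfolding dT' by (rule k(2))
    from AE_distrD[OF _ this]
    have "AE y in lborel. k (T' y) = ennreal (indicator S (T' y) * (\<bar>det (matrix (g' (T' y)))\<bar> * h (g (T' y))))"
      by simp
    moreover have "indicator S (T' y) = (indicator (T ` S) y :: real)" for y
      by (auto simp: indicator_def image_iff)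
    ultimately show "AE y in lborel. k (T' y) = ennreal (indicator (T ` S) y *
        (\<bar>det (matrix (T \<circ> g' (T' y) \<circ> T'))\<bar> * h (T' ((T \<circ> g \<circ> T') y))))"
      by (simp add: matT det_reindex[OF \<pi>])
  qed (use h(2) in auto)
  also have "\<dots> = (\<integral>\<^sup>+ y. ennreal (h y) \<partial>lborel)"
    unfolding dT'[symmetric] by (subst nn_integral_distr) auto
  finally show ?thesis .
qed

section \<open>The logarithmic gauge\<close>

text \<open>Adding 1 keeps the argument of the outer logarithm at least 1 as long as
  \<open>0 < norm (y - p) \<le> M\<close>.\<close>

definition log_gauge :: "real \<Rightarrow> real^'n \<Rightarrow> real^'n \<Rightarrow> real" where
  "log_gauge M p y = ln (1 + ln (M / norm (y - p)))"

text \<open>The norm of the gradient of \<open>log_gauge\<close>; the cut-off at radius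
  \<open>M\<close> makes its \<open>n\<close>-th power integrable over the whole space.\<close>

definition log_weight :: "real \<Rightarrow> real^'n \<Rightarrow> real^'n \<Rightarrow> real" where
  "log_weight M p y = (if 0 < norm (y - p) \<and> norm (y - p) \<le> M
     then 1 / (norm (y - p) * (1 + ln (M / norm (y - p)))) else 0)"

lemma log_weight_nonneg: "0 \<le> log_weight M p y"
  by (auto simp: log_weight_def intro!: divide_nonneg_nonneg mult_nonneg_nonneg add_nonneg_nonneg)

lemma borel_measurable_log_weight [measurable]: "log_weight M p \<in> borel_measurable borel"
  unfolding log_weight_def[abs_def] by measurable

text \<open>The witness is the integer part of \<open>ln (M / norm (y - p))\<close>, the index of
  the exponential annulus that contains \<open>y\<close>.\<close>

lemma log_weight_le_exp:
  assumes "M > 0" "0 < norm (y - p)" "norm (y - p) \<le> M"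
  shows "\<exists>k. norm (y - p) \<le> M * exp (- real k) \<and> log_weight M p y \<le> exp (real k + 1) / (M * (1 + real k))"
proof -
  define s where "s = norm (y - p)"
  have s: "0 < s" "s \<le> M" using assms by (auto simp: s_def)
  then have L: "0 \<le> ln (M / s)" by simp
  define k where "k = nat \<lfloor>ln (M / s)\<rfloor>"
  have k: "real k \<le> ln (M / s)" "ln (M / s) < real k + 1"
    using L by (auto simp: k_def)
  have "exp (real k) \<le> exp (ln (M / s))" using k by simp
  then have 1: "s \<le> M * exp (- real k)"
    using s assms(1) by (simp add: exp_minus field_simps)
  have "exp (ln (M / s)) < exp (real k + 1)" using k by (simp only: exp_less_cancel_iff)
  then have "1 / s \<le> exp (real k + 1) / M"
    using s assms(1) by (simp add: field_simps)
  moreover have "1 / (1 + ln (M / s)) \<le> 1 / (1 + real k)"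
    using k by (intro divide_left_mono mult_pos_pos) auto
  ultimately have "(1 / s) * (1 / (1 + ln (M / s))) \<le> exp (real k + 1) / M * (1 / (1 + real k))"
    using s L assms(1) by (intro mult_mono) auto
  then have 2: "log_weight M p y \<le> exp (real k + 1) / (M * (1 + real k))"
    using s by (simp add: log_weight_def s_def[symmetric])
  from 1 2 show ?thesis unfolding s_def by blast
qed

text \<open>The annuli with radii decaying like \<open>exp (- k)\<close> contribute terms comparable to
  \<open>1 / (k + 1) ^ n\<close>, which is where \<open>n \<ge> 2\<close> is needed.\<close>

lemma integrable_log_weight_power:
  fixes p :: "real^'n"
  assumes "M > 0" and n: "CARD('n) \<ge> 2"
  shows "integrable lborel (\<lambda>y. log_weight M p y ^ CARD('n))"
proof (rule integrableI_bounded)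
  let ?n = "CARD('n)"
  define V where "V = unit_ball_vol (real ?n)"
  define c where "c k = (exp (real k + 1) / (M * (1 + real k))) ^ ?n" for k :: nat
  define r where "r k = M * exp (- real k)" for k :: nat
  have r: "r k > 0" for k using assms by (simp add: r_def)
  have c: "c k \<ge> 0" for k using assms by (simp add: c_def)
  have [measurable]: "cball p (r k) \<in> sets borel" for k by simp
  \<comment> \<open>Full balls replace the annuli in the majorant: \<open>c k\<close> grows like
    \<open>exp (n * k) / (1 + k) ^ n\<close>, and the volume of the \<open>k\<close>-th ball removes
    exactly the exponential.\<close>
  have "(\<integral>\<^sup>+ y. ennreal (norm (log_weight M p y ^ ?n)) \<partial>lborel) \<le>
      (\<integral>\<^sup>+ y. (\<Sum>k. ennreal (c k) * indicator (cball p (r k)) y) \<partial>lborel)"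
  proof (rule nn_integral_mono)
    fix y
    show "ennreal (norm (log_weight M p y ^ ?n)) \<le> (\<Sum>k. ennreal (c k) * indicator (cball p (r k)) y)"
    proof (cases "0 < norm (y - p) \<and> norm (y - p) \<le> M")
      case True
      then obtain k where k: "norm (y - p) \<le> r k" "log_weight M p y \<le> exp (real k + 1) / (M * (1 + real k))"
        using log_weight_le_exp[OF assms(1)] unfolding r_def by blast
      have "log_weight M p y ^ ?n \<le> c k"
        unfolding c_def by (intro power_mono k log_weight_nonneg)
      then have "ennreal (norm (log_weight M p y ^ ?n)) \<le> ennreal (c k)"
        by (intro ennreal_leI) (simp add: log_weight_nonneg)
      also have "\<dots> = ennreal (c k) * indicator (cball p (r k)) y"
        using k(1) by (simp add: dist_norm norm_minus_commute)
      also have "\<dots> \<le> (\<Sum>k. ennreal (c k) * indicator (cball p (r k)) y)"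
      proof -
        define a :: "nat \<Rightarrow> ennreal" where "a k = ennreal (c k) * indicator (cball p (r k)) y" for k
        have "a k \<le> (\<Sum>k. a k)" using sum_le_suminf[of a "{k}"] by simp
        then show ?thesis by (simp only: a_def)
      qed
      finally show ?thesis .
    next
      case False
      then have "log_weight M p y = 0" by (auto simp: log_weight_def)
      then show ?thesis by (simp add: zero_power)
    qed
  qed
  also have "\<dots> = (\<Sum>k. \<integral>\<^sup>+ y. ennreal (c k) * indicator (cball p (r k)) y \<partial>lborel)"
    by (rule nn_integral_suminf) measurable
  also have "\<dots> = (\<Sum>k. ennreal (V * exp 1 ^ ?n * (1 / (1 + real k) ^ ?n)))"
  proof (rule suminf_cong)
    fix k
    have "(\<integral>\<^sup>+ y. ennreal (c k) * indicator (cball p (r k)) y \<partial>lborel) = ennreal (c k) * ennreal (V * r k ^ ?n)"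
      using r[of k] by (subst nn_integral_cmult) (auto simp: emeasure_cball V_def)
    also have "\<dots> = ennreal (c k * (V * r k ^ ?n))"
      using c[of k] r[of k] by (intro ennreal_mult[symmetric]) (auto simp: V_def)
    also have "c k * (V * r k ^ ?n) = V * (exp (real k + 1) / (M * (1 + real k)) * r k) ^ ?n"
      unfolding c_def by (subst power_mult_distrib) (rule mult.left_commute)
    also have "exp (real k + 1) / (M * (1 + real k)) * r k = exp 1 * (1 / (1 + real k))"
    proof -
      have "exp (real k + 1) * exp (- real k) = exp 1" by (simp flip: exp_add)
      moreover have "exp (real k + 1) / (M * (1 + real k)) * r k =
          exp (real k + 1) * exp (- real k) * (M / (M * (1 + real k)))"
        by (simp add: r_def)
      ultimately show ?thesis using assms(1) by simp
    qed
    finally show "(\<integral>\<^sup>+ y. ennreal (c k) * indicator (cball p (r k)) y \<partial>lborel) =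
        ennreal (V * exp 1 ^ ?n * (1 / (1 + real k) ^ ?n))"
      by (simp add: power_mult_distrib power_divide)
  qed
  also have "\<dots> < \<infinity>"
  proof -
    have "summable (\<lambda>k. 1 / (1 + real k) ^ ?n)"
    proof (rule summable_comparison_test)
      show "summable (\<lambda>k. inverse (real (Suc k) ^ 2))"
        using inverse_power_summable[of 2, where 'a = real] by (subst summable_Suc_iff) simp
      have "norm (1 / (1 + real k) ^ ?n) \<le> inverse (real (Suc k) ^ 2)" for k
      proof -
        have "(1 + real k) ^ 2 \<le> (1 + real k) ^ ?n" using n by (intro power_increasing) auto
        then show ?thesis by (simp add: divide_simps)
      qed
      then show "\<exists>N. \<forall>k\<ge>N. norm (1 / (1 + real k) ^ ?n) \<le> inverse (real (Suc k) ^ 2)" by blast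
    qed
    then have "summable (\<lambda>k. V * exp 1 ^ ?n * (1 / (1 + real k) ^ ?n))" by (rule summable_mult)
    then show ?thesis
      by (subst suminf_ennreal2) (auto simp: V_def)
  qed
  finally show "(\<integral>\<^sup>+ y. ennreal (norm (log_weight M p y ^ ?n)) \<partial>lborel) < \<infinity>" .
qed measurable

lemma log_gauge_radial_derivative:
  assumes "0 < s" "s \<le> M"
  shows "((\<lambda>s. ln (1 + ln (M / s))) has_real_derivative - (1 / (s * (1 + ln (M / s))))) (at s)"
proof -
  have "0 \<le> ln (M / s)" using assms by simp
  then have "1 + ln (M / s) > 0" by linarith
  then show ?thesis
    using assms by (auto intro!: derivative_eq_intros simp: field_simps power2_eq_square)
qed

lemma log_gauge_has_derivative:
  assumes "0 < norm (y - p)" "norm (y - p) \<le> M"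
  shows "(log_gauge M p has_derivative (\<lambda>h. - log_weight M p y * (h \<bullet> sgn (y - p)))) (at y)"
proof -
  have "((\<lambda>y. norm (y - p)) has_derivative (\<lambda>h. h \<bullet> sgn (y - p))) (at y)"
  proof -
    have "((\<lambda>y. y - p) has_derivative (\<lambda>h. h)) (at y)"
      by (auto intro!: derivative_eq_intros)
    moreover have "y - p \<noteq> 0" using assms(1) by auto
    ultimately show ?thesis using has_derivative_compose has_derivative_norm by blast
  qed
  moreover have "((\<lambda>s. ln (1 + ln (M / s))) has_derivative (\<lambda>h. h * - log_weight M p y)) (at (norm (y - p)))"
  proof -
    have "(*) (- (1 / (norm (y - p) * (1 + ln (M / norm (y - p)))))) = (\<lambda>h. h * - log_weight M p y)"
      using assms by (auto simp: fun_eq_iff log_weight_def)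
    then show ?thesis
      using log_gauge_radial_derivative[OF assms] by (simp only: has_field_derivative_def)
  qed
  ultimately have "((\<lambda>y. ln (1 + ln (M / norm (y - p)))) has_derivative
      (\<lambda>h. (h \<bullet> sgn (y - p)) * - log_weight M p y)) (at y)"
    by (rule has_derivative_compose)
  then show ?thesis by (simp add: log_gauge_def[abs_def] mult.commute)
qed

text \<open>The distance to \<open>p\<close> is 1-Lipschitz, and the radial profile has slope at
  most \<open>1 / s \<le> 1 / m\<close> in modulus on \<open>{m..M}\<close>.\<close>

lemma log_gauge_lipschitz:
  assumes "0 < m" and T: "\<And>y. y \<in> T \<Longrightarrow> m \<le> norm (y - p) \<and> norm (y - p) \<le> M"
  shows "(1 / m)-lipschitz_on T (log_gauge M p)"
proof -
  have "(1 / m)-lipschitz_on {m..M} (\<lambda>s. ln (1 + ln (M / s)))"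
  proof (rule bounded_derivative_imp_lipschitz)
    fix s assume s: "s \<in> {m..M}"
    then have "0 < s" "s \<le> M" using assms(1) by auto
    from log_gauge_radial_derivative[OF this]
    show "((\<lambda>s. ln (1 + ln (M / s))) has_derivative (\<lambda>h. - (1 / (s * (1 + ln (M / s)))) * h)) (at s within {m..M})"
      unfolding has_field_derivative_def by (rule has_derivative_at_withinI)
    have "0 \<le> ln (M / s)" using \<open>0 < s\<close> \<open>s \<le> M\<close> by simp
    then have "m \<le> s * (1 + ln (M / s))"
    proof -
      have "m \<le> s * 1" using s by simp
      also have "\<dots> \<le> s * (1 + ln (M / s))"
        using \<open>0 < s\<close> \<open>0 \<le> ln (M / s)\<close> by (intro mult_left_mono) auto
      finally show ?thesis .
    qed
    then have le: "\<bar>- (1 / (s * (1 + ln (M / s))))\<bar> \<le> 1 / m"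
      using assms(1) by (simp add: frac_le)
    show "onorm (\<lambda>h. - (1 / (s * (1 + ln (M / s)))) * h) \<le> 1 / m"
    proof (rule onorm_le)
      fix h :: real
      show "norm (- (1 / (s * (1 + ln (M / s)))) * h) \<le> 1 / m * norm h"
        unfolding real_norm_def abs_mult by (intro mult_right_mono le) simp
    qed
  qed (use assms in auto)
  then have "(1 / m)-lipschitz_on ((\<lambda>y. norm (y - p)) ` T) (\<lambda>s. ln (1 + ln (M / s)))"
    by (rule lipschitz_on_subset) (use T in auto)
  moreover have "1-lipschitz_on T (\<lambda>y. norm (y - p))"
    by (rule lipschitz_onI) (auto simp: dist_norm intro: order_trans[OF norm_triangle_ineq3])
  ultimately have "(1 / m * 1)-lipschitz_on T (\<lambda>y. ln (1 + ln (M / norm (y - p))))"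
    by (rule lipschitz_on_compose2[rotated])
  then show ?thesis by (simp add: log_gauge_def[abs_def])
qed

text \<open>A pointwise substitute for Hoelder's inequality along rays.\<close>

lemma le_add_of_power_eq:
  fixes P a q :: real
  assumes "0 \<le> a" "0 \<le> q" "0 \<le> P" and eq: "P ^ Suc n = a * q ^ n"
  shows "P \<le> a + q"
proof (cases "P \<le> q")
  case False
  then have "q ^ n \<le> P ^ n" using assms by (intro power_mono) auto
  then have "P * P ^ n \<le> a * P ^ n" using eq assms by (simp add: mult_left_mono)
  moreover have "P ^ n > 0" using False assms by simp
  ultimately show ?thesis using assms by simp
qed (use assms in simp)

text \<open>Solving \<open>ln (1 + ln (M / s)) \<le> c\<close> for \<open>s\<close>. A bound on the
  gauge thus keeps a positive distance from \<open>p\<close>.\<close>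

lemma log_gauge_le_imp_norm_ge:
  assumes "M > 0" "0 < norm (y - p)" "norm (y - p) \<le> M" and le: "log_gauge M p y \<le> c"
  shows "norm (y - p) \<ge> M * exp (1 - exp c)"
proof -
  have L: "0 \<le> ln (M / norm (y - p))" using assms by simp
  then have "1 + ln (M / norm (y - p)) \<le> exp c"
    using le exp_le_cancel_iff[of "ln (1 + ln (M / norm (y - p)))" c] unfolding log_gauge_def
    by (simp add: add_pos_nonneg)
  then have "ln (M / norm (y - p)) \<le> exp c - 1" by simp
  then have "M / norm (y - p) \<le> exp (exp c - 1)"
    using exp_le_cancel_iff[of "ln (M / norm (y - p))" "exp c - 1"] exp_ln[of "M / norm (y - p)"] assms
    by (simp only: divide_pos_pos)
  then have "M \<le> exp (exp c - 1) * norm (y - p)"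
    using assms by (simp add: field_simps)
  then have "M * exp (1 - exp c) \<le> exp (exp c - 1) * norm (y - p) * exp (1 - exp c)"
    by (intro mult_right_mono) auto
  also have "\<dots> = norm (y - p)" by (simp add: exp_diff field_simps)
  finally show ?thesis .
qed

section \<open>Divergence of the radial integrals\<close>

lemma open_punctured_ball: "open (punctured_ball :: (real^'n) set)"
  unfolding punctured_ball_def
  by (intro open_Collect_conj open_Collect_less continuous_intros)

lemma compact_punctured_ball_positive:
  assumes "compact S" "S \<subseteq> (punctured_ball :: (real^'n) set)"
  shows "\<exists>\<epsilon>. 0 < \<epsilon> \<and> \<epsilon> < 1 \<and> (\<forall>x\<in>S. \<epsilon> < norm x)"
proof (cases "S = {}")
  case True
  then show ?thesis by (intro exI[of _ "1 / 2"]) auto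
next
  case False
  obtain x where x: "x \<in> S" "\<And>y. y \<in> S \<Longrightarrow> norm x \<le> norm y"
    using continuous_attains_inf[OF assms(1) False continuous_on_norm[OF continuous_on_id]] by auto
  then have "0 < norm x" "norm x < 1" using assms(2) by (auto simp: punctured_ball_def)
  show ?thesis
  proof (intro exI[of _ "norm x / 2"] conjI ballI)
    show "norm x / 2 < norm y" if "y \<in> S" for y
      using x(2)[OF that] \<open>0 < norm x\<close> by linarith
  qed (use \<open>0 < norm x\<close> \<open>norm x < 1\<close> in linarith)+
qed

text \<open>Difference quotients along a fixed sequence, since the limit of a sequence of Borel
  functions is again Borel.\<close>

lemma has_derivative_imp_limit_quotient:
  fixes f :: "'a::real_normed_vector \<Rightarrow> 'b::real_normed_vector"
  assumes "(f has_derivative f') (at x)"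
  shows "(\<lambda>k. real (Suc k) *\<^sub>R (f (x + (1 / real (Suc k)) *\<^sub>R v) - f x)) \<longlonglongrightarrow> f' v"
proof -
  have "((\<lambda>t::real. x + t *\<^sub>R v) has_derivative (\<lambda>t. t *\<^sub>R v)) (at 0)"
    by (auto intro!: derivative_eq_intros)
  moreover have "(f has_derivative f') (at (x + 0 *\<^sub>R v))" using assms by simp
  ultimately have "((\<lambda>t. f (x + t *\<^sub>R v)) has_derivative (\<lambda>t. f' (t *\<^sub>R v))) (at 0)"
    by (rule has_derivative_compose)
  then have "((\<lambda>t. norm (f (x + t *\<^sub>R v) - f x - f' (t *\<^sub>R v)) / norm t) \<longlongrightarrow> 0) (at 0)"
    by (simp add: has_derivative_at)
  moreover have "filterlim (\<lambda>k. 1 / real (Suc k)) (at 0) sequentially"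
    using LIMSEQ_inverse_real_of_nat by (auto simp: filterlim_at inverse_eq_divide)
  ultimately have "(\<lambda>k. norm (f (x + (1 / real (Suc k)) *\<^sub>R v) - f x - f' ((1 / real (Suc k)) *\<^sub>R v)) /
      norm (1 / real (Suc k))) \<longlonglongrightarrow> 0"
    by (rule filterlim_compose)
  moreover have "norm (f (x + (1 / real (Suc k)) *\<^sub>R v) - f x - f' ((1 / real (Suc k)) *\<^sub>R v)) / norm (1 / real (Suc k)) =
      norm (real (Suc k) *\<^sub>R (f (x + (1 / real (Suc k)) *\<^sub>R v) - f x) - f' v)" for k
  proof -
    have "real (Suc k) *\<^sub>R (f (x + (1 / real (Suc k)) *\<^sub>R v) - f x) - f' v =
        real (Suc k) *\<^sub>R (f (x + (1 / real (Suc k)) *\<^sub>R v) - f x - f' ((1 / real (Suc k)) *\<^sub>R v))"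
      using has_derivative_linear[OF assms] by (simp add: linear_cmul scaleR_diff_right)
    then show ?thesis by simp
  qed
  ultimately have "(\<lambda>k. norm (real (Suc k) *\<^sub>R (f (x + (1 / real (Suc k)) *\<^sub>R v) - f x) - f' v)) \<longlonglongrightarrow> 0"
    by (simp only:)
  then show ?thesis by (simp only: tendsto_norm_zero_iff LIM_zero_iff)
qed

lemma linear_eq_sum_axis:
  fixes L :: "real^'n \<Rightarrow> 'b::real_vector"
  assumes "linear L"
  shows "L v = (\<Sum>i\<in>UNIV. v $ i *\<^sub>R L (axis i 1))"
proof -
  have "v = (\<Sum>i\<in>UNIV. v $ i *\<^sub>R axis i 1)" by (simp add: vec_eq_iff axis_def if_distrib cong: if_cong)
  then have "L v = L (\<Sum>i\<in>UNIV. v $ i *\<^sub>R axis i 1)" by simp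
  then show ?thesis using assms by (simp add: linear_sum linear_cmul)
qed

text \<open>Borel representatives of the partial derivatives, used instead of the total derivative,
  which is only known to be Lebesgue measurable.\<close>

definition borel_partial :: "(real^'n \<Rightarrow> real^'n) \<Rightarrow> 'n \<Rightarrow> real^'n \<Rightarrow> real^'n" where
  "borel_partial f i x = lim (\<lambda>k. real (Suc k) *\<^sub>R (f (x + (1 / real (Suc k)) *\<^sub>R axis i 1) - f x))"

lemma borel_measurable_borel_partial [measurable]:
  assumes [measurable]: "f \<in> borel_measurable borel"
  shows "borel_partial f i \<in> borel_measurable borel"
  unfolding borel_partial_def[abs_def] by (intro borel_measurable_lim_metric) measurable

lemma borel_partial_eq:
  assumes "(f has_derivative f') (at x)"
  shows "borel_partial f i x = f' (axis i 1)"
  unfolding borel_partial_def by (intro limI has_derivative_imp_limit_quotient assms)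

text \<open>A length-volume argument in the metric with density \<open>log_weight\<close>: the image
  has finite volume, whereas the images of the rays end at \<open>p\<close> and have infinite
  length.\<close>

lemma AE_radial_integral_normal_dilatation_infinite:
  fixes f :: "real^'n \<Rightarrow> real^'n"
  assumes n: "CARD('n) \<ge> 2"
    and cont: "continuous_on punctured_ball f" and inj: "inj_on f punctured_ball"
    and reg: "AE x in lborel. x \<in> punctured_ball \<longrightarrow> regular_point f x"
    and qc: "\<And>\<epsilon>. 0 < \<epsilon> \<Longrightarrow> \<epsilon> < 1 \<Longrightarrow> \<exists>K G. {x. \<epsilon> < norm x \<and> norm x < 1} \<subseteq> G \<and> ACL_on f G \<and>
      (AE x in lborel. x \<in> G \<longrightarrow> dilatation f x \<le> K)"
    and p: "\<And>x. x \<in> punctured_ball \<Longrightarrow> f x \<noteq> p \<and> norm (f x - p) \<le> M"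
    and lim: "(f \<longlongrightarrow> p) (at 0)"
  shows "AE u in sphere_measure.
    (\<integral>\<^sup>+ t\<in>{0<..<1}. ennreal (normal_dilatation f (t *\<^sub>R u) / t) \<partial>lborel) = \<infinity>"
proof -
  let ?n = "CARD('n)" and ?B = "punctured_ball :: (real^'n) set"
  obtain m where m: "?n = Suc m" "m \<ge> 1" using n by (cases "?n") auto
  have M: "M > 0"
  proof -
    have "(1 / 2) *\<^sub>R axis undefined 1 \<in> ?B" by (simp add: punctured_ball_def norm_axis_1)
    from p[OF this] show ?thesis by (smt (verit) norm_le_zero_iff right_minus_eq)
  qed

  \<comment> \<open>Borel representatives and the set \<open>S\<close> of regular points\<close>
  have openB: "open ?B" by (rule open_punctured_ball)
  have [measurable]: "?B \<in> sets borel" using openB by simp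
  \<comment> \<open>Only the values of \<open>f\<close> on the open ball are known to be continuous;
    with 0 elsewhere the function is Borel on the whole space.\<close>
  define f0 where "f0 x = (if x \<in> ?B then f x else 0)" for x
  have [measurable]: "f0 \<in> borel_measurable borel"
    unfolding f0_def[abs_def]
    by (rule borel_measurable_continuous_on_if) (use cont in auto)
  define \<rho> where "\<rho> x = log_weight M p (f0 x)" for x
  have [measurable]: "\<rho> \<in> borel_measurable borel" unfolding \<rho>_def[abs_def] by measurable
  have \<rho>0: "\<rho> x \<ge> 0" for x by (simp add: \<rho>_def log_weight_nonneg)
  define D where "D i x = borel_partial f0 i x" for i x
  have [measurable]: "D i \<in> borel_measurable borel" for i unfolding D_def[abs_def] by measurable
  define J where "J x = det (\<chi> r c. D c x $ r)" for x
  have [measurable]: "J \<in> borel_measurable borel"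
  proof -
    have [measurable]: "(\<lambda>x. D i x $ j) \<in> borel_measurable borel" for i j
      by (rule measurable_compose[of "D i" borel borel]) (auto intro!: borel_measurable_continuous_onI continuous_intros)
    show ?thesis unfolding J_def[abs_def] det_def by simp
  qed
  define N where "N x = norm (\<Sum>i\<in>UNIV. (x $ i / norm x) *\<^sub>R D i x)" for x
  have [measurable]: "N \<in> borel_measurable borel" unfolding N_def[abs_def] by measurable
  define Q where "Q x = (N x ^ ?n / J x) powr (1 / (real ?n - 1))" for x
  have [measurable]: "Q \<in> borel_measurable borel" unfolding Q_def[abs_def] by measurable
  define S where "S = {x \<in> ?B. regular_point f x}"
  have AE_S: "AE x in lborel. x \<in> ?B \<longrightarrow> x \<in> S"
    using reg by eventually_elim (simp add: S_def)
  \<comment> \<open>The set of regular points differs from the punctured ball by a subset of a null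
    set, which the completion makes measurable.\<close>
  have S_leb: "S \<in> sets lebesgue"
  proof -
    obtain Z where Z: "Z \<in> null_sets lborel" "\<And>x. x \<notin> Z \<Longrightarrow> x \<in> ?B \<longrightarrow> x \<in> S"
      using AE_E3[OF AE_S] by (metis DiffI UNIV_I space_borel space_lborel)
    have "?B - S \<subseteq> Z" using Z by blast
    then have "?B - S \<in> sets lebesgue"
      using Z(1) by (metis null_sets_completion_subset null_sets_completionI null_setsD2)
    moreover have "S = ?B - (?B - S)" by (auto simp: S_def)
    ultimately show ?thesis by (metis sets.Diff sets_completionI_sets sets_lborel \<open>?B \<in> sets borel\<close>)
  qed
  have der: "(f has_derivative frechet_derivative f (at x)) (at x)" if "x \<in> S" for x
    using that by (auto simp: S_def regular_point_def frechet_derivative_works)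
  have der0: "(f0 has_derivative frechet_derivative f (at x)) (at x)" if "x \<in> S" for x
    by (rule has_derivative_transform_within_open[OF der[OF that] openB])
      (use that in \<open>auto simp: S_def f0_def\<close>)
  have D: "D i x = frechet_derivative f (at x) (axis i 1)" if "x \<in> S" for i x
    unfolding D_def by (rule borel_partial_eq[OF der0[OF that]])
  have lin: "linear (frechet_derivative f (at x))" if "x \<in> S" for x
    using der[OF that] has_derivative_linear by blast
  have J: "J x = jacobian f x" "J x > 0" if "x \<in> S" for x
  proof -
    show "J x = jacobian f x" unfolding J_def jacobian_def matrix_def using D[OF that] by simp
    then show "J x > 0" using that by (simp add: S_def regular_point_def)
  qed
  have N: "N x = norm (frechet_derivative f (at x) (x /\<^sub>R norm x))" if "x \<in> S" for x
    unfolding N_def linear_eq_sum_axis[OF lin[OF that], of "x /\<^sub>R norm x"] D[OF that]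
    by (simp add: divide_inverse mult.commute)
  have Q: "Q x = normal_dilatation f x" if "x \<in> S" for x
    using that J(1)[OF that] N[OF that] by (simp add: Q_def normal_dilatation_def S_def)
  have \<rho>_pos: "0 < norm (f x - p)" "norm (f x - p) \<le> M" "f0 x = f x" if "x \<in> ?B" for x
    using p[OF that] that by (auto simp: f0_def)

  \<comment> \<open>The weighted volume of the image\<close>
  define H where "H x = ennreal (\<bar>J x\<bar> * \<rho> x ^ ?n) * indicator ?B x" for x
  have [measurable]: "H \<in> borel_measurable borel" unfolding H_def[abs_def] by measurable
  have int_w: "integrable lborel (\<lambda>y. log_weight M p y ^ ?n)"
    by (rule integrable_log_weight_power[OF M n])
  have H_fin: "(\<integral>\<^sup>+ x. H x \<partial>lborel) < \<infinity>"
  proof -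
    have "(\<integral>\<^sup>+ x. H x \<partial>lborel) \<le> (\<integral>\<^sup>+ y. ennreal (log_weight M p y ^ ?n) \<partial>lborel)"
    proof (rule change_of_variables_le[OF S_leb _ _ int_w])
      show "(f has_derivative frechet_derivative f (at x)) (at x within S)" if "x \<in> S" for x
        using der[OF that] by (rule has_derivative_at_withinI)
      show "inj_on f S" using inj by (rule inj_on_subset) (auto simp: S_def)
      show "AE x in lborel. H x = ennreal (indicator S x *
          (\<bar>det (matrix (frechet_derivative f (at x)))\<bar> * log_weight M p (f x) ^ ?n))"
        using AE_S
      proof eventually_elim
        case (elim x)
        show ?case
        proof (cases "x \<in> ?B")
          case True
          then have "x \<in> S" using elim by simp
          then show ?thesis
            using True J(1)[of x] by (simp add: H_def \<rho>_def jacobian_def \<rho>_pos)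
        next
          case False
          then have "x \<notin> S" by (simp add: S_def)
          then show ?thesis using False by (simp add: H_def)
        qed
      qed
    qed (auto simp: log_weight_nonneg)
    also have "\<dots> < \<infinity>"
      using int_w by (subst nn_integral_eq_integral) (auto simp: log_weight_nonneg)
    finally show ?thesis .
  qed

  \<comment> \<open>The gauge composed with \<open>f\<close>: derivative, integrability, and
    behaviour on axis-parallel lines\<close>
  define g where "g x = log_gauge M p (f x)" for x
  define d where "d i x = - \<rho> x * (D i x \<bullet> sgn (f0 x - p))" for i x
  have [measurable]: "d i \<in> borel_measurable borel" for i unfolding d_def[abs_def] by measurable
  have g_der: "(g has_derivative (\<lambda>h. - \<rho> x * (frechet_derivative f (at x) h \<bullet> sgn (f x - p)))) (at x)"
    if "x \<in> S" for x
  proof -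
    have "x \<in> ?B" using that by (simp add: S_def)
    from has_derivative_compose[OF der[OF that] log_gauge_has_derivative[OF \<rho>_pos(1,2)[OF this]]]
    show ?thesis using \<rho>_pos(3)[OF \<open>x \<in> ?B\<close>] by (simp add: g_def[abs_def] \<rho>_def)
  qed
  have d_abs: "\<bar>d i x\<bar> \<le> \<rho> x * norm (D i x)" for i x
  proof -
    have "\<bar>D i x \<bullet> sgn (f0 x - p)\<bar> \<le> norm (D i x) * norm (sgn (f0 x - p))"
      by (rule Cauchy_Schwarz_ineq2)
    also have "\<dots> \<le> norm (D i x) * 1" by (intro mult_left_mono) (auto simp: norm_sgn)
    finally show ?thesis using \<rho>0[of x] by (simp add: d_def abs_mult mult_left_mono)
  qed
  have cont_g: "continuous_on ?B g"
  proof -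
    have "continuous_on (f ` ?B) (log_gauge M p)"
    proof (rule continuous_at_imp_continuous_on, rule ballI)
      fix y assume "y \<in> f ` ?B"
      then show "isCont (log_gauge M p) y"
        using \<rho>_pos(1,2) log_gauge_has_derivative has_derivative_continuous by blast
    qed
    then show ?thesis unfolding g_def[abs_def] using cont continuous_on_compose2 by blast
  qed
  \<comment> \<open>On the shell the local bound of the dilatation gives \<open>(\<rho> x * norm (D
    i x)) ^ n \<le> K' * \<bar>J x\<bar> * \<rho> x ^ n\<close>, which is integrable by
    \<open>H_fin\<close>; \<open>y \<le> 1 + y ^ n\<close> for \<open>y \<ge> 0\<close> passes to
    the first power, the shell having finite measure.\<close>
  have d_int: "integrable lborel (\<lambda>x. indicator {x. \<alpha> \<le> norm x \<and> norm x \<le> \<beta>} x * d i x)"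
    if \<alpha>\<beta>: "0 < \<alpha>" "\<beta> < 1" for \<alpha> \<beta> i
  proof (rule integrableI_bounded)
    define Sh where "Sh = {x::real^'n. \<alpha> \<le> norm x \<and> norm x \<le> \<beta>}"
    have [measurable]: "Sh \<in> sets borel" unfolding Sh_def by measurable
    define \<epsilon> where "\<epsilon> = min \<alpha> 1 / 2"
    have \<epsilon>: "0 < \<epsilon>" "\<epsilon> < 1" "\<epsilon> < \<alpha>" using \<alpha>\<beta> by (auto simp: \<epsilon>_def min_def)
    obtain K G where KG: "{x. \<epsilon> < norm x \<and> norm x < 1} \<subseteq> G" "AE x in lborel. x \<in> G \<longrightarrow> dilatation f x \<le> K"
      using qc[OF \<epsilon>(1,2)] by blast
    define K' where "K' = max K 0"
    have "(\<integral>\<^sup>+ x. ennreal (norm (indicator Sh x * d i x)) \<partial>lborel) \<le>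
        (\<integral>\<^sup>+ x. indicator Sh x + ennreal K' * H x \<partial>lborel)"
    proof (rule nn_integral_mono_AE)
      show "AE x in lborel. ennreal (norm (indicator Sh x * d i x)) \<le> indicator Sh x + ennreal K' * H x"
        using AE_S KG(2)
      proof eventually_elim
        case (elim x)
        show ?case
        proof (cases "x \<in> Sh")
          case True
          then have xB: "x \<in> ?B" "x \<in> G"
            using \<alpha>\<beta> \<epsilon> KG(1) by (auto simp: Sh_def punctured_ball_def)
          then have xS: "x \<in> S" using elim by simp
          have "norm (D i x) \<le> onorm (frechet_derivative f (at x)) * norm (axis i (1::real) :: real^'n)"
            unfolding D[OF xS] using der[OF xS] has_derivative_bounded_linear by (intro onorm) blast
          then have "norm (D i x) \<le> onorm (frechet_derivative f (at x))" by (simp add: norm_axis_1)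
          then have "norm (D i x) ^ ?n \<le> onorm (frechet_derivative f (at x)) ^ ?n"
            by (intro power_mono) auto
          also have "\<dots> \<le> K * J x"
            using elim(2) xB J[OF xS] by (simp add: dilatation_def pos_divide_le_eq)
          also have "\<dots> \<le> K' * J x" using J(2)[OF xS] by (intro mult_right_mono) (auto simp: K'_def)
          finally have "norm (D i x) ^ ?n \<le> K' * J x" .
          then have "\<rho> x ^ ?n * norm (D i x) ^ ?n \<le> \<rho> x ^ ?n * (K' * J x)"
            using \<rho>0[of x] by (intro mult_left_mono) auto
          then have "(\<rho> x * norm (D i x)) ^ ?n \<le> K' * (\<bar>J x\<bar> * \<rho> x ^ ?n)"
            using J(2)[OF xS] by (simp add: power_mult_distrib mult_ac)
          moreover have "\<rho> x * norm (D i x) \<le> 1 + (\<rho> x * norm (D i x)) ^ ?n"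
          proof (cases "\<rho> x * norm (D i x) \<le> 1")
            case True
            then show ?thesis using \<rho>0[of x] by (simp add: add_increasing2)
          next
            case False
            then have "(\<rho> x * norm (D i x)) ^ 1 \<le> (\<rho> x * norm (D i x)) ^ ?n"
              using n by (intro power_increasing) auto
            then show ?thesis by simp
          qed
          ultimately have "\<bar>d i x\<bar> \<le> 1 + K' * (\<bar>J x\<bar> * \<rho> x ^ ?n)" using d_abs[of i x] by linarith
          then have "ennreal \<bar>d i x\<bar> \<le> ennreal (1 + K' * (\<bar>J x\<bar> * \<rho> x ^ ?n))" by (rule ennreal_leI)
          also have "\<dots> = 1 + ennreal K' * ennreal (\<bar>J x\<bar> * \<rho> x ^ ?n)"
            using \<rho>0[of x] by (subst ennreal_plus) (auto simp: K'_def ennreal_mult)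
          finally show ?thesis using True xB by (simp add: H_def)
        qed simp
      qed
    qed
    also have "\<dots> = (\<integral>\<^sup>+ x. indicator Sh x \<partial>lborel) + (\<integral>\<^sup>+ x. ennreal K' * H x \<partial>lborel)"
      by (rule nn_integral_add) measurable
    also have "\<dots> = emeasure lborel Sh + ennreal K' * (\<integral>\<^sup>+ x. H x \<partial>lborel)"
      by (simp add: nn_integral_cmult)
    also have "\<dots> < \<infinity>"
    proof -
      have "bounded Sh" by (rule bounded_subset[OF bounded_cball[of 0 \<beta>]]) (auto simp: Sh_def)
      then have "emeasure lborel Sh < \<infinity>" by (rule emeasure_bounded_finite)
      then show ?thesis using H_fin by (simp add: ennreal_mult_less_top)
    qed
    finally show "(\<integral>\<^sup>+ x. ennreal (norm (indicator {x. \<alpha> \<le> norm x \<and> norm x \<le> \<beta>} x * d i x)) \<partial>lborel) < \<infinity>"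
      unfolding Sh_def .
  qed measurable
  have line: "AE x in lborel. \<forall>s\<ge>0. x \<in> cbox l w \<longrightarrow> x + s *\<^sub>R axis i 1 \<in> cbox l w \<longrightarrow>
      ((\<lambda>t. d i (x + t *\<^sub>R axis i 1)) has_integral (g (x + s *\<^sub>R axis i 1) - g x)) {0..s}"
    if box: "cbox l w \<subseteq> ?B" for i l w
  proof -
    obtain \<epsilon> where \<epsilon>: "0 < \<epsilon>" "\<epsilon> < 1" "\<And>x. x \<in> cbox l w \<Longrightarrow> \<epsilon> < norm x"
      using compact_punctured_ball_positive[OF compact_cbox box] by blast
    obtain G where G: "{x. \<epsilon> < norm x \<and> norm x < 1} \<subseteq> G" "ACL_on f G" using qc[OF \<epsilon>(1,2)] by blast
    have boxG: "cbox l w \<subseteq> G" using box \<epsilon>(3) G(1) by (auto simp: punctured_ball_def)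
    \<comment> \<open>The gauge is Lipschitz only away from \<open>p\<close>; the image of the box
      is compact and omits \<open>p\<close>.\<close>
    have "\<exists>\<mu>>0. \<forall>x\<in>cbox l w. \<mu> \<le> norm (f x - p)"
    proof (cases "cbox l w = {}")
      case False
      have "continuous_on (cbox l w) (\<lambda>x. norm (f x - p))"
        by (intro continuous_intros continuous_on_subset[OF cont box])
      from continuous_attains_inf[OF compact_cbox False this] obtain z where z: "z \<in> cbox l w"
        "\<And>y. y \<in> cbox l w \<Longrightarrow> norm (f z - p) \<le> norm (f y - p)" by blast
      then show ?thesis using \<rho>_pos(1)[of z] box by blast
    qed (auto intro: exI[of _ 1])
    then obtain \<mu> where \<mu>: "\<mu> > 0" "\<And>x. x \<in> cbox l w \<Longrightarrow> \<mu> \<le> norm (f x - p)" by blast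
    have "(1 / \<mu>)-lipschitz_on (f ` cbox l w) (log_gauge M p)"
      using \<mu> \<rho>_pos(2) box by (intro log_gauge_lipschitz) auto
    moreover have "AE x in lborel. x \<in> cbox l w \<longrightarrow>
      ((\<lambda>s. log_gauge M p (f (x + s *\<^sub>R axis i 1))) has_real_derivative d i x) (at 0)"
      using AE_S
    proof eventually_elim
      case (elim x)
      show ?case
      proof
        assume "x \<in> cbox l w"
        then have xB: "x \<in> ?B" and xS: "x \<in> S" using elim box by auto
        have "((\<lambda>s::real. x + s *\<^sub>R axis i 1) has_derivative (\<lambda>s. s *\<^sub>R axis i 1)) (at 0)"
          by (auto intro!: derivative_eq_intros)
        moreover have "(g has_derivative (\<lambda>h. - \<rho> x * (frechet_derivative f (at x) h \<bullet> sgn (f x - p)))) (at (x + 0 *\<^sub>R axis i 1))"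
          using g_der[OF xS] by simp
        ultimately have "((\<lambda>s. g (x + s *\<^sub>R axis i 1)) has_derivative
            (\<lambda>s. - \<rho> x * (frechet_derivative f (at x) (s *\<^sub>R axis i 1) \<bullet> sgn (f x - p)))) (at 0)"
          by (rule has_derivative_compose)
        moreover have "(\<lambda>s. - \<rho> x * (frechet_derivative f (at x) (s *\<^sub>R axis i 1) \<bullet> sgn (f x - p))) = (*) (d i x)"
          using \<rho>_pos(3)[OF xB] by (simp add: fun_eq_iff d_def D[OF xS] linear_cmul[OF lin[OF xS]])
        ultimately show "((\<lambda>s. log_gauge M p (f (x + s *\<^sub>R axis i 1))) has_real_derivative d i x) (at 0)"
          by (simp add: has_field_derivative_def g_def)
      qed
    qed
    ultimately show ?thesis
      unfolding g_def by (rule ACL_line_fundamental_theorem[OF G(2) boxG])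
  qed

  \<comment> \<open>The pointwise bound for the radial derivative\<close>
  have pointwise: "\<bar>\<Sum>i\<in>UNIV. u $ i * d i (t *\<^sub>R u)\<bar> \<le>
      \<bar>J (t *\<^sub>R u)\<bar> * \<rho> (t *\<^sub>R u) ^ ?n * t ^ (?n - 1) + Q (t *\<^sub>R u) / t"
    if u: "norm u = 1" and t: "0 < t" and xS: "t *\<^sub>R u \<in> S" for t u
  proof -
    let ?x = "t *\<^sub>R u"
    define P where "P = \<rho> ?x * N ?x"
    have "norm ?x = t" using u t by simp
    then have Nsum: "N ?x = norm (\<Sum>i\<in>UNIV. u $ i *\<^sub>R D i ?x)" using t by (simp add: N_def)
    have "(\<Sum>i\<in>UNIV. u $ i * d i ?x) = - \<rho> ?x * ((\<Sum>i\<in>UNIV. u $ i *\<^sub>R D i ?x) \<bullet> sgn (f0 ?x - p))"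
      by (simp add: d_def inner_sum_left sum_distrib_left mult_ac sum_negf)
    then have "\<bar>\<Sum>i\<in>UNIV. u $ i * d i ?x\<bar> = \<rho> ?x * \<bar>(\<Sum>i\<in>UNIV. u $ i *\<^sub>R D i ?x) \<bullet> sgn (f0 ?x - p)\<bar>"
      using \<rho>0[of ?x] by (simp add: abs_mult)
    also have "\<dots> \<le> \<rho> ?x * (N ?x * norm (sgn (f0 ?x - p)))"
      unfolding Nsum using \<rho>0[of ?x] by (intro mult_left_mono Cauchy_Schwarz_ineq2)
    also have "\<dots> \<le> \<rho> ?x * (N ?x * 1)"
      using \<rho>0[of ?x] by (intro mult_left_mono) (auto simp: norm_sgn N_def)
    finally have le: "\<bar>\<Sum>i\<in>UNIV. u $ i * d i ?x\<bar> \<le> P" by (simp add: P_def)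
    have Jp: "J ?x > 0" by (rule J(2)[OF xS])
    \<comment> \<open>The power \<open>m = n - 1\<close> undoes the exponent
      \<open>1 / (n - 1)\<close> in \<open>Q\<close>; where \<open>N\<close> vanishes both sides are
      0, since \<open>0 powr r = 0\<close> and \<open>m \<ge> 1\<close>.\<close>
    have Qm: "Q ?x ^ m = N ?x ^ ?n / J ?x"
    proof (cases "N ?x = 0")
      case True
      then show ?thesis using m by (simp add: Q_def)
    next
      case False
      define y where "y = N ?x ^ ?n / J ?x"
      have "y > 0" using False Jp by (simp add: y_def N_def)
      then have "(y powr (1 / real m)) ^ m = (y powr (1 / real m)) powr real m"
        by (simp add: powr_realpow)
      also have "\<dots> = y powr (1 / real m * real m)" by (rule powr_powr)
      also have "\<dots> = y" using m(2) \<open>y > 0\<close> by simp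
      finally show ?thesis using m(1) by (simp add: Q_def y_def)
    qed
    have "P ^ Suc m = (J ?x * \<rho> ?x ^ ?n * t ^ m) * (Q ?x / t) ^ m"
      using Jp t Qm m(1) by (simp add: P_def power_mult_distrib power_divide)
    then have "P \<le> J ?x * \<rho> ?x ^ ?n * t ^ m + Q ?x / t"
      by (intro le_add_of_power_eq) (use \<rho>0[of ?x] Jp t in \<open>auto simp: P_def Q_def N_def\<close>)
    then show ?thesis using le Jp m(1) by simp
  qed

  \<comment> \<open>Divergence along almost every ray\<close>
  define a where "a k = 1 / (real k + 3)" for k :: nat
  have a: "0 < a k" "a k \<le> 1 / 2" for k by (auto simp: a_def field_simps)
  have a_lim: "a \<longlonglongrightarrow> 0" 
    using LIMSEQ_ignore_initial_segment[OF lim_inverse_n', of 3] by (simp add: a_def[abs_def] add.commute)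
  \<comment> \<open>The inner endpoint runs through a countable sequence, so that one null set of
    directions serves for all \<open>k\<close>.\<close>
  have "AE u in sphere_measure. ennreal \<bar>g ((1 / 2) *\<^sub>R u) - g (a k *\<^sub>R u)\<bar> \<le>
      (\<integral>\<^sup>+ t. ennreal \<bar>\<Sum>i\<in>UNIV. u $ i * d i (t *\<^sub>R u)\<bar> * indicator {a k..1 / 2} t \<partial>lborel)" for k
    by (rule AE_ray_increment_le[OF a _ cont_g d_int line]) auto
  then have "AE u in sphere_measure. \<forall>k. ennreal \<bar>g ((1 / 2) *\<^sub>R u) - g (a k *\<^sub>R u)\<bar> \<le>
      (\<integral>\<^sup>+ t. ennreal \<bar>\<Sum>i\<in>UNIV. u $ i * d i (t *\<^sub>R u)\<bar> * indicator {a k..1 / 2} t \<partial>lborel)"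
    by (simp add: AE_all_countable)
  moreover have "AE u in sphere_measure. AE t in lborel. 0 < t \<and> t < 1 \<longrightarrow> t *\<^sub>R u \<in> S"
    by (rule AE_polar[OF AE_S])
  moreover have "AE u in sphere_measure. (\<integral>\<^sup>+ t. H (t *\<^sub>R u) * radial_weight ?n t \<partial>lborel) < \<infinity>"
  proof (rule AE_polar_finite)
    have "(\<integral>\<^sup>+ x. H x * indicator ?B x \<partial>lborel) \<le> (\<integral>\<^sup>+ x. H x \<partial>lborel)"
      by (intro nn_integral_mono) (auto simp: indicator_def)
    then show "(\<integral>\<^sup>+ x. H x * indicator ?B x \<partial>lborel) < \<infinity>" using H_fin by simp
  qed measurable
  moreover have "AE u in (sphere_measure :: (real^'n) measure). norm u = 1"
    by (rule AE_sphere_measure_norm)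
  ultimately show ?thesis
  proof eventually_elim
    case (elim u)
    define A where "A = (\<integral>\<^sup>+ t. H (t *\<^sub>R u) * radial_weight ?n t \<partial>lborel)"
    define B where "B = (\<integral>\<^sup>+ t\<in>{0<..<1}. ennreal (normal_dilatation f (t *\<^sub>R u) / t) \<partial>lborel)"
    have B_eq: "B = (\<integral>\<^sup>+ t. ennreal (Q (t *\<^sub>R u) / t) * indicator {0<..<1} t \<partial>lborel)"
      unfolding B_def
    proof (rule nn_integral_cong_AE)
      show "AE t in lborel. ennreal (normal_dilatation f (t *\<^sub>R u) / t) * indicator {0<..<1} t =
          ennreal (Q (t *\<^sub>R u) / t) * indicator {0<..<1} t"
        using elim(2) by eventually_elim (auto simp: Q indicator_def)
    qed
    have le: "ennreal \<bar>g ((1 / 2) *\<^sub>R u) - g (a k *\<^sub>R u)\<bar> \<le> A + B" for k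
    proof -
      have "ennreal \<bar>g ((1 / 2) *\<^sub>R u) - g (a k *\<^sub>R u)\<bar> \<le>
          (\<integral>\<^sup>+ t. ennreal \<bar>\<Sum>i\<in>UNIV. u $ i * d i (t *\<^sub>R u)\<bar> * indicator {a k..1 / 2} t \<partial>lborel)"
        using elim(1) by blast
      also have "\<dots> \<le> (\<integral>\<^sup>+ t. H (t *\<^sub>R u) * radial_weight ?n t +
          ennreal (Q (t *\<^sub>R u) / t) * indicator {0<..<1} t \<partial>lborel)"
      proof (rule nn_integral_mono_AE)
        show "AE t in lborel. ennreal \<bar>\<Sum>i\<in>UNIV. u $ i * d i (t *\<^sub>R u)\<bar> * indicator {a k..1 / 2} t \<le>
          H (t *\<^sub>R u) * radial_weight ?n t +
          ennreal (Q (t *\<^sub>R u) / t) * indicator {0<..<1} t"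
          using elim(2)
        proof eventually_elim
          case (elim t)
          show ?case
          proof (cases "t \<in> {a k..1 / 2}")
            case True
            then have t: "0 < t" "t < 1" using a[of k] by auto
            then have xS: "t *\<^sub>R u \<in> S" using elim by blast
            then have xB: "t *\<^sub>R u \<in> ?B" by (simp add: S_def)
            have "ennreal \<bar>\<Sum>i\<in>UNIV. u $ i * d i (t *\<^sub>R u)\<bar> \<le>
                ennreal (\<bar>J (t *\<^sub>R u)\<bar> * \<rho> (t *\<^sub>R u) ^ ?n * t ^ (?n - 1) + Q (t *\<^sub>R u) / t)"
              by (intro ennreal_leI pointwise \<open>norm u = 1\<close> t(1) xS)
            also have "\<dots> = ennreal (\<bar>J (t *\<^sub>R u)\<bar> * \<rho> (t *\<^sub>R u) ^ ?n) * ennreal (t ^ (?n - 1)) + ennreal (Q (t *\<^sub>R u) / t)"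
              using t \<rho>0 by (subst ennreal_plus) (auto simp: Q_def ennreal_mult)
            finally show ?thesis using True t xB by (simp add: H_def)
          qed simp
        qed
      qed
      also have "\<dots> = A + B" unfolding A_def B_eq by (rule nn_integral_add) measurable
      finally show ?thesis .
    qed
    show ?case unfolding B_def[symmetric]
    \<comment> \<open>If \<open>B\<close> were finite, the gauge would stay bounded along the points
      \<open>a k *\<^sub>R u\<close>, which would keep their images at a fixed positive distance
      from \<open>p\<close>, contrary to \<open>lim\<close>.\<close>
    proof (rule ccontr)
      assume "B \<noteq> \<infinity>"
      then have "A + B < \<infinity>" using elim(3) by (simp add: A_def less_top)
      then obtain c where c: "A + B = ennreal c" "c \<ge> 0" by (cases "A + B") auto
      define c' where "c' = g ((1 / 2) *\<^sub>R u) + c"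
      have "M * exp (1 - exp c') \<le> norm (f (a k *\<^sub>R u) - p)" for k
      proof -
        have xB: "a k *\<^sub>R u \<in> ?B" 
        proof -
          have "norm (a k *\<^sub>R u) = a k" using a[of k] elim(4) by simp
          then show ?thesis using a[of k] unfolding punctured_ball_def mem_Collect_eq by linarith
        qed
        have "\<bar>g ((1 / 2) *\<^sub>R u) - g (a k *\<^sub>R u)\<bar> \<le> c"
          using le[of k] c by (simp add: ennreal_le_iff)
        then have "log_gauge M p (f (a k *\<^sub>R u)) \<le> c'" by (simp add: c'_def g_def)
        then show ?thesis using \<rho>_pos[OF xB] M by (intro log_gauge_le_imp_norm_ge)
      qed
      moreover have "(\<lambda>k. norm (f (a k *\<^sub>R u) - p)) \<longlonglongrightarrow> norm (p - p)"
      proof (intro tendsto_intros)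
        have "filterlim (\<lambda>k. a k *\<^sub>R u) (at 0) sequentially"
          unfolding filterlim_at using tendsto_scaleR[OF a_lim tendsto_const[of u]] a elim(4)
          by (auto simp: less_imp_neq[symmetric])
        then show "(\<lambda>k. f (a k *\<^sub>R u)) \<longlonglongrightarrow> p" by (rule filterlim_compose[OF lim])
      qed
      ultimately have "M * exp (1 - exp c') \<le> norm (p - p)"
        by (intro LIMSEQ_le_const) auto
      then show False using M by (simp add: mult_le_0_iff)
    qed
  qed
qed

section \<open>Cavitation\<close>

text \<open>Compactness of the unit sphere gives a collar inside \<open>G\<close>, where a point
  beyond the sphere is at distance \<open>norm x - 1\<close> from its radial projection. Continuity
  and injectivity hold on each region \<open>norm x > \<epsilon>\<close>; they carry over because
  any one or two points lie in a common region.\<close>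

lemma locally_qc_embedding_extension:
  fixes f :: "real^'n \<Rightarrow> real^'n"
  assumes "locally_qc_embedding f"
  obtains F R where "R > 1" "\<And>x. x \<in> punctured_cball \<Longrightarrow> F x = f x"
    and "continuous_on {x. 0 < norm x \<and> norm x < R} F"
    and "inj_on F {x. 0 < norm x \<and> norm x < R}"
    and "\<And>\<epsilon>. 0 < \<epsilon> \<Longrightarrow> \<epsilon> < 1 \<Longrightarrow> \<exists>K G. {x. \<epsilon> < norm x \<and> norm x < 1} \<subseteq> G \<and> ACL_on F G \<and>
      (AE x in lborel. x \<in> G \<longrightarrow> dilatation F x \<le> K)"
proof -
  obtain G F where G: "is_domain G" "punctured_cball \<subseteq> G" and F: "\<And>x. x \<in> punctured_cball \<Longrightarrow> F x = f x"
    and qc: "\<And>\<epsilon>. 0 < \<epsilon> \<Longrightarrow> \<epsilon> < 1 \<Longrightarrow> quasiconformal F {x \<in> G. norm x > \<epsilon>} (F ` {x \<in> G. norm x > \<epsilon>})"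
    using assms unfolding locally_qc_embedding_def by blast
  have "open G" using G(1) by (simp add: is_domain_def)
  moreover have "sphere 0 1 \<subseteq> G" using G(2) by (auto simp: punctured_cball_def)
  ultimately obtain e where e: "e > 0" "(\<Union>z\<in>sphere 0 1. ball z e) \<subseteq> G"
    using compact_subset_open_imp_ball_epsilon_subset[of "sphere 0 1" G] by (metis compact_sphere)
  define U where "U = {x::real^'n. 0 < norm x \<and> norm x < 1 + e}"
  have "U \<subseteq> G"
  proof
    fix x assume x: "x \<in> U"
    show "x \<in> G"
    proof (cases "norm x \<le> 1")
      case True
      then show ?thesis using x G(2) by (auto simp: U_def punctured_cball_def)
    next
      case False
      then have "x \<noteq> 0" by auto
      have "dist (x /\<^sub>R norm x) x = norm ((1 / norm x - 1) *\<^sub>R x)"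
        unfolding dist_norm by (simp add: scaleR_diff_left divide_inverse)
      also have "\<dots> = (1 - 1 / norm x) * norm x"
      proof -
        have "1 / norm x \<le> 1" using False by (simp add: divide_le_eq_1)
        then show ?thesis unfolding norm_scaleR by simp
      qed
      also have "\<dots> = norm x - 1" using \<open>x \<noteq> 0\<close> by (simp add: left_diff_distrib)
      finally have "x \<in> ball (x /\<^sub>R norm x) e" using x by (simp add: U_def)
      moreover have "x /\<^sub>R norm x \<in> sphere 0 1" using \<open>x \<noteq> 0\<close> by simp
      ultimately show ?thesis using e by blast
    qed
  qed
  have hom: "\<exists>g. homeomorphism {x \<in> G. norm x > \<epsilon>} (F ` {x \<in> G. norm x > \<epsilon>}) F g" if "0 < \<epsilon>" "\<epsilon> < 1" for \<epsilon>
    using qc[OF that] unfolding quasiconformal_def quasiconformal_with_def by blast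
  have "continuous_on U F"
  proof (rule continuous_at_imp_continuous_on, rule ballI)
    fix x assume x: "x \<in> U"
    define \<epsilon> where "\<epsilon> = min (norm x) 1 / 2"
    have \<epsilon>: "0 < \<epsilon>" "\<epsilon> < 1" "\<epsilon> < norm x" using x by (auto simp: \<epsilon>_def U_def min_def)
    have "continuous_on {x \<in> G. norm x > \<epsilon>} F" using hom[OF \<epsilon>(1,2)] by (auto simp: homeomorphism_def)
    moreover have "open {x \<in> G. norm x > \<epsilon>}"
    proof -
      have "{x \<in> G. norm x > \<epsilon>} = G \<inter> {x. \<epsilon> < norm x}" by auto
      then show ?thesis using \<open>open G\<close> by (auto intro!: open_Int open_Collect_less continuous_intros)
    qed
    ultimately show "isCont F x"
      using x \<open>U \<subseteq> G\<close> \<epsilon>(3) continuous_on_eq_continuous_at by blast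
  qed
  moreover have "inj_on F U"
  proof (rule inj_onI)
    fix x y assume xy: "x \<in> U" "y \<in> U" "F x = F y"
    define \<mu> where "\<mu> = min (min (norm x) (norm y)) 1"
    have "0 < \<mu>" "\<mu> \<le> norm x" "\<mu> \<le> norm y" "\<mu> \<le> 1" using xy by (auto simp: \<mu>_def U_def)
    then obtain \<epsilon> where \<epsilon>: "0 < \<epsilon>" "\<epsilon> < 1" "\<epsilon> < norm x" "\<epsilon> < norm y"
      using dense[of 0 \<mu>] by (meson order_less_le_trans)
    obtain g where g: "homeomorphism {x \<in> G. norm x > \<epsilon>} (F ` {x \<in> G. norm x > \<epsilon>}) F g"
      using hom[OF \<epsilon>(1,2)] by blast
    have "x \<in> {x \<in> G. norm x > \<epsilon>}" "y \<in> {x \<in> G. norm x > \<epsilon>}"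
      using xy \<open>U \<subseteq> G\<close> \<epsilon> by auto
    then have "g (F x) = x" "g (F y) = y" using homeomorphism_apply1[OF g] by auto
    then show "x = y" using xy(3) by metis
  qed
  moreover have "\<exists>K G. {x. \<epsilon> < norm x \<and> norm x < 1} \<subseteq> G \<and> ACL_on F G \<and>
      (AE x in lborel. x \<in> G \<longrightarrow> dilatation F x \<le> K)" if \<epsilon>: "0 < \<epsilon>" "\<epsilon> < 1" for \<epsilon>
  proof -
    obtain K where K: "ACL_on F {x \<in> G. norm x > \<epsilon>}" "AE x in lebesgue. x \<in> {x \<in> G. norm x > \<epsilon>} \<longrightarrow>
        F differentiable (at x) \<and> jacobian F x \<noteq> 0 \<and> dilatation F x \<le> K"
      using qc[OF \<epsilon>] unfolding quasiconformal_def quasiconformal_with_def by blast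
    have "AE x in lborel. x \<in> {x \<in> G. norm x > \<epsilon>} \<longrightarrow> dilatation F x \<le> K"
      using K(2) unfolding AE_completion_iff by eventually_elim blast
    moreover have "{x. \<epsilon> < norm x \<and> norm x < 1} \<subseteq> {x \<in> G. norm x > \<epsilon>}"
    proof
      fix x :: "real^'n" assume "x \<in> {x. \<epsilon> < norm x \<and> norm x < 1}"
      then have "0 < norm x" "norm x \<le> 1" "\<epsilon> < norm x" using \<epsilon> unfolding mem_Collect_eq by linarith+
      then show "x \<in> {x \<in> G. norm x > \<epsilon>}" using G(2) unfolding punctured_cball_def by blast
    qed
    ultimately show ?thesis using K(1) by blast
  qed
  ultimately show thesis using that[of "1 + e" F] e(1) F unfolding U_def by simp
qed

text \<open>Maps that agree near \<open>x\<close> have the same derivatives there, so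
  \<open>frechet_derivative\<close>, a choice among these, is the same for both even where none
  exists.\<close>

lemma regular_point_normal_dilatation_cong:
  fixes f F :: "real^'n \<Rightarrow> real^'n"
  assumes "open S" "x \<in> S" "\<And>y. y \<in> S \<Longrightarrow> F y = f y"
  shows "regular_point F x \<longleftrightarrow> regular_point f x" and "normal_dilatation F x = normal_dilatation f x"
proof -
  have der: "(F has_derivative D) (at x) \<longleftrightarrow> (f has_derivative D) (at x)" for D
    using has_derivative_transform_within_open[of F D x UNIV S f]
      has_derivative_transform_within_open[of f D x UNIV S F] assms by auto
  then have fd: "frechet_derivative F (at x) = frechet_derivative f (at x)"
    by (simp add: frechet_derivative_def)
  show r: "regular_point F x \<longleftrightarrow> regular_point f x"
    by (simp add: regular_point_def differentiable_def der jacobian_def fd)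
  show "normal_dilatation F x = normal_dilatation f x"
    by (simp add: normal_dilatation_def r jacobian_def fd)
qed

theorem theorem3p3:
  fixes f :: "real^'n \<Rightarrow> real^'n"
  assumes "CARD('n) \<ge> 2"
    and "locally_qc_embedding f"
    and "orientation_preserving_on f punctured_ball"
    and "nested_spheres f"
    and "I_Q f > 0"
  shows "admits_cavitation f"
proof -
  obtain F R where R: "R > 1" and Ff: "\<And>x. x \<in> punctured_cball \<Longrightarrow> F x = f x"
    and cont: "continuous_on {x. 0 < norm x \<and> norm x < R} F"
    and inj: "inj_on F {x. 0 < norm x \<and> norm x < R}"
    and qc: "\<And>\<epsilon>. 0 < \<epsilon> \<Longrightarrow> \<epsilon> < 1 \<Longrightarrow> \<exists>K G. {x. \<epsilon> < norm x \<and> norm x < 1} \<subseteq> G \<and> ACL_on F G \<and>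
      (AE x in lborel. x \<in> G \<longrightarrow> dilatation F x \<le> K)"
    by (rule locally_qc_embedding_extension[OF assms(2)]) (rule that)
  let ?B = "punctured_ball :: (real^'n) set"
  have FB: "F x = f x" if "x \<in> ?B" for x
    using that by (intro Ff) (auto simp: punctured_ball_def punctured_cball_def)
  have F_sphere: "F ` sphere 0 r = f ` sphere 0 r" if "0 < r" "r < 1" for r
    using that by (intro image_cong FB) (auto simp: punctured_ball_def)
  have FfB: "F ` ?B = f ` ?B" using FB by (rule image_cong[OF refl])
  have nest: "F ` sphere 0 r \<subseteq> inside (F ` sphere 0 s)" if "0 < r" "r < s" "s < 1" for r s
    using assms(4) that F_sphere unfolding nested_spheres_def by force
  have dim: "DIM(real^'n) \<ge> 2" using assms(1) by simp
  obtain C where C: "{D \<in> components (- (F ` ?B)). bounded D} = {C}" "compact C" "connected C" "C \<noteq> {}"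
    and bdd: "bounded (F ` ?B)" and lim: "\<And>y. C = {y} \<Longrightarrow> (F \<longlongrightarrow> y) (at 0)"
    by (rule punctured_ball_image_complement[OF dim R cont inj, folded punctured_ball_def])
      (rule nest, assumption+, rule that)
  have "\<exists>x\<in>C. \<exists>y\<in>C. x \<noteq> y"
  proof (rule ccontr)
    assume "\<not> (\<exists>x\<in>C. \<exists>y\<in>C. x \<noteq> y)"
    then obtain p where p: "C = {p}" using C(4) by blast
    have "p \<notin> F ` ?B" using C(1) p in_components_subset[of C "- (F ` ?B)"] by blast
    obtain M where M: "\<And>x. x \<in> ?B \<Longrightarrow> norm (F x - p) \<le> M"
      using bdd bounded_any_center[of "F ` ?B" p] by (auto simp: dist_norm norm_minus_commute)
    have sub: "?B \<subseteq> {x. 0 < norm x \<and> norm x < R}" using R by (auto simp: punctured_ball_def)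
    have reg: "AE x in lborel. x \<in> ?B \<longrightarrow> regular_point F x"
      using assms(3) unfolding orientation_preserving_on_def AE_completion_iff
    proof eventually_elim
      case (elim x)
      then show ?case
        using regular_point_normal_dilatation_cong(1)[OF open_punctured_ball _ FB, of x] by simp
    qed
    have "AE u in sphere_measure.
        (\<integral>\<^sup>+ t\<in>{0<..<1}. ennreal (normal_dilatation F (t *\<^sub>R u) / t) \<partial>lborel) = \<infinity>"
      using M \<open>p \<notin> F ` ?B\<close> lim[OF p]
      by (intro AE_radial_integral_normal_dilatation_infinite assms(1) reg qc
          continuous_on_subset[OF cont sub] inj_on_subset[OF inj sub]) auto
    moreover have "AE u in (sphere_measure :: (real^'n) measure). norm u = 1"
      by (rule AE_sphere_measure_norm)
    \<comment> \<open>The divergence is known for the extension \<open>F\<close>; it passes to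
      \<open>f\<close> because the two agree on the open punctured ball, which contains the points
      \<open>t *\<^sub>R u\<close> with \<open>0 < t < 1\<close>.\<close>
    ultimately have "AE u in sphere_measure.
        inverse (\<integral>\<^sup>+ t\<in>{0<..<1}. ennreal (normal_dilatation f (t *\<^sub>R u) / t) \<partial>lborel) ^ (CARD('n) - 1) = 0"
    proof eventually_elim
      case (elim u)
      have "(\<integral>\<^sup>+ t\<in>{0<..<1}. ennreal (normal_dilatation f (t *\<^sub>R u) / t) \<partial>lborel) =
          (\<integral>\<^sup>+ t\<in>{0<..<1}. ennreal (normal_dilatation F (t *\<^sub>R u) / t) \<partial>lborel)"
      proof (rule nn_integral_cong)
        fix t :: real
        have "normal_dilatation F (t *\<^sub>R u) = normal_dilatation f (t *\<^sub>R u)" if t: "t \<in> {0<..<1}"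
        proof (rule regular_point_normal_dilatation_cong(2)[OF open_punctured_ball _ FB])
          have "norm (t *\<^sub>R u) = t" using t elim(2) by simp
          then show "t *\<^sub>R u \<in> ?B"
            using t unfolding punctured_ball_def mem_Collect_eq greaterThanLessThan_iff by linarith
        qed
        then show "ennreal (normal_dilatation f (t *\<^sub>R u) / t) * indicator {0<..<1} t =
            ennreal (normal_dilatation F (t *\<^sub>R u) / t) * indicator {0<..<1} t"
          by (cases "t \<in> {0<..<1}") auto
      qed
      \<comment> \<open>Here \<open>inverse \<infinity> = 0\<close> is raised to the power
        \<open>n - 1\<close>, which is positive because \<open>n \<ge> 2\<close>.\<close>
      then show ?case using elim(1) assms(1) by (simp add: zero_power)
    qed
    then have "I_Q f = (\<integral>\<^sup>+ u. 0 \<partial>(sphere_measure :: (real^'n) measure))"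
      unfolding I_Q_def by (rule nn_integral_cong_AE)
    then show False using assms(5) by simp
  qed
  then show ?thesis
    using C unfolding admits_cavitation_def nondegenerate_continuum_def FfB by blast
qed

end
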